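(* Let $F$ be a surface-link. Let $(B,X,\underline{*},\overline{*},* )$ be a shadow biquandle such that $X$ is strongly connected, and let $(X,\{\underline{\star}\},\{\overline{\star}\})$ be the corresponding local biquandle of $(B,X)$. Let $\mu_3:C_3^{\rm SB}(B,X)\to C_3^{\rm LB}(X)$ be the bijective chain map given by $\mu_3\big((x,a_1,a_2,a_3)\big)=\big((x,x*a_1),(x,x*a_2),(x,x*a_3)\big)$, and let $\mu_3^*:H_3^{\rm SB}(B,X)\to H_3^{\rm LB}(X)$ be the induced isomorphism. Then, as multisets, $$\mathcal{H}^{\rm LB}(F)=\mu_3^*\big(\mathcal{H}^{\rm SB}(F)\big)\quad\text{and}\quad(\mu_3^* )^{-1}\big(\mathcal{H}^{\rm LB}(F)\big)=\mathcal{H}^{\rm SB}(F).$$ Moreover, for an abelian group $A$, let $\theta\in Z^3_{\rm SB}(B,X;A)$ and $\theta'\in Z^3_{\rm LB}(X;A)$ be such that $\theta=\theta'\circ\mu_3$. Then $$\Phi_\theta^{\rm SB}(F)=\Phi_{\theta'}^{\rm LB}(F).$$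
   Context: A biquandle is a set $B$ with binary operations $\underline{*},\overline{*}:B\times B\to B$ such that: (i) $a\,\underline{*}\,a=a\,\overline{*}\,a$ for all $a\in B$; (ii) for every $b\in B$ the maps $B\to B$, $a\mapsto a\,\underline{*}\,b$ and $a\mapsto a\,\overline{*}\,b$ are bijective, and the map $S:B\times B\to B\times B$, $S(a,b)=(b\,\overline{*}\,a,\;a\,\underline{*}\,b)$ is bijective; (iii) for all $a,b,c\in B$: $(a\underline{*}b)\underline{*}(c\underline{*}b)=(a\underline{*}c)\underline{*}(b\overline{*}c)$, $(a\underline{*}b)\overline{*}(c\underline{*}b)=(a\overline{*}c)\underline{*}(b\overline{*}c)$, $(a\overline{*}b)\overline{*}(c\overline{*}b)=(a\overline{*}c)\overline{*}(b\underline{*}c)$. A $B$-set is a set $X$ with a map $*:X\times B\to X$ such that for each $a\in B$ the map $X\to X$, $x\mapsto x*a$ is bijective, and $(x*a)*(b\,\overline{*}\,a)=(x*b)*(a\,\underline{*}\,b)$ for all $a,b\in B$, $x\in X$. A shadow biquandle $(B,X,\underline{*},\overline{*},* )$ is a pair of a biquandle $B$ and a $B$-set $X$. A $B$-set $X$ is strongly connected if for every $x\in X$ the map $B\to X$, $a\mapsto x*a$ is bijective; then for $x,y\in X$, $x\searrow y\in B$ denotes the unique element $a\in B$ with $x*a=y$. A horizontal-tribracket on a set $X$ is a ternary operation $[\,]:X^3\to X$ such that: (H1) in the equation $[x,y,z]=w$, any three of $x,y,z,w$ that include $w$ determine the remaining one uniquely (and it exists); (H2) $[y,[x,y,z],[x,y,w]]=[z,[x,y,z],[x,z,w]]=[w,[x,y,w],[x,z,w]]$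 for all $x,y,z,w\in X$. The local biquandle associated with $(X,[\,])$ consists of the operations, for each $x\in X$, $\underline{\star}_x,\overline{\star}_x:(\{x\}\times X)^2\to X^2$, $(x,y)\,\underline{\star}_x\,(x,z)=(z,[x,y,z])$, $(x,y)\,\overline{\star}_x\,(x,z)=(z,[x,z,y])$ (subscripts omitted). For a shadow biquandle $(B,X)$ with $X$ strongly connected, the corresponding horizontal-tribracket is $[x,y,z]=y*\big((x\searrow z)\overline{*}(x\searrow y)\big)=z*\big((x\searrow y)\underline{*}(x\searrow z)\big)$ (it is known that the two expressions agree and define a horizontal-tribracket), and the corresponding local biquandle of $(B,X)$ is the local biquandle associated with it. Chain complexes. $C_n^{\rm sb}(B,X)$ is the free $\mathbb{Z}$-module on $X\times B^n$ if $n\ge 1$ and $0$ otherwise, with $$\partial_n^{\rm sb}(x,a_1,\dots,a_n)=\sum_{i=1}^n(-1)^i\big\{(x,a_1,\dots,a_{i-1},a_{i+1},\dots,a_n)-(x*a_i,a_1\underline{*}a_i,\dots,a_{i-1}\underline{*}a_i,a_{i+1}\overline{*}a_i,\dots,a_n\overline{*}a_i)\big\}$$ for $n\ge 2$ and $0$ for $n\le 1$; $D_n^{\rm sb}(B,X)$ is the submodule generated by the $(x,a_1,\dots,a_n)$ with $a_i=a_{i+1}$ for some $i$; $C_n^{\rm SB}=C_n^{\rm sb}/D_n^{\rm sb}$ with induced boundary. $C_n^{\rm lb}(X)$ is the free $\mathbb{Z}$-module on $\{((x,y_1),\dots,(x,y_n)) : x,y_1,\dots,y_n\in X\}$ if $n\ge1$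 and $0$ otherwise, with $$\partial_n^{\rm lb}\big((x,y_1),\dots,(x,y_n)\big)=\sum_{i=1}^n(-1)^i\big\{\big((x,y_1),\dots,(x,y_{i-1}),(x,y_{i+1}),\dots,(x,y_n)\big)-\big((x,y_1)\underline{\star}(x,y_i),\dots,(x,y_{i-1})\underline{\star}(x,y_i),(x,y_{i+1})\overline{\star}(x,y_i),\dots,(x,y_n)\overline{\star}(x,y_i)\big)\big\}$$ for $n\ge2$ and $0$ otherwise; $D_n^{\rm lb}(X)$ is the submodule generated by the $((x,y_1),\dots,(x,y_n))$ with $y_i=y_{i+1}$ for some $i$; $C_n^{\rm LB}=C_n^{\rm lb}/D_n^{\rm lb}$ with induced boundary. $H_n^{\rm SB}(B,X)$, $H_n^{\rm LB}(X)$ are the homology groups; $Z^n_{\rm SB}(B,X;A)$, $Z^n_{\rm LB}(X;A)$ are the groups of $n$-cocycles, i.e. homomorphisms $f$ from $C_n^{\rm SB}(B,X)$, respectively $C_n^{\rm LB}(X)$, to $A$ with $f\circ\partial_{n+1}=0$. Diagrams. A surface-link is a disjoint union of oriented closed surfaces locally flatly embedded in $\mathbb{R}^4$; a diagram $D$ is its image under a regular projection to $\mathbb{R}^3$ with height information along double point curves (its points are regular points, double points, triple points and branch points). A diagram is connected if it is connected as a subset of $\mathbb{R}^3$. $\mathcal{SS}(D)$ is the set of semi-sheets (connected components of $D$ after removing small neighborhoods of the double point curves), $\mathcal{R}(D)$ the set of connected components of $\mathbb{R}^3\setminus D$. Each semi-sheet $s$ has a normal vector $n_s$ such that $(o_1,o_2,n_s)$,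 with $(o_1,o_2)$ the orientation of $D$, is the right-handed orientation of $\mathbb{R}^3$. Along a double point curve, let $r$ be the adjacent region from which the normal vectors of both sheets point away; $u_1$, $o_1$ are the under- and over-semi-sheets adjacent to $r$, and $u_2$, $o_2$ are the other under- and over-semi-sheets. At a triple point $\tau$, $r_1$ is the region from which the normal vectors of the bottom, middle and top sheets all point away, and $b_1,m_1,t_1$ are the bottom-, middle- and top-semi-sheets adjacent to $r_1$. ${\rm sign}(\tau)=\pm1$ is the usual sign of a triple point ($+1$ iff the normals of the top, middle, bottom sheets in this order form a right-handed frame). Shadow biquandle colorings. A $(B,X)$-coloring of $D$ is a map $C:\mathcal{SS}(D)\cup\mathcal{R}(D)\to B\cup X$ with $C(\mathcal{SS}(D))\subset B$, $C(\mathcal{R}(D))\subset X$, such that along each double point curve $C(u_2)=C(u_1)\underline{*}C(o_1)$ and $C(o_2)=C(o_1)\overline{*}C(u_1)$, and for each semi-sheet $s$ whose normal vector points from region $r_1$ to region $r_2$, $C(r_1)*C(s)=C(r_2)$. The set of them is ${\rm Col}^{\rm SB}_{(B,X)}(D)$. Put $W^{\rm SB}(D,C)=\sum_\tau{\rm sign}(\tau)\,(C(r_1),C(b_1),C(m_1),C(t_1))\in C_3^{\rm SB}(B,X)$, the sum over all triple points $\tau$ of $D$. Local biquandle colorings. An $X^2$-coloring of $D$ is a map $C:\mathcal{SS}(D)\to X^2$ such that along each double point curve $C(u_1)$ and $C(o_1)$ have the same first component, say $C(u_1)=(x,y)$, $C(o_1)=(x,z)$, and $C(u_2)=(x,y)\underline{\star}(x,z)=(z,[x,y,z])$,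 $C(o_2)=(x,z)\overline{\star}(x,y)=(y,[x,y,z])$. The set of them is ${\rm Col}^{\rm LB}_{X^2}(D)$. Put $W^{\rm LB}(D,C)=\sum_\tau{\rm sign}(\tau)\,(C(b_1),C(m_1),C(t_1))\in C_3^{\rm LB}(X)$. Invariants (multisets). For a connected diagram $D$ of $F$: $\mathcal{H}^{\rm SB}(F)=\{[W^{\rm SB}(D,C)]\in H_3^{\rm SB}(B,X) : C\in{\rm Col}^{\rm SB}_{(B,X)}(D)\}$, $\Phi_\theta^{\rm SB}(F)=\{\theta(W^{\rm SB}(D,C))\in A : C\in{\rm Col}^{\rm SB}_{(B,X)}(D)\}$, $\mathcal{H}^{\rm LB}(F)=\{[W^{\rm LB}(D,C)]\in H_3^{\rm LB}(X) : C\in{\rm Col}^{\rm LB}_{X^2}(D)\}$, $\Phi_{\theta'}^{\rm LB}(F)=\{\theta'(W^{\rm LB}(D,C))\in A : C\in{\rm Col}^{\rm LB}_{X^2}(D)\}$. It is known that these do not depend on the choice of connected diagram $D$ of $F$. Isomorphisms are applied to multisets elementwise. *)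

theory Defs
  imports "HOL-Analysis.Analysis" "HOL-Algebra.Free_Abelian_Groups" "HOL-Library.Multiset"
begin

section \<open>Shadow biquandles and local biquandles\<close>

text \<open>Below, \<open>ud\<close> is the operation with the underline and \<open>ov\<close> the one with the overline.\<close>

locale biquandle =
  fixes B :: "'b set"
    and ud :: "'b \<Rightarrow> 'b \<Rightarrow> 'b"
    and ov :: "'b \<Rightarrow> 'b \<Rightarrow> 'b"
  assumes ud_closed: "\<And>a b. a \<in> B \<Longrightarrow> b \<in> B \<Longrightarrow> ud a b \<in> B"
    and ov_closed: "\<And>a b. a \<in> B \<Longrightarrow> b \<in> B \<Longrightarrow> ov a b \<in> B"
    and diagonal: "\<And>a. a \<in> B \<Longrightarrow> ud a a = ov a a"
    and ud_bij: "\<And>b. b \<in> B \<Longrightarrow> bij_betw (\<lambda>a. ud a b) B B"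
    and ov_bij: "\<And>b. b \<in> B \<Longrightarrow> bij_betw (\<lambda>a. ov a b) B B"
    and switch_bij: "bij_betw (\<lambda>(a, b). (ov b a, ud a b)) (B \<times> B) (B \<times> B)"
    and exchange_uu: "\<And>a b c. a \<in> B \<Longrightarrow> b \<in> B \<Longrightarrow> c \<in> B \<Longrightarrow>
          ud (ud a b) (ud c b) = ud (ud a c) (ov b c)"
    and exchange_uo: "\<And>a b c. a \<in> B \<Longrightarrow> b \<in> B \<Longrightarrow> c \<in> B \<Longrightarrow>
          ov (ud a b) (ud c b) = ud (ov a c) (ov b c)"
    and exchange_oo: "\<And>a b c. a \<in> B \<Longrightarrow> b \<in> B \<Longrightarrow> c \<in> B \<Longrightarrow>
          ov (ov a b) (ov c b) = ov (ov a c) (ud b c)"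

locale shadow_biquandle = biquandle B ud ov
  for B :: "'b set"
    and ud :: "'b \<Rightarrow> 'b \<Rightarrow> 'b"
    and ov :: "'b \<Rightarrow> 'b \<Rightarrow> 'b" +
  fixes X :: "'x set"
    and act :: "'x \<Rightarrow> 'b \<Rightarrow> 'x"
  assumes act_closed: "\<And>x a. x \<in> X \<Longrightarrow> a \<in> B \<Longrightarrow> act x a \<in> X"
    and act_bij: "\<And>a. a \<in> B \<Longrightarrow> bij_betw (\<lambda>x. act x a) X X"
    and act_exchange: "\<And>x a b. x \<in> X \<Longrightarrow> a \<in> B \<Longrightarrow> b \<in> B \<Longrightarrow>
          act (act x a) (ov b a) = act (act x b) (ud a b)"

definition strongly_connected :: "'b set \<Rightarrow> 'x set \<Rightarrow> ('x \<Rightarrow> 'b \<Rightarrow> 'x) \<Rightarrow> bool" where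
  "strongly_connected B X act \<longleftrightarrow> (\<forall>x\<in>X. bij_betw (\<lambda>a. act x a) B X)"

definition arrow :: "'b set \<Rightarrow> ('x \<Rightarrow> 'b \<Rightarrow> 'x) \<Rightarrow> 'x \<Rightarrow> 'x \<Rightarrow> 'b" where
  "arrow B act x y = (THE a. a \<in> B \<and> act x a = y)"

definition tribracket_of ::
  "'b set \<Rightarrow> ('b \<Rightarrow> 'b \<Rightarrow> 'b) \<Rightarrow> ('x \<Rightarrow> 'b \<Rightarrow> 'x) \<Rightarrow> 'x \<Rightarrow> 'x \<Rightarrow> 'x \<Rightarrow> 'x" where
  "tribracket_of B ov act x y z = act y (ov (arrow B act x z) (arrow B act x y))"

lemma (in shadow_biquandle) tribracket_of_alt:
  assumes sc: "strongly_connected B X act" and "x \<in> X" "y \<in> X" "z \<in> X"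
  shows "tribracket_of B ov act x y z = act z (ud (arrow B act x y) (arrow B act x z))"
proof -
  have arr: "arrow B act x w \<in> B \<and> act x (arrow B act x w) = w" if "w \<in> X" for w
  proof -
    have b: "bij_betw (\<lambda>a. act x a) B X"
      using sc \<open>x \<in> X\<close> by (simp add: strongly_connected_def)
    have "\<exists>!a. a \<in> B \<and> act x a = w"
      using b that unfolding bij_betw_def inj_on_def by blast
    from theI'[OF this] show ?thesis by (simp add: arrow_def)
  qed
  show ?thesis
    unfolding tribracket_of_def
    using arr[OF \<open>y \<in> X\<close>] arr[OF \<open>z \<in> X\<close>]
      act_exchange[OF \<open>x \<in> X\<close>, of "arrow B act x y" "arrow B act x z"] by simp
qed

text \<open>The operations of the local biquandle associated with a tribracket \<open>br\<close>; they are only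
  used on pairs of pairs with equal first components.\<close>

definition lb_ud :: "('x \<Rightarrow> 'x \<Rightarrow> 'x \<Rightarrow> 'x) \<Rightarrow> 'x \<times> 'x \<Rightarrow> 'x \<times> 'x \<Rightarrow> 'x \<times> 'x" where
  "lb_ud br p q = (snd q, br (fst p) (snd p) (snd q))"

definition lb_ov :: "('x \<Rightarrow> 'x \<Rightarrow> 'x \<Rightarrow> 'x) \<Rightarrow> 'x \<times> 'x \<Rightarrow> 'x \<times> 'x \<Rightarrow> 'x \<times> 'x" where
  "lb_ov br p q = (snd q, br (fst p) (snd q) (snd p))"


section \<open>Chain complexes\<close>

text \<open>If \<open>h\<close> sends the elements of each coset \<open>K\<close> into a single \<open>H\<close>-coset, this is the
  induced map on cosets.\<close>

definition induced_map :: "('c, 'm) monoid_scheme \<Rightarrow> 'c set \<Rightarrow> ('d \<Rightarrow> 'c) \<Rightarrow> 'd set \<Rightarrow> 'c set" where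
  "induced_map G H h K = the_elem ((\<lambda>c. H #>\<^bsub>G\<^esub> h c) ` K)"

definition homology_grp :: "(nat \<Rightarrow> 'c monoid) \<Rightarrow> (nat \<Rightarrow> 'c \<Rightarrow> 'c) \<Rightarrow> nat \<Rightarrow> 'c set monoid" where
  "homology_grp C d n =
     ((C n)\<lparr>carrier := kernel (C n) (C (n - 1)) (d n)\<rparr>) Mod (d (Suc n) ` carrier (C (Suc n)))"

definition homology_class ::
  "(nat \<Rightarrow> 'c monoid) \<Rightarrow> (nat \<Rightarrow> 'c \<Rightarrow> 'c) \<Rightarrow> nat \<Rightarrow> 'c \<Rightarrow> 'c set" where
  "homology_class C d n z = (d (Suc n) ` carrier (C (Suc n))) #>\<^bsub>C n\<^esub> z"

definition cocycles ::
  "(nat \<Rightarrow> 'c monoid) \<Rightarrow> (nat \<Rightarrow> 'c \<Rightarrow> 'c) \<Rightarrow> nat \<Rightarrow> ('a, 'm) monoid_scheme \<Rightarrow> ('c \<Rightarrow> 'a) set" where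
  "cocycles C d n A =
     {f \<in> hom (C n) A. \<forall>c\<in>carrier (C (Suc n)). f (d (Suc n) c) = \<one>\<^bsub>A\<^esub>}"

text \<open>A tuple \<open>a\<^sub>1, \<dots>, a\<^sub>n\<close> is a list \<open>as\<close> with \<open>a\<^sub>i = as ! (i - 1)\<close>.\<close>

definition omit :: "nat \<Rightarrow> 'c list \<Rightarrow> 'c list" where
  "omit i as = take (i - 1) as @ drop i as"

definition omit_act ::
  "('c \<Rightarrow> 'c \<Rightarrow> 'c) \<Rightarrow> ('c \<Rightarrow> 'c \<Rightarrow> 'c) \<Rightarrow> nat \<Rightarrow> 'c list \<Rightarrow> 'c list" where
  "omit_act u v i as =
     map (\<lambda>b. u b (as ! (i - 1))) (take (i - 1) as) @ map (\<lambda>b. v b (as ! (i - 1))) (drop i as)"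

definition has_repeat :: "'c list \<Rightarrow> bool" where
  "has_repeat as \<longleftrightarrow> (\<exists>i. Suc i < length as \<and> as ! i = as ! Suc i)"

subsection \<open>The shadow biquandle complex\<close>

definition sb_basis :: "'b set \<Rightarrow> 'x set \<Rightarrow> nat \<Rightarrow> ('x \<times> 'b list) set" where
  "sb_basis B X n = (if n \<ge> 1 then {(x, as). x \<in> X \<and> set as \<subseteq> B \<and> length as = n} else {})"

definition C_sb :: "'b set \<Rightarrow> 'x set \<Rightarrow> nat \<Rightarrow> (('x \<times> 'b list) \<Rightarrow>\<^sub>0 int) monoid" where
  "C_sb B X n = free_Abelian_group (sb_basis B X n)"

definition D_sb :: "'b set \<Rightarrow> 'x set \<Rightarrow> nat \<Rightarrow> (('x \<times> 'b list) \<Rightarrow>\<^sub>0 int) set" where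
  "D_sb B X n = generate (C_sb B X n) (frag_of ` {(x, as) \<in> sb_basis B X n. has_repeat as})"

definition bd_sb ::
  "('b \<Rightarrow> 'b \<Rightarrow> 'b) \<Rightarrow> ('b \<Rightarrow> 'b \<Rightarrow> 'b) \<Rightarrow> ('x \<Rightarrow> 'b \<Rightarrow> 'x) \<Rightarrow> nat
     \<Rightarrow> (('x \<times> 'b list) \<Rightarrow>\<^sub>0 int) \<Rightarrow> (('x \<times> 'b list) \<Rightarrow>\<^sub>0 int)" where
  "bd_sb ud ov act n = frag_extend (\<lambda>(x, as).
     if n \<ge> 2 then
       \<Sum>i=1..n. frag_cmul ((-1) ^ i)
         (frag_of (x, omit i as) - frag_of (act x (as ! (i - 1)), omit_act ud ov i as))
     else 0)"

definition C_SB :: "'b set \<Rightarrow> 'x set \<Rightarrow> nat \<Rightarrow> (('x \<times> 'b list) \<Rightarrow>\<^sub>0 int) set monoid" where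
  "C_SB B X n = C_sb B X n Mod D_sb B X n"

definition bd_SB ::
  "'b set \<Rightarrow> 'x set \<Rightarrow> ('b \<Rightarrow> 'b \<Rightarrow> 'b) \<Rightarrow> ('b \<Rightarrow> 'b \<Rightarrow> 'b) \<Rightarrow> ('x \<Rightarrow> 'b \<Rightarrow> 'x) \<Rightarrow> nat
     \<Rightarrow> (('x \<times> 'b list) \<Rightarrow>\<^sub>0 int) set \<Rightarrow> (('x \<times> 'b list) \<Rightarrow>\<^sub>0 int) set" where
  "bd_SB B X ud ov act n =
     induced_map (C_sb B X (n - 1)) (D_sb B X (n - 1)) (bd_sb ud ov act n)"

definition H_SB ::
  "'b set \<Rightarrow> 'x set \<Rightarrow> ('b \<Rightarrow> 'b \<Rightarrow> 'b) \<Rightarrow> ('b \<Rightarrow> 'b \<Rightarrow> 'b) \<Rightarrow> ('x \<Rightarrow> 'b \<Rightarrow> 'x) \<Rightarrow> nat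
     \<Rightarrow> (('x \<times> 'b list) \<Rightarrow>\<^sub>0 int) set set monoid" where
  "H_SB B X ud ov act n = homology_grp (C_SB B X) (bd_SB B X ud ov act) n"

definition Z_SB ::
  "'b set \<Rightarrow> 'x set \<Rightarrow> ('b \<Rightarrow> 'b \<Rightarrow> 'b) \<Rightarrow> ('b \<Rightarrow> 'b \<Rightarrow> 'b) \<Rightarrow> ('x \<Rightarrow> 'b \<Rightarrow> 'x) \<Rightarrow> nat
     \<Rightarrow> ('a, 'm) monoid_scheme \<Rightarrow> ((('x \<times> 'b list) \<Rightarrow>\<^sub>0 int) set \<Rightarrow> 'a) set" where
  "Z_SB B X ud ov act n A = cocycles (C_SB B X) (bd_SB B X ud ov act) n A"

subsection \<open>The local biquandle complex\<close>

definition lb_basis :: "'x set \<Rightarrow> nat \<Rightarrow> ('x \<times> 'x) list set" where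
  "lb_basis X n =
     (if n \<ge> 1 then {map (Pair x) ys |x ys. x \<in> X \<and> set ys \<subseteq> X \<and> length ys = n} else {})"

definition C_lb :: "'x set \<Rightarrow> nat \<Rightarrow> (('x \<times> 'x) list \<Rightarrow>\<^sub>0 int) monoid" where
  "C_lb X n = free_Abelian_group (lb_basis X n)"

definition D_lb :: "'x set \<Rightarrow> nat \<Rightarrow> (('x \<times> 'x) list \<Rightarrow>\<^sub>0 int) set" where
  "D_lb X n = generate (C_lb X n) (frag_of ` {ps \<in> lb_basis X n. has_repeat ps})"

definition bd_lb ::
  "('x \<Rightarrow> 'x \<Rightarrow> 'x \<Rightarrow> 'x) \<Rightarrow> nat \<Rightarrow> (('x \<times> 'x) list \<Rightarrow>\<^sub>0 int) \<Rightarrow> (('x \<times> 'x) list \<Rightarrow>\<^sub>0 int)" where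
  "bd_lb br n = frag_extend (\<lambda>ps.
     if n \<ge> 2 then
       \<Sum>i=1..n. frag_cmul ((-1) ^ i)
         (frag_of (omit i ps) - frag_of (omit_act (lb_ud br) (lb_ov br) i ps))
     else 0)"

definition C_LB :: "'x set \<Rightarrow> nat \<Rightarrow> (('x \<times> 'x) list \<Rightarrow>\<^sub>0 int) set monoid" where
  "C_LB X n = C_lb X n Mod D_lb X n"

definition bd_LB ::
  "'x set \<Rightarrow> ('x \<Rightarrow> 'x \<Rightarrow> 'x \<Rightarrow> 'x) \<Rightarrow> nat
     \<Rightarrow> (('x \<times> 'x) list \<Rightarrow>\<^sub>0 int) set \<Rightarrow> (('x \<times> 'x) list \<Rightarrow>\<^sub>0 int) set" where
  "bd_LB X br n = induced_map (C_lb X (n - 1)) (D_lb X (n - 1)) (bd_lb br n)"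

definition H_LB ::
  "'x set \<Rightarrow> ('x \<Rightarrow> 'x \<Rightarrow> 'x \<Rightarrow> 'x) \<Rightarrow> nat \<Rightarrow> (('x \<times> 'x) list \<Rightarrow>\<^sub>0 int) set set monoid" where
  "H_LB X br n = homology_grp (C_LB X) (bd_LB X br) n"

definition Z_LB ::
  "'x set \<Rightarrow> ('x \<Rightarrow> 'x \<Rightarrow> 'x \<Rightarrow> 'x) \<Rightarrow> nat \<Rightarrow> ('a, 'm) monoid_scheme
     \<Rightarrow> ((('x \<times> 'x) list \<Rightarrow>\<^sub>0 int) set \<Rightarrow> 'a) set" where
  "Z_LB X br n A = cocycles (C_LB X) (bd_LB X br) n A"

subsection \<open>The chain map and the map it induces on homology\<close>

definition mu_chain ::
  "('x \<Rightarrow> 'b \<Rightarrow> 'x) \<Rightarrow> (('x \<times> 'b list) \<Rightarrow>\<^sub>0 int) \<Rightarrow> (('x \<times> 'x) list \<Rightarrow>\<^sub>0 int)" where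
  "mu_chain act = frag_extend (\<lambda>(x, as). frag_of (map (\<lambda>a. (x, act x a)) as))"

definition mu ::
  "'x set \<Rightarrow> ('x \<Rightarrow> 'b \<Rightarrow> 'x) \<Rightarrow> nat
     \<Rightarrow> (('x \<times> 'b list) \<Rightarrow>\<^sub>0 int) set \<Rightarrow> (('x \<times> 'x) list \<Rightarrow>\<^sub>0 int) set" where
  "mu X act n = induced_map (C_lb X n) (D_lb X n) (mu_chain act)"

definition mu_star ::
  "'x set \<Rightarrow> ('x \<Rightarrow> 'x \<Rightarrow> 'x \<Rightarrow> 'x) \<Rightarrow> ('x \<Rightarrow> 'b \<Rightarrow> 'x) \<Rightarrow> nat
     \<Rightarrow> (('x \<times> 'b list) \<Rightarrow>\<^sub>0 int) set set \<Rightarrow> (('x \<times> 'x) list \<Rightarrow>\<^sub>0 int) set set" where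
  "mu_star X br act n =
     induced_map (C_LB X n) (bd_LB X br (Suc n) ` carrier (C_LB X (Suc n))) (mu X act n)"

text \<open>The homology group is the subgroup of cycle classes in the quotient of the chain group by the
  boundaries, and \<open>mu_star\<close> is a bijection already between these quotients. The inverse is taken
  there; by \<open>mu_star_inv_on_homology\<close> below it restricts to the inverse of the isomorphism between the
  homology groups.\<close>

definition mu_star_inv ::
  "'b set \<Rightarrow> 'x set \<Rightarrow> ('b \<Rightarrow> 'b \<Rightarrow> 'b) \<Rightarrow> ('b \<Rightarrow> 'b \<Rightarrow> 'b) \<Rightarrow> ('x \<Rightarrow> 'x \<Rightarrow> 'x \<Rightarrow> 'x)
     \<Rightarrow> ('x \<Rightarrow> 'b \<Rightarrow> 'x) \<Rightarrow> nat
     \<Rightarrow> (('x \<times> 'x) list \<Rightarrow>\<^sub>0 int) set set \<Rightarrow> (('x \<times> 'b list) \<Rightarrow>\<^sub>0 int) set set" where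
  "mu_star_inv B X ud ov br act n =
     inv_into (carrier (C_SB B X n Mod (bd_SB B X ud ov act (Suc n) ` carrier (C_SB B X (Suc n)))))
       (mu_star X br act n)"

subsection \<open>The chain map is an isomorphism\<close>

lemma induced_map_coset:
  assumes "group G" "group G'" "subgroup H G" "subgroup H' G'"
    and h: "h \<in> hom G G'" and hH: "h ` H \<subseteq> H'" and c: "c \<in> carrier G"
  shows "induced_map G' H' h (H #>\<^bsub>G\<^esub> c) = H' #>\<^bsub>G'\<^esub> h c"
proof -
  interpret G: group G by fact
  interpret G': group G' by fact
  have hc: "h c \<in> carrier G'" using h c by (auto simp: hom_def)
  have sub: "H \<subseteq> carrier G" "H' \<subseteq> carrier G'"
    using assms subgroup.subset by blast+
  have *: "H' #>\<^bsub>G'\<^esub> h d = H' #>\<^bsub>G'\<^esub> h c" if d: "d \<in> H #>\<^bsub>G\<^esub> c" for d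
  proof -
    obtain k where k: "k \<in> H" "d = k \<otimes>\<^bsub>G\<^esub> c" using d by (auto simp: r_coset_def)
    then have "h d = h k \<otimes>\<^bsub>G'\<^esub> h c" using h c sub by (auto simp: hom_def)
    moreover have "h k \<in> H'" using k hH by auto
    ultimately have "h d \<in> H' #>\<^bsub>G'\<^esub> h c" by (auto simp: r_coset_def)
    then show ?thesis using G'.repr_independence[OF _ hc \<open>subgroup H' G'\<close>] by metis
  qed
  have "c \<in> H #>\<^bsub>G\<^esub> c" using G.rcos_self c \<open>subgroup H G\<close> by blast
  then have "(\<lambda>d. H' #>\<^bsub>G'\<^esub> h d) ` (H #>\<^bsub>G\<^esub> c) = (\<lambda>d. H' #>\<^bsub>G'\<^esub> h c) ` (H #>\<^bsub>G\<^esub> c)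
      \<and> H #>\<^bsub>G\<^esub> c \<noteq> {}"
    by (intro conjI image_cong refl *) blast+
  then have "(\<lambda>d. H' #>\<^bsub>G'\<^esub> h d) ` (H #>\<^bsub>G\<^esub> c) = {H' #>\<^bsub>G'\<^esub> h c}" by (simp only: image_constant_conv) simp
  then show ?thesis by (simp add: induced_map_def)
qed

lemma carrier_Mod: "carrier (G Mod H) = {H #>\<^bsub>G\<^esub> c |c. c \<in> carrier G}"
  by (auto simp: FactGroup_def RCOSETS_def)

lemma induced_map_hom:
  assumes "comm_group G" "comm_group G'" "subgroup H G" "subgroup H' G'"
    and h: "h \<in> hom G G'" and hH: "h ` H \<subseteq> H'"
  shows "induced_map G' H' h \<in> hom (G Mod H) (G' Mod H')"
proof -
  interpret G: comm_group G by fact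
  interpret G': comm_group G' by fact
  interpret N: normal H G using G.normal_iff_subgroup \<open>subgroup H G\<close> by simp
  interpret N': normal H' G' using G'.normal_iff_subgroup \<open>subgroup H' G'\<close> by simp
  have eq: "induced_map G' H' h (H #>\<^bsub>G\<^esub> c) = H' #>\<^bsub>G'\<^esub> h c" if "c \<in> carrier G" for c
    using induced_map_coset[OF G.is_group G'.is_group assms(3,4) h hH that] .
  have hc: "h c \<in> carrier G'" if "c \<in> carrier G" for c using h that by (auto simp: hom_def)
  show ?thesis
  proof (rule homI)
    fix K assume "K \<in> carrier (G Mod H)"
    then obtain c where "c \<in> carrier G" "K = H #>\<^bsub>G\<^esub> c" by (auto simp: carrier_Mod)
    then show "induced_map G' H' h K \<in> carrier (G' Mod H')"
      using eq hc by (auto simp: carrier_Mod)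
  next
    fix K L assume "K \<in> carrier (G Mod H)" "L \<in> carrier (G Mod H)"
    then obtain c d where cd: "c \<in> carrier G" "K = H #>\<^bsub>G\<^esub> c" "d \<in> carrier G" "L = H #>\<^bsub>G\<^esub> d"
      by (auto simp: carrier_Mod)
    have "h (c \<otimes>\<^bsub>G\<^esub> d) = h c \<otimes>\<^bsub>G'\<^esub> h d" using h cd by (auto simp: hom_def)
    then show "induced_map G' H' h (K \<otimes>\<^bsub>G Mod H\<^esub> L)
        = induced_map G' H' h K \<otimes>\<^bsub>G' Mod H'\<^esub> induced_map G' H' h L"
      using cd eq hc by (simp add: FactGroup_def N.rcos_sum N'.rcos_sum)
  qed
qed

lemma induced_map_bij:
  assumes "comm_group G" "comm_group G'" "subgroup H G" "subgroup H' G'"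
    and h: "h \<in> hom G G'" and b: "bij_betw h (carrier G) (carrier G')" and hH: "h ` H = H'"
  shows "bij_betw (induced_map G' H' h) (carrier (G Mod H)) (carrier (G' Mod H'))"
proof -
  interpret G: comm_group G by fact
  interpret G': comm_group G' by fact
  have eq: "induced_map G' H' h (H #>\<^bsub>G\<^esub> c) = H' #>\<^bsub>G'\<^esub> h c" if "c \<in> carrier G" for c
    using induced_map_coset[OF G.is_group G'.is_group assms(3,4) h _ that] hH by simp
  have sub: "H \<subseteq> carrier G" using \<open>subgroup H G\<close> subgroup.subset by blast
  show ?thesis
    unfolding bij_betw_def
  proof
    show "inj_on (induced_map G' H' h) (carrier (G Mod H))"
    proof (rule inj_onI)
      fix K L assume KL: "K \<in> carrier (G Mod H)" "L \<in> carrier (G Mod H)"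
        "induced_map G' H' h K = induced_map G' H' h L"
      then obtain c d where cd: "c \<in> carrier G" "K = H #>\<^bsub>G\<^esub> c" "d \<in> carrier G" "L = H #>\<^bsub>G\<^esub> d"
        by (auto simp: carrier_Mod)
      have hcd: "h c \<in> carrier G'" "h d \<in> carrier G'" using cd h by (auto simp: hom_def)
      have "H' #>\<^bsub>G'\<^esub> h c = H' #>\<^bsub>G'\<^esub> h d" using KL cd eq by simp
      then have "h c \<in> H' #>\<^bsub>G'\<^esub> h d"
        using G'.rcos_self[OF hcd(1) \<open>subgroup H' G'\<close>] by simp
      then obtain k where k: "k \<in> H" "h c = h k \<otimes>\<^bsub>G'\<^esub> h d"
        using hH by (auto simp: r_coset_def)
      then have "h c = h (k \<otimes>\<^bsub>G\<^esub> d)" using h cd sub by (auto simp: hom_def)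
      then have "c = k \<otimes>\<^bsub>G\<^esub> d"
        using b cd k sub unfolding bij_betw_def inj_on_def by (meson G.m_closed subsetD)
      then have "c \<in> H #>\<^bsub>G\<^esub> d" using k by (auto simp: r_coset_def)
      then show "K = L" using G.repr_independence[OF _ cd(3) \<open>subgroup H G\<close>] cd by metis
    qed
    show "induced_map G' H' h ` carrier (G Mod H) = carrier (G' Mod H')"
    proof
      show "induced_map G' H' h ` carrier (G Mod H) \<subseteq> carrier (G' Mod H')"
        using eq h by (auto simp: carrier_Mod hom_def)
      show "carrier (G' Mod H') \<subseteq> induced_map G' H' h ` carrier (G Mod H)"
      proof
        fix L assume "L \<in> carrier (G' Mod H')"
        then obtain d where "d \<in> carrier G'" "L = H' #>\<^bsub>G'\<^esub> d" by (auto simp: carrier_Mod)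
        moreover then obtain c where "c \<in> carrier G" "h c = d"
          using b unfolding bij_betw_def by (metis imageE)
        ultimately have "L = induced_map G' H' h (H #>\<^bsub>G\<^esub> c)" "c \<in> carrier G" using eq by auto
        then show "L \<in> induced_map G' H' h ` carrier (G Mod H)" by (auto simp: carrier_Mod)
      qed
    qed
  qed
qed

lemma generate_frag_of:
  fixes S :: "'a set"
  assumes "T \<subseteq> S"
  shows "generate (free_Abelian_group S) (frag_of ` T) = {c. Poly_Mapping.keys c \<subseteq> T}"
proof
  interpret group "free_Abelian_group S" by simp
  have sub: "frag_of ` T \<subseteq> carrier (free_Abelian_group S)" using assms by auto
  have "subgroup {c. Poly_Mapping.keys c \<subseteq> T} (free_Abelian_group S)"
  proof (rule subgroupI)
    show "{c. Poly_Mapping.keys c \<subseteq> T} \<noteq> ({} :: ('a \<Rightarrow>\<^sub>0 int) set)"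
      by (metis (mono_tags) empty_iff keys_zero mem_Collect_eq empty_subsetI)
  next
    fix a b :: "'a \<Rightarrow>\<^sub>0 int"
    assume "a \<in> {c. Poly_Mapping.keys c \<subseteq> T}" "b \<in> {c. Poly_Mapping.keys c \<subseteq> T}"
    then show "a \<otimes>\<^bsub>free_Abelian_group S\<^esub> b \<in> {c. Poly_Mapping.keys c \<subseteq> T}"
      using keys_add[of a b] by auto
  qed (use assms in auto)
  then show "generate (free_Abelian_group S) (frag_of ` T) \<subseteq> {c. Poly_Mapping.keys c \<subseteq> T}"
    by (rule generate_subgroup_incl[rotated]) auto
  have gsub: "subgroup (generate (free_Abelian_group S) (frag_of ` T)) (free_Abelian_group S)"
    by (rule generate_is_subgroup[OF sub])
  show "{c. Poly_Mapping.keys c \<subseteq> T} \<subseteq> generate (free_Abelian_group S) (frag_of ` T)"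
  proof
    fix c :: "'a \<Rightarrow>\<^sub>0 int" assume "c \<in> {c. Poly_Mapping.keys c \<subseteq> T}"
    then have "Poly_Mapping.keys c \<subseteq> T" by simp
    then show "c \<in> generate (free_Abelian_group S) (frag_of ` T)"
    proof (induction c rule: frag_induction)
      case zero
      show ?case using subgroup.one_closed[OF gsub] by simp
    next
      case (one x)
      then show ?case by (simp add: generate.incl)
    next
      case (diff a b)
      have bc: "b \<in> carrier (free_Abelian_group S)" using diff(2) gsub subgroup.subset by blast
      have "a \<otimes>\<^bsub>free_Abelian_group S\<^esub> inv\<^bsub>free_Abelian_group S\<^esub> b
          \<in> generate (free_Abelian_group S) (frag_of ` T)"
        using diff subgroup.m_closed[OF gsub] subgroup.m_inv_closed[OF gsub] by blast
      then show ?case using bc by simp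
    qed
  qed
qed

lemma D_sb_eq: "D_sb B X n = {c. Poly_Mapping.keys c \<subseteq> {(x, as) \<in> sb_basis B X n. has_repeat as}}"
  unfolding D_sb_def C_sb_def by (rule generate_frag_of) auto

lemma D_lb_eq: "D_lb X n = {c. Poly_Mapping.keys c \<subseteq> {ps \<in> lb_basis X n. has_repeat ps}}"
  unfolding D_lb_def C_lb_def by (rule generate_frag_of) auto

lemma subgroup_D_sb: "subgroup (D_sb B X n) (C_sb B X n)"
  unfolding D_sb_def C_sb_def by (rule group.generate_is_subgroup) auto

lemma subgroup_D_lb: "subgroup (D_lb X n) (C_lb X n)"
  unfolding D_lb_def C_lb_def by (rule group.generate_is_subgroup) auto

lemma comm_group_C: "comm_group (C_sb B X n)" "comm_group (C_lb X n)"
  by (simp_all add: C_sb_def C_lb_def abelian_free_Abelian_group)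

lemma comm_group_C_quot: "comm_group (C_SB B X n)" "comm_group (C_LB X n)"
  by (simp_all add: C_SB_def C_LB_def comm_group.abelian_FactGroup comm_group_C
      subgroup_D_sb subgroup_D_lb)

lemma frag_extend_hom:
  assumes "\<And>x. x \<in> S \<Longrightarrow> Poly_Mapping.keys (f x) \<subseteq> T"
  shows "frag_extend f \<in> hom (free_Abelian_group S) (free_Abelian_group T)"
proof (rule homI)
  fix c assume "c \<in> carrier (free_Abelian_group S)"
  then have "Poly_Mapping.keys c \<subseteq> S" by simp
  then have "Poly_Mapping.keys (frag_extend f c) \<subseteq> T"
    using keys_frag_extend[of f c] assms by blast
  then show "frag_extend f c \<in> carrier (free_Abelian_group T)" by simp
qed (simp add: frag_extend_add)

lemma length_omit: "1 \<le> i \<Longrightarrow> i \<le> length as \<Longrightarrow> length (omit i as) = length as - 1"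
  by (auto simp: omit_def)

lemma length_omit_act:
  "1 \<le> i \<Longrightarrow> i \<le> length as \<Longrightarrow> length (omit_act u v i as) = length as - 1"
  by (auto simp: omit_act_def)

lemma nth_omit:
  assumes "1 \<le> i" "i \<le> length as" "j < length as - 1"
  shows "omit i as ! j = as ! (if j < i - 1 then j else Suc j)"
  using assms by (auto simp: omit_def nth_append min_def)

lemma nth_omit_act:
  assumes "1 \<le> i" "i \<le> length as" "j < length as - 1"
  shows "omit_act u v i as ! j =
    (if j < i - 1 then u (as ! j) (as ! (i - 1)) else v (as ! Suc j) (as ! (i - 1)))"
  using assms by (auto simp: omit_act_def nth_append min_def)

lemma has_repeat_omit:
  assumes "Suc k < length as" "as ! k = as ! Suc k" "1 \<le> i" "i \<le> length as" "i \<noteq> Suc k"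
    "i \<noteq> Suc (Suc k)"
  shows "has_repeat (omit i as)" "has_repeat (omit_act u v i as)"
proof -
  define j where "j = (if k < i - 1 then k else k - 1)"
  have j: "Suc j < length as - 1" using assms by (auto simp: j_def)
  show "has_repeat (omit i as)"
    unfolding has_repeat_def using assms j
    by (intro exI[of _ j]) (auto simp: length_omit nth_omit j_def)
  show "has_repeat (omit_act u v i as)"
    unfolding has_repeat_def using assms j
    by (intro exI[of _ j]) (auto simp: length_omit_act nth_omit_act j_def)
qed

context shadow_biquandle
begin

lemma omit_in: "1 \<le> i \<Longrightarrow> i \<le> length as \<Longrightarrow> set as \<subseteq> B \<Longrightarrow> set (omit i as) \<subseteq> B"
  by (auto simp: omit_def dest: in_set_takeD in_set_dropD)

lemma omit_act_in:
  assumes "1 \<le> i" "i \<le> length as" "set as \<subseteq> B"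
  shows "set (omit_act ud ov i as) \<subseteq> B"
proof -
  have "as ! (i - 1) \<in> B" using assms by (metis Suc_diff_1 Suc_le_lessD less_eq_Suc_le nth_mem subsetD zero_less_one less_le_trans)
  then show ?thesis using assms ud_closed ov_closed
    by (auto simp: omit_act_def dest!: in_set_takeD in_set_dropD)
qed

lemma bd_sb_basis_keys:
  assumes "(x, as) \<in> sb_basis B X n"
  shows "Poly_Mapping.keys (bd_sb ud ov act n (frag_of (x, as))) \<subseteq> sb_basis B X (n - 1)"
proof (cases "n \<ge> 2")
  case True
  have as: "x \<in> X" "set as \<subseteq> B" "length as = n" using assms by (auto simp: sb_basis_def split: if_splits)
  have in_basis: "(x, omit i as) \<in> sb_basis B X (n - 1)"
     "(act x (as ! (i - 1)), omit_act ud ov i as) \<in> sb_basis B X (n - 1)"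
    if "i \<in> {1..n}" for i
  proof -
    have "as ! (i - 1) \<in> B" using as that by (metis atLeastAtMost_iff diff_less less_le_trans nth_mem subsetD zero_less_one Suc_le_eq One_nat_def)
    then show "(x, omit i as) \<in> sb_basis B X (n - 1)"
      "(act x (as ! (i - 1)), omit_act ud ov i as) \<in> sb_basis B X (n - 1)"
      using that as True act_closed omit_in[of i as] omit_act_in[of i as]
      by (auto simp: sb_basis_def length_omit length_omit_act)
  qed
  have "Poly_Mapping.keys (bd_sb ud ov act n (frag_of (x, as))) \<subseteq>
      (\<Union>i\<in>{1..n}. Poly_Mapping.keys (frag_cmul ((-1) ^ i)
         (frag_of (x, omit i as) - frag_of (act x (as ! (i - 1)), omit_act ud ov i as))))"
    using True by (simp add: bd_sb_def keys_sum)
  also have "\<dots> \<subseteq> sb_basis B X (n - 1)"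
  proof (rule UN_least)
    fix i assume "i \<in> {1..n}"
    then show "Poly_Mapping.keys (frag_cmul ((-1) ^ i)
         (frag_of (x, omit i as) - frag_of (act x (as ! (i - 1)), omit_act ud ov i as)))
        \<subseteq> sb_basis B X (n - 1)"
      using in_basis[of i] keys_diff[of "frag_of (x, omit i as)"
          "frag_of (act x (as ! (i - 1)), omit_act ud ov i as)"] by auto
  qed
  finally show ?thesis .
next
  case False
  then show ?thesis by (simp add: bd_sb_def)
qed

lemma bd_sb_hom: "bd_sb ud ov act n \<in> hom (C_sb B X n) (C_sb B X (n - 1))"
  unfolding C_sb_def bd_sb_def
proof (rule frag_extend_hom)
  fix p assume "p \<in> sb_basis B X n"
  then show "Poly_Mapping.keys (case p of (x, as) \<Rightarrow>
     if n \<ge> 2 then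
       \<Sum>i=1..n. frag_cmul ((-1) ^ i)
         (frag_of (x, omit i as) - frag_of (act x (as ! (i - 1)), omit_act ud ov i as))
     else 0) \<subseteq> sb_basis B X (n - 1)"
    using bd_sb_basis_keys[of "fst p" "snd p" n] by (simp add: bd_sb_def split: prod.splits)
qed

lemma omit_act_repeat:
  assumes "Suc k < length as" "as ! k = as ! Suc k" "set as \<subseteq> B"
  shows "omit (Suc k) as = omit (Suc (Suc k)) as"
    "omit_act ud ov (Suc k) as = omit_act ud ov (Suc (Suc k)) as"
proof -
  have ak: "as ! k \<in> B" using assms by (metis Suc_lessD nth_mem subsetD)
  show "omit (Suc k) as = omit (Suc (Suc k)) as"
    using assms by (intro nth_equalityI) (auto simp: length_omit nth_omit less_Suc_eq)
  show "omit_act ud ov (Suc k) as = omit_act ud ov (Suc (Suc k)) as"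
    using assms diagonal[OF ak]
    by (intro nth_equalityI) (auto simp: length_omit_act nth_omit_act less_Suc_eq)
qed

lemma keys_sum_alternating:
  assumes fin: "finite I" and k: "k \<in> I" "Suc k \<in> I" and eq: "g k = g (Suc k)"
    and oth: "\<And>i. i \<in> I \<Longrightarrow> i \<noteq> k \<Longrightarrow> i \<noteq> Suc k \<Longrightarrow> Poly_Mapping.keys (g i) \<subseteq> T"
  shows "Poly_Mapping.keys (\<Sum>i\<in>I. frag_cmul ((-1) ^ i) (g i)) \<subseteq> T"
proof -
  have "(\<Sum>i\<in>I. frag_cmul ((-1) ^ i) (g i)) =
      frag_cmul ((-1) ^ k) (g k) + (frag_cmul ((-1) ^ Suc k) (g (Suc k)) +
      (\<Sum>i\<in>I - {k} - {Suc k}. frag_cmul ((-1) ^ i) (g i)))"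
    using fin k by (subst sum.remove[of I k], simp, simp, subst sum.remove[of "I - {k}" "Suc k"]) auto
  also have "\<dots> = (\<Sum>i\<in>I - {k} - {Suc k}. frag_cmul ((-1) ^ i) (g i))"
    using eq frag_cmul_distrib[of "(-1) ^ k" "- ((-1) ^ k)" "g (Suc k)", symmetric]
    by (simp add: add.assoc[symmetric])
  finally have "(\<Sum>i\<in>I. frag_cmul ((-1) ^ i) (g i)) =
      (\<Sum>i\<in>I - {k} - {Suc k}. frag_cmul ((-1) ^ i) (g i))" .
  moreover have "(\<Union>i\<in>I - {k} - {Suc k}. Poly_Mapping.keys (frag_cmul ((-1) ^ i) (g i))) \<subseteq> T"
  proof (rule UN_least)
    fix i assume "i \<in> I - {k} - {Suc k}"
    then have "Poly_Mapping.keys (g i) \<subseteq> T" using oth by simp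
    then show "Poly_Mapping.keys (frag_cmul ((-1) ^ i) (g i)) \<subseteq> T"
      using keys_cmul by (rule order_trans[rotated])
  qed
  ultimately show ?thesis
    using keys_sum[of "\<lambda>i. frag_cmul ((-1) ^ i) (g i)" "I - {k} - {Suc k}"] by auto
qed

lemma bd_sb_degenerate:
  assumes "(x, as) \<in> sb_basis B X n" "has_repeat as"
  shows "bd_sb ud ov act n (frag_of (x, as)) \<in> D_sb B X (n - 1)"
proof (cases "n \<ge> 2")
  case True
  have as: "x \<in> X" "set as \<subseteq> B" "length as = n"
    using assms by (auto simp: sb_basis_def split: if_splits)
  obtain k where k: "Suc k < n" "as ! k = as ! Suc k" using assms as by (auto simp: has_repeat_def)
  define g where "g i = frag_of (x, omit i as)
      - frag_of (act x (as ! (i - 1)), omit_act ud ov i as)" for i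
  have "Poly_Mapping.keys (\<Sum>i=1..n. frag_cmul ((-1) ^ i) (g i))
      \<subseteq> {(x, as) \<in> sb_basis B X (n - 1). has_repeat as}"
  proof (rule keys_sum_alternating[where k = "Suc k"])
    show "g (Suc k) = g (Suc (Suc k))"
      using omit_act_repeat[of k as] as k by (simp add: g_def)
    fix i assume i: "i \<in> {1..n}" "i \<noteq> Suc k" "i \<noteq> Suc (Suc k)"
    have "as ! (i - 1) \<in> B" using as i by (metis atLeastAtMost_iff diff_less less_le_trans nth_mem subsetD zero_less_one Suc_le_eq One_nat_def)
    then have "(x, omit i as) \<in> sb_basis B X (n - 1)"
      "(act x (as ! (i - 1)), omit_act ud ov i as) \<in> sb_basis B X (n - 1)"
      using i as True act_closed omit_in[of i as] omit_act_in[of i as]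
      by (auto simp: sb_basis_def length_omit length_omit_act)
    moreover have "has_repeat (omit i as)" "has_repeat (omit_act ud ov i as)"
      using has_repeat_omit[of k as i] k i as by auto
    ultimately show "Poly_Mapping.keys (g i) \<subseteq> {(x, as) \<in> sb_basis B X (n - 1). has_repeat as}"
      unfolding g_def using keys_diff[of "frag_of (x, omit i as)"
          "frag_of (act x (as ! (i - 1)), omit_act ud ov i as)"] by auto
  qed (use k in auto)
  then show ?thesis using True by (simp add: D_sb_eq bd_sb_def g_def)
next
  case False
  then show ?thesis by (simp add: bd_sb_def D_sb_eq)
qed

lemma bd_sb_D: "bd_sb ud ov act n ` D_sb B X n \<subseteq> D_sb B X (n - 1)"
proof (rule image_subsetI)
  fix c assume "c \<in> D_sb B X n"
  then have "Poly_Mapping.keys c \<subseteq> {(x, as) \<in> sb_basis B X n. has_repeat as}"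
    by (simp add: D_sb_eq)
  then show "bd_sb ud ov act n c \<in> D_sb B X (n - 1)"
  proof (induction c rule: frag_induction)
    case zero
    then show ?case by (simp add: bd_sb_def D_sb_eq)
  next
    case (one p)
    then show ?case using bd_sb_degenerate[of "fst p" "snd p" n] by auto
  next
    case (diff a b)
    have "bd_sb ud ov act n (a - b) = bd_sb ud ov act n a - bd_sb ud ov act n b"
      by (simp add: bd_sb_def frag_extend_diff)
    then show ?case using diff keys_diff unfolding D_sb_eq by fastforce
  qed
qed

end

locale connected_shadow = shadow_biquandle B ud ov X act
  for B :: "'b set" and ud ov :: "'b \<Rightarrow> 'b \<Rightarrow> 'b" and X :: "'x set" and act :: "'x \<Rightarrow> 'b \<Rightarrow> 'x" +
  fixes br :: "'x \<Rightarrow> 'x \<Rightarrow> 'x \<Rightarrow> 'x"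
  assumes strong: "strongly_connected B X act"
    and br: "br = tribracket_of B ov act"
begin

abbreviation "mb \<equiv> \<lambda>(x, as). map (\<lambda>a. (x, act x a)) as"

lemma mu_chain_alt: "mu_chain act = frag_extend (frag_of \<circ> mb)"
  by (simp add: mu_chain_def comp_def case_prod_unfold)

lemma strongD: "x \<in> X \<Longrightarrow> bij_betw (act x) B X"
  using strong by (simp add: strongly_connected_def)

lemma arrow_act: "x \<in> X \<Longrightarrow> a \<in> B \<Longrightarrow> arrow B act x (act x a) = a"
  unfolding arrow_def by (rule the_equality) (use strongD in \<open>auto simp: bij_betw_def inj_on_def\<close>)

lemma br_act:
  assumes "x \<in> X" "a \<in> B" "b \<in> B"
  shows "br x (act x a) (act x b) = act (act x a) (ov b a)"
    "br x (act x a) (act x b) = act (act x b) (ud a b)"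
  using assms act_exchange by (simp_all add: br tribracket_of_def arrow_act)

lemma mb_bij: "bij_betw mb (sb_basis B X n) (lb_basis X n)"
  unfolding bij_betw_def
proof
  show "inj_on mb (sb_basis B X n)"
  proof (rule inj_onI, clarify)
    fix x as y bs
    assume m: "(x, as) \<in> sb_basis B X n" "(y, bs) \<in> sb_basis B X n"
      "map (\<lambda>a. (x, act x a)) as = map (\<lambda>a. (y, act y a)) bs"
    then have l: "x \<in> X" "set as \<subseteq> B" "set bs \<subseteq> B" "as \<noteq> []" "bs \<noteq> []" "length as = length bs"
      by (auto simp: sb_basis_def split: if_splits)
    have "x = y" using m(3) l by (cases as; cases bs) auto
    moreover have "as = bs"
    proof (rule nth_equalityI)
      fix i assume i: "i < length as"
      have "act x (as ! i) = act x (bs ! i)"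
        using arg_cong[OF m(3), of "\<lambda>l. l ! i"] i l \<open>x = y\<close> by simp
      then show "as ! i = bs ! i"
        using strongD[OF l(1)] i l unfolding bij_betw_def inj_on_def
        by (metis nth_mem subsetD)
    qed (use l in auto)
    ultimately show "x = y \<and> as = bs" by simp
  qed
  show "mb ` sb_basis B X n = lb_basis X n"
  proof
    show "mb ` sb_basis B X n \<subseteq> lb_basis X n"
    proof (rule image_subsetI)
      fix p assume p: "p \<in> sb_basis B X n"
      then have "mb p = map (Pair (fst p)) (map (act (fst p)) (snd p))"
        "fst p \<in> X" "set (map (act (fst p)) (snd p)) \<subseteq> X" "length (map (act (fst p)) (snd p)) = n" "n \<ge> 1"
        using act_closed by (auto simp: sb_basis_def case_prod_unfold split: if_splits)
      then have "mb p \<in> {map (Pair x) ys |x ys. x \<in> X \<and> set ys \<subseteq> X \<and> length ys = n}" by blast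
      then show "mb p \<in> lb_basis X n" using \<open>n \<ge> 1\<close> by (simp add: lb_basis_def)
    qed
    show "lb_basis X n \<subseteq> mb ` sb_basis B X n"
    proof
      fix ps assume "ps \<in> lb_basis X n"
      then obtain x ys where ps: "ps = map (Pair x) ys" "x \<in> X" "set ys \<subseteq> X" "length ys = n" "n \<ge> 1"
        by (auto simp: lb_basis_def split: if_splits)
      define as where "as = map (inv_into B (act x)) ys"
      have inv: "inv_into B (act x) y \<in> B" "act x (inv_into B (act x) y) = y" if "y \<in> X" for y
        using strongD[OF ps(2)] that
        by (auto simp: bij_betw_def inv_into_into f_inv_into_f)
      have "(x, as) \<in> sb_basis B X n" using ps inv by (auto simp: sb_basis_def as_def)
      moreover have "mb (x, as) = ps" using ps inv by (auto simp: as_def)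
      ultimately show "ps \<in> mb ` sb_basis B X n" by (rule image_eqI[OF sym, rotated])
    qed
  qed
qed

lemma has_repeat_mb:
  assumes "(x, as) \<in> sb_basis B X n"
  shows "has_repeat (mb (x, as)) \<longleftrightarrow> has_repeat as"
proof -
  have "x \<in> X" "set as \<subseteq> B" using assms by (auto simp: sb_basis_def split: if_splits)
  then have "act x (as ! i) = act x (as ! j) \<longleftrightarrow> as ! i = as ! j"
    if "i < length as" "j < length as" for i j
    using strongD[of x] that unfolding bij_betw_def inj_on_def by (metis nth_mem subsetD)
  then show ?thesis by (auto simp: has_repeat_def)
qed

lemma mu_chain_image:
  assumes S: "S \<subseteq> sb_basis B X n"
  shows "mu_chain act ` {c. Poly_Mapping.keys c \<subseteq> S} = {c. Poly_Mapping.keys c \<subseteq> mb ` S}"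
proof
  show "mu_chain act ` {c. Poly_Mapping.keys c \<subseteq> S} \<subseteq> {c. Poly_Mapping.keys c \<subseteq> mb ` S}"
  proof (rule image_subsetI)
    fix c :: "('x \<times> 'b list) \<Rightarrow>\<^sub>0 int" assume "c \<in> {c. Poly_Mapping.keys c \<subseteq> S}"
    then show "mu_chain act c \<in> {c. Poly_Mapping.keys c \<subseteq> mb ` S}"
      using keys_frag_extend[of "frag_of \<circ> mb" c] unfolding mu_chain_alt by fastforce
  qed
  show "{c. Poly_Mapping.keys c \<subseteq> mb ` S} \<subseteq> mu_chain act ` {c. Poly_Mapping.keys c \<subseteq> S}"
  proof
    fix c :: "('x \<times> 'x) list \<Rightarrow>\<^sub>0 int" assume "c \<in> {c. Poly_Mapping.keys c \<subseteq> mb ` S}"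
    then have "Poly_Mapping.keys c \<subseteq> mb ` S" by simp
    then show "c \<in> mu_chain act ` {c. Poly_Mapping.keys c \<subseteq> S}"
    proof (induction c rule: frag_induction)
      case zero
      have "mu_chain act 0 = 0" by (simp add: mu_chain_def)
      then show ?case by (intro image_eqI[of _ _ 0]) auto
    next
      case (one q)
      then obtain p where "p \<in> S" "q = mb p" by auto
      then show ?case by (intro image_eqI[of _ _ "frag_of p"]) (auto simp: mu_chain_alt)
    next
      case (diff a b)
      then obtain a' b' where "a = mu_chain act a'" "b = mu_chain act b'"
        "Poly_Mapping.keys a' \<subseteq> S" "Poly_Mapping.keys b' \<subseteq> S" by auto
      then show ?case using keys_diff[of a' b']
        by (intro image_eqI[of _ _ "a' - b'"]) (auto simp: mu_chain_def frag_extend_diff)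
    qed
  qed
qed

lemma mu_chain_hom: "mu_chain act \<in> hom (C_sb B X n) (C_lb X n)"
  unfolding C_sb_def C_lb_def mu_chain_alt
  by (rule frag_extend_hom) (use mb_bij[of n] in \<open>auto simp: bij_betw_def\<close>)

lemma mu_chain_bij: "bij_betw (mu_chain act) (carrier (C_sb B X n)) (carrier (C_lb X n))"
proof -
  define g where "g = inv_into (sb_basis B X n) mb"
  have g: "g (mb p) = p" if "p \<in> sb_basis B X n" for p
    using mb_bij[of n] that by (simp add: g_def bij_betw_def)
  have left: "frag_extend (frag_of \<circ> g) (mu_chain act c) = c"
    if "Poly_Mapping.keys c \<subseteq> sb_basis B X n" for c
    using that
  proof (induction c rule: frag_induction)
    case (one p)
    then show ?case using g[of p] by (simp add: mu_chain_alt)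
  qed (auto simp: mu_chain_def frag_extend_diff)
  have "inj_on (mu_chain act) (carrier (C_sb B X n))"
    by (rule inj_on_inverseI[of _ "frag_extend (frag_of \<circ> g)"]) (simp add: left C_sb_def)
  moreover have "mu_chain act ` carrier (C_sb B X n) = carrier (C_lb X n)"
    using mu_chain_image[of "sb_basis B X n" n] mb_bij[of n]
    by (auto simp: C_sb_def C_lb_def free_Abelian_group_def bij_betw_def)
  ultimately show ?thesis by (simp add: bij_betw_def)
qed

lemma mu_chain_D: "mu_chain act ` D_sb B X n = D_lb X n"
proof -
  have "mb ` {(x, as) \<in> sb_basis B X n. has_repeat as} = {ps \<in> lb_basis X n. has_repeat ps}"
  proof -
    have "mb ` sb_basis B X n = lb_basis X n" using mb_bij[of n] by (simp add: bij_betw_def)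
    moreover have "{(x, as) \<in> sb_basis B X n. has_repeat as} = {p \<in> sb_basis B X n. has_repeat (mb p)}"
      (is "?L = ?R")
    proof (rule Set.set_eqI)
      fix p show "p \<in> ?L \<longleftrightarrow> p \<in> ?R"
        using has_repeat_mb[of "fst p" "snd p" n] by (cases p) auto
    qed
    ultimately show ?thesis by (simp only: image_def) blast
  qed
  then show ?thesis
    using mu_chain_image[of "{(x, as) \<in> sb_basis B X n. has_repeat as}" n]
    by (auto simp: D_sb_eq D_lb_eq)
qed

lemma mb_omit:
  assumes "(x, as) \<in> sb_basis B X n" "i \<in> {1..n}"
  shows "omit i (mb (x, as)) = mb (x, omit i as)"
    "omit_act (lb_ud br) (lb_ov br) i (mb (x, as)) = mb (act x (as ! (i - 1)), omit_act ud ov i as)"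
proof -
  have as: "x \<in> X" "set as \<subseteq> B" "length as = n" using assms by (auto simp: sb_basis_def split: if_splits)
  have B: "as ! j \<in> B" if "j < n" for j using as that by (metis nth_mem subsetD)
  show "omit i (mb (x, as)) = mb (x, omit i as)"
    by (simp add: omit_def take_map drop_map)
  show "omit_act (lb_ud br) (lb_ov br) i (mb (x, as)) = mb (act x (as ! (i - 1)), omit_act ud ov i as)"
    using as assms(2) B
    by (intro nth_equalityI)
       (auto simp: length_omit_act nth_omit_act lb_ud_def lb_ov_def br_act(2) act_exchange)
qed

lemma mu_chain_bd:
  assumes "c \<in> carrier (C_sb B X n)"
  shows "mu_chain act (bd_sb ud ov act n c) = bd_lb br n (mu_chain act c)"
proof -
  have "Poly_Mapping.keys c \<subseteq> sb_basis B X n" using assms by (simp add: C_sb_def)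
  then show ?thesis
  proof (induction c rule: frag_induction)
    case zero
    then show ?case by (simp add: mu_chain_def bd_sb_def bd_lb_def)
  next
    case (one p)
    obtain x as where p: "p = (x, as)" by (cases p)
    show ?case
    proof (cases "n \<ge> 2")
      case True
      have "mu_chain act (bd_sb ud ov act n (frag_of p)) =
         (\<Sum>i=1..n. frag_cmul ((-1) ^ i) (frag_of (mb (x, omit i as))
            - frag_of (mb (act x (as ! (i - 1)), omit_act ud ov i as))))"
        using True by (simp add: p bd_sb_def mu_chain_alt frag_extend_sum frag_extend_cmul
            frag_extend_diff comp_def)
      also have "\<dots> = bd_lb br n (frag_of (mb (x, as)))"
        using True mb_omit[of x as n] one p by (simp add: bd_lb_def)
      also have "\<dots> = bd_lb br n (mu_chain act (frag_of p))" by (simp add: mu_chain_alt p)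
      finally show ?thesis .
    next
      case False
      then show ?thesis by (simp add: mu_chain_def bd_sb_def bd_lb_def p)
    qed
  next
    case (diff a b)
    then show ?case by (simp add: mu_chain_def bd_sb_def bd_lb_def frag_extend_diff)
  qed
qed

lemma bd_lb_hom: "bd_lb br n \<in> hom (C_lb X n) (C_lb X (n - 1))"
proof (rule homI)
  fix c assume "c \<in> carrier (C_lb X n)"
  then obtain d where "d \<in> carrier (C_sb B X n)" "c = mu_chain act d"
    using mu_chain_bij[of n] by (auto simp: bij_betw_def)
  then show "bd_lb br n c \<in> carrier (C_lb X (n - 1))"
    using mu_chain_bd[of d n] mu_chain_hom[of "n - 1"] bd_sb_hom[of n]
    by (metis hom_in_carrier)
qed (simp add: C_lb_def bd_lb_def frag_extend_add)

lemma bd_lb_D: "bd_lb br n ` D_lb X n \<subseteq> D_lb X (n - 1)"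
proof (rule image_subsetI)
  fix c assume "c \<in> D_lb X n"
  then obtain d where d: "d \<in> D_sb B X n" "c = mu_chain act d" using mu_chain_D[of n] by auto
  then have "d \<in> carrier (C_sb B X n)" using subgroup.subset[OF subgroup_D_sb] by blast
  then have "bd_lb br n c = mu_chain act (bd_sb ud ov act n d)" using mu_chain_bd d by simp
  then show "bd_lb br n c \<in> D_lb X (n - 1)"
    using bd_sb_D[of n] d mu_chain_D[of "n - 1"] by auto
qed

lemmas groups = comm_group.axioms(2)[OF comm_group_C(1)] comm_group.axioms(2)[OF comm_group_C(2)]

lemmas groups_quot =
  comm_group.axioms(2)[OF comm_group_C_quot(1)] comm_group.axioms(2)[OF comm_group_C_quot(2)]

lemma mu_coset:
  "c \<in> carrier (C_sb B X n) \<Longrightarrow>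
     mu X act n (D_sb B X n #>\<^bsub>C_sb B X n\<^esub> c) = D_lb X n #>\<^bsub>C_lb X n\<^esub> mu_chain act c"
  unfolding mu_def
  by (rule induced_map_coset[OF groups subgroup_D_sb subgroup_D_lb mu_chain_hom]) (simp add: mu_chain_D)

lemma bd_SB_coset:
  "c \<in> carrier (C_sb B X n) \<Longrightarrow>
     bd_SB B X ud ov act n (D_sb B X n #>\<^bsub>C_sb B X n\<^esub> c)
       = D_sb B X (n - 1) #>\<^bsub>C_sb B X (n - 1)\<^esub> bd_sb ud ov act n c"
  unfolding bd_SB_def
  using induced_map_coset[OF groups(1) groups(1) subgroup_D_sb subgroup_D_sb bd_sb_hom bd_sb_D] .

lemma bd_LB_coset:
  "c \<in> carrier (C_lb X n) \<Longrightarrow>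
     bd_LB X br n (D_lb X n #>\<^bsub>C_lb X n\<^esub> c)
       = D_lb X (n - 1) #>\<^bsub>C_lb X (n - 1)\<^esub> bd_lb br n c"
  unfolding bd_LB_def
  using induced_map_coset[OF groups(2) groups(2) subgroup_D_lb subgroup_D_lb bd_lb_hom bd_lb_D] .

lemma mu_hom: "mu X act n \<in> hom (C_SB B X n) (C_LB X n)"
  unfolding mu_def C_SB_def C_LB_def
  by (rule induced_map_hom[OF comm_group_C subgroup_D_sb subgroup_D_lb mu_chain_hom])
     (simp add: mu_chain_D)

lemma mu_bij: "bij_betw (mu X act n) (carrier (C_SB B X n)) (carrier (C_LB X n))"
  unfolding mu_def C_SB_def C_LB_def
  by (rule induced_map_bij[OF comm_group_C subgroup_D_sb subgroup_D_lb mu_chain_hom mu_chain_bij])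
     (simp add: mu_chain_D)

lemma mu_chain_map:
  assumes "K \<in> carrier (C_SB B X n)"
  shows "mu X act (n - 1) (bd_SB B X ud ov act n K) = bd_LB X br n (mu X act n K)"
proof -
  obtain c where c: "c \<in> carrier (C_sb B X n)" "K = D_sb B X n #>\<^bsub>C_sb B X n\<^esub> c"
    using assms by (auto simp: C_SB_def carrier_Mod)
  have "bd_sb ud ov act n c \<in> carrier (C_sb B X (n - 1))"
    using bd_sb_hom c by (metis hom_in_carrier)
  moreover have "mu_chain act c \<in> carrier (C_lb X n)"
    using mu_chain_hom c by (metis hom_in_carrier)
  ultimately show ?thesis
    using c by (simp add: bd_SB_coset mu_coset bd_LB_coset mu_chain_bd)
qed

lemma bd_SB_hom: "bd_SB B X ud ov act n \<in> hom (C_SB B X n) (C_SB B X (n - 1))"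
  unfolding bd_SB_def C_SB_def
  by (rule induced_map_hom[OF comm_group_C(1) comm_group_C(1) subgroup_D_sb subgroup_D_sb
        bd_sb_hom bd_sb_D])

lemma bd_LB_hom: "bd_LB X br n \<in> hom (C_LB X n) (C_LB X (n - 1))"
  unfolding bd_LB_def C_LB_def
  by (rule induced_map_hom[OF comm_group_C(2) comm_group_C(2) subgroup_D_lb subgroup_D_lb
        bd_lb_hom bd_lb_D])

abbreviation "bim_SB n \<equiv> bd_SB B X ud ov act (Suc n) ` carrier (C_SB B X (Suc n))"
abbreviation "bim_LB n \<equiv> bd_LB X br (Suc n) ` carrier (C_LB X (Suc n))"

lemma subgroup_bim: "subgroup (bim_SB n) (C_SB B X n)" "subgroup (bim_LB n) (C_LB X n)"
proof -
  have "group_hom (C_SB B X (Suc n)) (C_SB B X n) (bd_SB B X ud ov act (Suc n))"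
    using bd_SB_hom[of "Suc n"] by (simp add: group_hom_def group_hom_axioms_def groups_quot)
  then show "subgroup (bim_SB n) (C_SB B X n)" by (rule group_hom.img_is_subgroup)
  have "group_hom (C_LB X (Suc n)) (C_LB X n) (bd_LB X br (Suc n))"
    using bd_LB_hom[of "Suc n"] by (simp add: group_hom_def group_hom_axioms_def groups_quot)
  then show "subgroup (bim_LB n) (C_LB X n)" by (rule group_hom.img_is_subgroup)
qed

lemma mu_bim: "mu X act n ` bim_SB n = bim_LB n"
proof -
  have "mu X act n ` bim_SB n = (\<lambda>K. bd_LB X br (Suc n) (mu X act (Suc n) K)) ` carrier (C_SB B X (Suc n))"
    using mu_chain_map[of _ "Suc n"] by (force simp: image_image)
  also have "\<dots> = bim_LB n"
    using mu_bij[of "Suc n"] by (simp add: bij_betw_def image_image[symmetric])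
  finally show ?thesis .
qed

lemma mu_star_coset:
  "K \<in> carrier (C_SB B X n) \<Longrightarrow>
     mu_star X br act n (bim_SB n #>\<^bsub>C_SB B X n\<^esub> K) = bim_LB n #>\<^bsub>C_LB X n\<^esub> mu X act n K"
  unfolding mu_star_def
  by (rule induced_map_coset[OF groups_quot subgroup_bim mu_hom]) (simp add: mu_bim)

lemma mu_star_bij_quotient:
  "bij_betw (mu_star X br act n) (carrier (C_SB B X n Mod bim_SB n)) (carrier (C_LB X n Mod bim_LB n))"
  unfolding mu_star_def
  by (rule induced_map_bij[OF comm_group_C_quot subgroup_bim mu_hom mu_bij mu_bim])

lemma mu_kernel:
  assumes "K \<in> carrier (C_SB B X n)"
  shows "mu X act n K \<in> kernel (C_LB X n) (C_LB X (n - 1)) (bd_LB X br n)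
     \<longleftrightarrow> K \<in> kernel (C_SB B X n) (C_SB B X (n - 1)) (bd_SB B X ud ov act n)"
proof -
  note g = groups_quot
  have one: "mu X act (n - 1) \<one>\<^bsub>C_SB B X (n - 1)\<^esub> = \<one>\<^bsub>C_LB X (n - 1)\<^esub>"
    using hom_one[OF mu_hom g(1) g(2)] .
  have bd: "bd_SB B X ud ov act n K \<in> carrier (C_SB B X (n - 1))"
    using bd_SB_hom assms by (metis hom_in_carrier)
  have oc: "\<one>\<^bsub>C_SB B X (n - 1)\<^esub> \<in> carrier (C_SB B X (n - 1))"
    using g(1) by (metis group.is_monoid monoid.one_closed)
  have inj: "inj_on (mu X act (n - 1)) (carrier (C_SB B X (n - 1)))"
    using mu_bij by (simp add: bij_betw_def)
  have "mu X act n K \<in> carrier (C_LB X n)" using mu_hom assms by (metis hom_in_carrier)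
  then show ?thesis
    unfolding kernel_def using mu_chain_map[OF assms] one assms inj_onD[OF inj _ bd oc] by auto
qed

lemma carrier_H_SB:
  "carrier (H_SB B X ud ov act n) = {bim_SB n #>\<^bsub>C_SB B X n\<^esub> K |K.
     K \<in> kernel (C_SB B X n) (C_SB B X (n - 1)) (bd_SB B X ud ov act n)}"
  by (auto simp: H_SB_def homology_grp_def FactGroup_def RCOSETS_def r_coset_def)

lemma carrier_H_LB:
  "carrier (H_LB X br n) = {bim_LB n #>\<^bsub>C_LB X n\<^esub> K |K.
     K \<in> kernel (C_LB X n) (C_LB X (n - 1)) (bd_LB X br n)}"
  by (auto simp: H_LB_def homology_grp_def FactGroup_def RCOSETS_def r_coset_def)

lemma mu_star_bij:
  "bij_betw (mu_star X br act n) (carrier (H_SB B X ud ov act n)) (carrier (H_LB X br n))"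
  unfolding bij_betw_def
proof
  have "carrier (H_SB B X ud ov act n) \<subseteq> carrier (C_SB B X n Mod bim_SB n)"
    unfolding carrier_H_SB carrier_Mod kernel_def by auto
  then show "inj_on (mu_star X br act n) (carrier (H_SB B X ud ov act n))"
    using mu_star_bij_quotient[of n] by (meson bij_betw_def inj_on_subset)
  show "mu_star X br act n ` carrier (H_SB B X ud ov act n) = carrier (H_LB X br n)"
  proof
    show "mu_star X br act n ` carrier (H_SB B X ud ov act n) \<subseteq> carrier (H_LB X br n)"
    proof (rule image_subsetI)
      fix h assume "h \<in> carrier (H_SB B X ud ov act n)"
      then obtain K where K: "h = bim_SB n #>\<^bsub>C_SB B X n\<^esub> K"
        "K \<in> kernel (C_SB B X n) (C_SB B X (n - 1)) (bd_SB B X ud ov act n)"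
        unfolding carrier_H_SB by blast
      then have "K \<in> carrier (C_SB B X n)" by (simp add: kernel_def)
      then show "mu_star X br act n h \<in> carrier (H_LB X br n)"
        unfolding carrier_H_LB using mu_kernel[of K n] mu_star_coset[of K n] K by blast
    qed
    show "carrier (H_LB X br n) \<subseteq> mu_star X br act n ` carrier (H_SB B X ud ov act n)"
    proof
      fix h assume "h \<in> carrier (H_LB X br n)"
      then obtain L where L: "h = bim_LB n #>\<^bsub>C_LB X n\<^esub> L"
        "L \<in> kernel (C_LB X n) (C_LB X (n - 1)) (bd_LB X br n)"
        unfolding carrier_H_LB by blast
      then have "L \<in> carrier (C_LB X n)" by (simp add: kernel_def)
      then obtain K where K: "K \<in> carrier (C_SB B X n)" "L = mu X act n K"
        using mu_bij[of n] by (auto simp: bij_betw_def)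
      then have "bim_SB n #>\<^bsub>C_SB B X n\<^esub> K \<in> carrier (H_SB B X ud ov act n)"
        unfolding carrier_H_SB using mu_kernel[of K n] L by blast
      moreover have "h = mu_star X br act n (bim_SB n #>\<^bsub>C_SB B X n\<^esub> K)"
        using L K mu_star_coset by simp
      ultimately show "h \<in> mu_star X br act n ` carrier (H_SB B X ud ov act n)" by blast
    qed
  qed
qed

lemma mu_star_inv_on_homology:
  assumes "h \<in> carrier (H_LB X br n)"
  shows "mu_star_inv B X ud ov br act n h
       = inv_into (carrier (H_SB B X ud ov act n)) (mu_star X br act n) h"
proof -
  obtain k where k: "k \<in> carrier (H_SB B X ud ov act n)" "h = mu_star X br act n k"
    using mu_star_bij[of n] assms by (auto simp: bij_betw_def)
  have "k \<in> carrier (C_SB B X n Mod bim_SB n)"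
    using k(1) unfolding carrier_H_SB carrier_Mod kernel_def by auto
  then show ?thesis
    using k mu_star_bij[of n] mu_star_bij_quotient[of n] by (simp add: bij_betw_def mu_star_inv_def)
qed

end



section \<open>Oriented surface-links\<close>

text \<open>Everything is in the topological category. Euclidean 4-space is \<open>(real^3) \<times> real\<close>, the
  projection to 3-space is \<open>fst\<close> and the height is \<open>snd\<close>.\<close>

type_synonym R3 = "real^3"
type_synonym R4 = "(real^3) \<times> real"

definition open_embedding :: "('a::topological_space \<Rightarrow> 'b::topological_space) \<Rightarrow> bool" where
  "open_embedding \<phi> \<longleftrightarrow>
     continuous_on UNIV \<phi> \<and> inj \<phi> \<and> (\<forall>U. open U \<longrightarrow> open (\<phi> ` U))"

text \<open>\<open>g\<close> has local degree 1 at \<open>u\<close>: its normalised restriction to small spheres around \<open>u\<close>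
  is homotopic to the identity, which by Hopf's theorem means that it has degree 1. It is used
  for maps that are injective and continuous near \<open>u\<close>.\<close>

definition orientation_preserving_at ::
  "('a::euclidean_space \<Rightarrow> 'a) \<Rightarrow> 'a \<Rightarrow> bool" where
  "orientation_preserving_at g u \<longleftrightarrow>
     (\<forall>\<^sub>F r in at_right (0::real).
        homotopic_with_canon (\<lambda>_. True) (sphere 0 1) (sphere 0 1)
          (\<lambda>x. sgn (g (u + r *\<^sub>R x) - g u)) id)"

definition orientation_preserving :: "('a::euclidean_space \<Rightarrow> 'a) \<Rightarrow> bool" where
  "orientation_preserving g \<longleftrightarrow> (\<forall>u. orientation_preserving_at g u)"

text \<open>Local parametrisations of a surface by the whole plane.\<close>

definition surface_chart :: "R4 set \<Rightarrow> (real^2 \<Rightarrow> R4) \<Rightarrow> bool" where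
  "surface_chart F c \<longleftrightarrow>
     continuous_on UNIV c \<and> inj c \<and> (\<forall>U. open U \<longrightarrow> openin (top_of_set F) (c ` U))"

definition compatible_charts :: "(real^2 \<Rightarrow> R4) \<Rightarrow> (real^2 \<Rightarrow> R4) \<Rightarrow> bool" where
  "compatible_charts c c' \<longleftrightarrow>
     (\<forall>u u'. c u = c' u' \<longrightarrow> orientation_preserving_at (inv_into UNIV c' \<circ> c) u)"

definition oriented_atlas :: "R4 set \<Rightarrow> (real^2 \<Rightarrow> R4) set \<Rightarrow> bool" where
  "oriented_atlas F \<omega> \<longleftrightarrow>
     (\<forall>c\<in>\<omega>. surface_chart F c) \<and> F = (\<Union>c\<in>\<omega>. range c) \<and>
     (\<forall>c\<in>\<omega>. \<forall>c'\<in>\<omega>. compatible_charts c c')"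

definition positive_chart :: "R4 set \<Rightarrow> (real^2 \<Rightarrow> R4) set \<Rightarrow> (real^2 \<Rightarrow> R4) \<Rightarrow> bool" where
  "positive_chart F \<omega> c \<longleftrightarrow> oriented_atlas F (insert c \<omega>)"

definition locally_flat :: "R4 set \<Rightarrow> bool" where
  "locally_flat F \<longleftrightarrow>
     (\<forall>p\<in>F. \<exists>\<Phi> :: R4 \<Rightarrow> R4. open_embedding \<Phi> \<and> \<Phi> 0 = p \<and>
        F \<inter> range \<Phi> = \<Phi> ` {v. fst v $ 3 = 0 \<and> snd v = 0})"

text \<open>A compact locally flat surface is a finite disjoint union of closed connected surfaces;
  an orientation is given by an oriented atlas \<open>\<omega>\<close>. The empty link is excluded.\<close>

definition surface_link :: "R4 set \<Rightarrow> (real^2 \<Rightarrow> R4) set \<Rightarrow> bool" where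
  "surface_link F \<omega> \<longleftrightarrow> F \<noteq> {} \<and> compact F \<and> locally_flat F \<and> oriented_atlas F \<omega>"

definition ambient_isotopic ::
  "R4 set \<Rightarrow> (real^2 \<Rightarrow> R4) set \<Rightarrow> R4 set \<Rightarrow> (real^2 \<Rightarrow> R4) set \<Rightarrow> bool" where
  "ambient_isotopic F \<omega> G \<eta> \<longleftrightarrow>
     (\<exists>H :: real \<Rightarrow> R4 \<Rightarrow> R4.
        continuous_on ({0..1} \<times> UNIV) (\<lambda>(t, v). H t v) \<and>
        (\<forall>t\<in>{0..1}. \<exists>K. homeomorphism UNIV UNIV (H t) K) \<and>
        H 0 = id \<and> G = H 1 ` F \<and> \<eta> = (\<lambda>c. H 1 \<circ> c) ` \<omega>)"


section \<open>Diagrams\<close>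

text \<open>A diagram is represented by the surface \<open>G\<close> in 4-space (with its orientation \<open>\<eta>\<close>) whose
  projection it is; the underlying subset of 3-space is \<open>fst ` G\<close>, and \<open>snd\<close> gives the height
  information.\<close>

text \<open>\<open>\<phi>\<close> maps the plane \<open>x\<^sub>3 = 0\<close> onto a single sheet so that the first two axes
  give the orientation of the sheet and all three axes the orientation of 3-space; hence the
  third axis is mapped to the direction of the normal vector.\<close>

definition right_handed_chart ::
  "R4 set \<Rightarrow> (real^2 \<Rightarrow> R4) set \<Rightarrow> (real^2 \<Rightarrow> R4) \<Rightarrow> (R3 \<Rightarrow> R3) \<Rightarrow> bool" where
  "right_handed_chart G \<eta> c \<phi> \<longleftrightarrow>
     positive_chart G \<eta> c \<and> open_embedding \<phi> \<and> orientation_preserving \<phi> \<and>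
     G \<inter> fst -` range \<phi> = range c \<and>
     (\<forall>u. fst (c u) = \<phi> (vector [u $ 1, u $ 2, 0]))"

definition regular_points :: "R4 set \<Rightarrow> (real^2 \<Rightarrow> R4) set \<Rightarrow> R3 set" where
  "regular_points G \<eta> = {\<phi> 0 |c \<phi>. right_handed_chart G \<eta> c \<phi>}"

text \<open>At the regular point \<open>q\<close> the normal vector points from (a subset of) \<open>N\<close> to \<open>P\<close>.\<close>

definition normal_crosses ::
  "R4 set \<Rightarrow> (real^2 \<Rightarrow> R4) set \<Rightarrow> R3 \<Rightarrow> R3 set \<Rightarrow> R3 set \<Rightarrow> bool" where
  "normal_crosses G \<eta> q N P \<longleftrightarrow>
     (\<exists>c \<phi>. right_handed_chart G \<eta> c \<phi> \<and> \<phi> 0 = q \<and>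
        \<phi> ` {x. x $ 3 < 0} \<subseteq> N \<and> \<phi> ` {x. 0 < x $ 3} \<subseteq> P)"

text \<open>Near the image of \<open>\<phi>\<close> the surface consists of the sheets over the coordinate planes
  \<open>x\<^sub>i = 0\<close>, \<open>i \<in> I\<close>, with height \<open>h i\<close>; the coordinates are chosen such that the normal vector
  of the \<open>i\<close>-th sheet points to the side \<open>x\<^sub>i > 0\<close>. (No condition is put on the orientation of
  \<open>\<phi>\<close> itself, so such coordinates can always be obtained by reflections.)\<close>

definition crossing_chart ::
  "R4 set \<Rightarrow> (real^2 \<Rightarrow> R4) set \<Rightarrow> 3 set \<Rightarrow> (R3 \<Rightarrow> R3) \<Rightarrow> (3 \<Rightarrow> R3 \<Rightarrow> real) \<Rightarrow> bool" where
  "crossing_chart G \<eta> I \<phi> h \<longleftrightarrow>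
     open_embedding \<phi> \<and>
     (\<forall>i\<in>I. continuous_on {x. x $ i = 0} (h i)) \<and>
     G \<inter> fst -` range \<phi> = {(\<phi> x, h i x) |i x. i \<in> I \<and> x $ i = 0} \<and>
     (\<forall>i\<in>I. \<forall>x. x $ i = 0 \<and> (\<forall>j\<in>I - {i}. x $ j \<noteq> 0) \<longrightarrow>
        normal_crosses G \<eta> (\<phi> x) (\<phi> ` {y. y $ i < 0}) (\<phi> ` {y. 0 < y $ i}))"

text \<open>Over-sheet \<open>x\<^sub>1 = 0\<close>, under-sheet \<open>x\<^sub>2 = 0\<close>.\<close>

definition double_chart ::
  "R4 set \<Rightarrow> (real^2 \<Rightarrow> R4) set \<Rightarrow> (R3 \<Rightarrow> R3) \<Rightarrow> bool" where
  "double_chart G \<eta> \<phi> \<longleftrightarrow>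
     (\<exists>h. crossing_chart G \<eta> {1, 2} \<phi> h \<and>
        (\<forall>x. x $ 1 = 0 \<and> x $ 2 = 0 \<longrightarrow> h 2 x < h 1 x))"

text \<open>Top sheet \<open>x\<^sub>1 = 0\<close>, middle sheet \<open>x\<^sub>2 = 0\<close>, bottom sheet \<open>x\<^sub>3 = 0\<close>.\<close>

definition triple_chart ::
  "R4 set \<Rightarrow> (real^2 \<Rightarrow> R4) set \<Rightarrow> (R3 \<Rightarrow> R3) \<Rightarrow> bool" where
  "triple_chart G \<eta> \<phi> \<longleftrightarrow>
     (\<exists>h. crossing_chart G \<eta> {1, 2, 3} \<phi> h \<and>
        (\<forall>x. x $ 1 = 0 \<and> x $ 2 = 0 \<longrightarrow> h 2 x < h 1 x) \<and>
        (\<forall>x. x $ 2 = 0 \<and> x $ 3 = 0 \<longrightarrow> h 3 x < h 2 x) \<and>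
        (\<forall>x. x $ 1 = 0 \<and> x $ 3 = 0 \<longrightarrow> h 3 x < h 1 x))"

text \<open>The Whitney umbrella, i.e. the cone over a figure eight.\<close>

definition umbrella :: "real^2 \<Rightarrow> R3" where
  "umbrella u = vector [u $ 1, (u $ 2)\<^sup>2, u $ 1 * u $ 2]"

definition branch_chart :: "R4 set \<Rightarrow> (R3 \<Rightarrow> R3) \<Rightarrow> bool" where
  "branch_chart G \<phi> \<longleftrightarrow>
     open_embedding \<phi> \<and>
     (\<exists>h :: real^2 \<Rightarrow> real. continuous_on UNIV h \<and>
        inj (\<lambda>u. (\<phi> (umbrella u), h u)) \<and>
        G \<inter> fst -` range \<phi> = range (\<lambda>u. (\<phi> (umbrella u), h u)))"

definition double_points :: "R4 set \<Rightarrow> (real^2 \<Rightarrow> R4) set \<Rightarrow> R3 set" where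
  "double_points G \<eta> = {\<phi> 0 |\<phi>. double_chart G \<eta> \<phi>}"

definition triple_points :: "R4 set \<Rightarrow> (real^2 \<Rightarrow> R4) set \<Rightarrow> R3 set" where
  "triple_points G \<eta> = {\<phi> 0 |\<phi>. triple_chart G \<eta> \<phi>}"

definition branch_points :: "R4 set \<Rightarrow> R3 set" where
  "branch_points G = {\<phi> 0 |\<phi>. branch_chart G \<phi>}"

definition regular_projection :: "R4 set \<Rightarrow> (real^2 \<Rightarrow> R4) set \<Rightarrow> bool" where
  "regular_projection G \<eta> \<longleftrightarrow>
     fst ` G = regular_points G \<eta> \<union> double_points G \<eta> \<union> triple_points G \<eta> \<union> branch_points G"

definition connected_diagram_of ::
  "R4 set \<Rightarrow> (real^2 \<Rightarrow> R4) set \<Rightarrow> R4 set \<Rightarrow> (real^2 \<Rightarrow> R4) set \<Rightarrow> bool" where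
  "connected_diagram_of F \<omega> G \<eta> \<longleftrightarrow>
     ambient_isotopic F \<omega> G \<eta> \<and> regular_projection G \<eta> \<and> connected (fst ` G)"

text \<open>Removing small neighbourhoods of the double point curves (with their end points, the triple
  and branch points) leaves, up to shrinking, the regular points. Both the over- and the
  under-sheet are cut.\<close>

definition semi_sheets :: "R4 set \<Rightarrow> (real^2 \<Rightarrow> R4) set \<Rightarrow> R3 set set" where
  "semi_sheets G \<eta> = components (regular_points G \<eta>)"

definition regions :: "R4 set \<Rightarrow> R3 set set" where
  "regions G = components (- (fst ` G))"

definition sheet_at :: "R4 set \<Rightarrow> (real^2 \<Rightarrow> R4) set \<Rightarrow> R3 \<Rightarrow> R3 set" where
  "sheet_at G \<eta> q = connected_component_set (regular_points G \<eta>) q"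

definition region_at :: "R4 set \<Rightarrow> R3 \<Rightarrow> R3 set" where
  "region_at G q = connected_component_set (- (fst ` G)) q"

text \<open>The semi-sheets at a double point, read off from a chart as in \<open>double_chart\<close>. Both
  normal vectors point away from the quadrant \<open>x\<^sub>1 < 0, x\<^sub>2 < 0\<close>.\<close>

definition sheet_u1 :: "R4 set \<Rightarrow> (real^2 \<Rightarrow> R4) set \<Rightarrow> (R3 \<Rightarrow> R3) \<Rightarrow> R3 set" where
  "sheet_u1 G \<eta> \<phi> = sheet_at G \<eta> (\<phi> (vector [-1, 0, 0]))"

definition sheet_u2 :: "R4 set \<Rightarrow> (real^2 \<Rightarrow> R4) set \<Rightarrow> (R3 \<Rightarrow> R3) \<Rightarrow> R3 set" where
  "sheet_u2 G \<eta> \<phi> = sheet_at G \<eta> (\<phi> (vector [1, 0, 0]))"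

definition sheet_o1 :: "R4 set \<Rightarrow> (real^2 \<Rightarrow> R4) set \<Rightarrow> (R3 \<Rightarrow> R3) \<Rightarrow> R3 set" where
  "sheet_o1 G \<eta> \<phi> = sheet_at G \<eta> (\<phi> (vector [0, -1, 0]))"

definition sheet_o2 :: "R4 set \<Rightarrow> (real^2 \<Rightarrow> R4) set \<Rightarrow> (R3 \<Rightarrow> R3) \<Rightarrow> R3 set" where
  "sheet_o2 G \<eta> \<phi> = sheet_at G \<eta> (\<phi> (vector [0, 1, 0]))"

text \<open>The data at a triple point \<open>\<tau>\<close>, read off from a chosen chart (they do not depend on the
  choice). All normal vectors point away from the octant where all coordinates are negative.\<close>

definition chart_at_triple ::
  "R4 set \<Rightarrow> (real^2 \<Rightarrow> R4) set \<Rightarrow> R3 \<Rightarrow> (R3 \<Rightarrow> R3)" where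
  "chart_at_triple G \<eta> \<tau> = (SOME \<phi>. triple_chart G \<eta> \<phi> \<and> \<phi> 0 = \<tau>)"

definition triple_r1 :: "R4 set \<Rightarrow> (real^2 \<Rightarrow> R4) set \<Rightarrow> R3 \<Rightarrow> R3 set" where
  "triple_r1 G \<eta> \<tau> = region_at G (chart_at_triple G \<eta> \<tau> (vector [-1, -1, -1]))"

definition triple_b1 :: "R4 set \<Rightarrow> (real^2 \<Rightarrow> R4) set \<Rightarrow> R3 \<Rightarrow> R3 set" where
  "triple_b1 G \<eta> \<tau> = sheet_at G \<eta> (chart_at_triple G \<eta> \<tau> (vector [-1, -1, 0]))"

definition triple_m1 :: "R4 set \<Rightarrow> (real^2 \<Rightarrow> R4) set \<Rightarrow> R3 \<Rightarrow> R3 set" where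
  "triple_m1 G \<eta> \<tau> = sheet_at G \<eta> (chart_at_triple G \<eta> \<tau> (vector [-1, 0, -1]))"

definition triple_t1 :: "R4 set \<Rightarrow> (real^2 \<Rightarrow> R4) set \<Rightarrow> R3 \<Rightarrow> R3 set" where
  "triple_t1 G \<eta> \<tau> = sheet_at G \<eta> (chart_at_triple G \<eta> \<tau> (vector [0, -1, -1]))"

definition triple_sign :: "R4 set \<Rightarrow> (real^2 \<Rightarrow> R4) set \<Rightarrow> R3 \<Rightarrow> int" where
  "triple_sign G \<eta> \<tau> =
     (if orientation_preserving (chart_at_triple G \<eta> \<tau>) then 1 else -1)"


section \<open>Colorings\<close>

text \<open>A shadow coloring is given by its restrictions to the semi-sheets and to the regions. The
  maps are extensional, so that distinct elements are distinct colorings.\<close>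

definition Col_SB ::
  "'b set \<Rightarrow> 'x set \<Rightarrow> ('b \<Rightarrow> 'b \<Rightarrow> 'b) \<Rightarrow> ('b \<Rightarrow> 'b \<Rightarrow> 'b) \<Rightarrow> ('x \<Rightarrow> 'b \<Rightarrow> 'x)
     \<Rightarrow> R4 set \<Rightarrow> (real^2 \<Rightarrow> R4) set \<Rightarrow> ((R3 set \<Rightarrow> 'b) \<times> (R3 set \<Rightarrow> 'x)) set" where
  "Col_SB B X ud ov act G \<eta> =
     {(Cs, Cr). Cs \<in> semi_sheets G \<eta> \<rightarrow>\<^sub>E B \<and> Cr \<in> regions G \<rightarrow>\<^sub>E X \<and>
        (\<forall>\<phi>. double_chart G \<eta> \<phi> \<longrightarrow>
           Cs (sheet_u2 G \<eta> \<phi>) = ud (Cs (sheet_u1 G \<eta> \<phi>)) (Cs (sheet_o1 G \<eta> \<phi>)) \<and>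
           Cs (sheet_o2 G \<eta> \<phi>) = ov (Cs (sheet_o1 G \<eta> \<phi>)) (Cs (sheet_u1 G \<eta> \<phi>))) \<and>
        (\<forall>s\<in>semi_sheets G \<eta>. \<forall>r1\<in>regions G. \<forall>r2\<in>regions G.
           (\<exists>q\<in>s. normal_crosses G \<eta> q r1 r2) \<longrightarrow> act (Cr r1) (Cs s) = Cr r2)}"

definition Col_LB ::
  "'x set \<Rightarrow> ('x \<Rightarrow> 'x \<Rightarrow> 'x \<Rightarrow> 'x) \<Rightarrow> R4 set \<Rightarrow> (real^2 \<Rightarrow> R4) set
     \<Rightarrow> (R3 set \<Rightarrow> 'x \<times> 'x) set" where
  "Col_LB X br G \<eta> =
     {C \<in> semi_sheets G \<eta> \<rightarrow>\<^sub>E X \<times> X.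
        \<forall>\<phi>. double_chart G \<eta> \<phi> \<longrightarrow>
          fst (C (sheet_u1 G \<eta> \<phi>)) = fst (C (sheet_o1 G \<eta> \<phi>)) \<and>
          C (sheet_u2 G \<eta> \<phi>) = lb_ud br (C (sheet_u1 G \<eta> \<phi>)) (C (sheet_o1 G \<eta> \<phi>)) \<and>
          C (sheet_o2 G \<eta> \<phi>) = lb_ov br (C (sheet_o1 G \<eta> \<phi>)) (C (sheet_u1 G \<eta> \<phi>))}"

definition W_SB ::
  "'b set \<Rightarrow> 'x set \<Rightarrow> R4 set \<Rightarrow> (real^2 \<Rightarrow> R4) set
     \<Rightarrow> (R3 set \<Rightarrow> 'b) \<times> (R3 set \<Rightarrow> 'x) \<Rightarrow> (('x \<times> 'b list) \<Rightarrow>\<^sub>0 int) set" where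
  "W_SB B X G \<eta> C =
     D_sb B X 3 #>\<^bsub>C_sb B X 3\<^esub>
       (\<Sum>\<tau>\<in>triple_points G \<eta>. frag_cmul (triple_sign G \<eta> \<tau>)
          (frag_of (snd C (triple_r1 G \<eta> \<tau>),
             [fst C (triple_b1 G \<eta> \<tau>), fst C (triple_m1 G \<eta> \<tau>), fst C (triple_t1 G \<eta> \<tau>)])))"

definition W_LB ::
  "'x set \<Rightarrow> R4 set \<Rightarrow> (real^2 \<Rightarrow> R4) set
     \<Rightarrow> (R3 set \<Rightarrow> 'x \<times> 'x) \<Rightarrow> (('x \<times> 'x) list \<Rightarrow>\<^sub>0 int) set" where
  "W_LB X G \<eta> C =
     D_lb X 3 #>\<^bsub>C_lb X 3\<^esub>
       (\<Sum>\<tau>\<in>triple_points G \<eta>. frag_cmul (triple_sign G \<eta> \<tau>)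
          (frag_of [C (triple_b1 G \<eta> \<tau>), C (triple_m1 G \<eta> \<tau>), C (triple_t1 G \<eta> \<tau>)]))"


section \<open>The invariants as multisets\<close>

text \<open>The sets of colorings may be infinite, so multiplicities may be infinite cardinals. A multiset
  \<open>{f i : i \<in> S}\<close> is therefore an indexed family \<open>(S, f)\<close>, and two families are equal as multisets
  if one is a bijective reindexing of the other.\<close>

type_synonym ('i, 'v) family = "'i set \<times> ('i \<Rightarrow> 'v)"

definition same_multiset :: "('i, 'v) family \<Rightarrow> ('j, 'v) family \<Rightarrow> bool" where
  "same_multiset M N \<longleftrightarrow>
     (\<exists>\<beta>. bij_betw \<beta> (fst M) (fst N) \<and> (\<forall>i\<in>fst M. snd N (\<beta> i) = snd M i))"

definition family_image :: "('v \<Rightarrow> 'w) \<Rightarrow> ('i, 'v) family \<Rightarrow> ('i, 'w) family" where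
  "family_image g M = (fst M, g \<circ> snd M)"

lemma same_multiset_finite:
  assumes "finite S" "finite T"
  shows "same_multiset (S, f) (T, g) \<longleftrightarrow> image_mset f (mset_set S) = image_mset g (mset_set T)"
proof
  assume "same_multiset (S, f) (T, g)"
  then obtain \<beta> where b: "bij_betw \<beta> S T" and e: "\<forall>i\<in>S. g (\<beta> i) = f i"
    by (auto simp: same_multiset_def)
  have "mset_set T = image_mset \<beta> (mset_set S)"
    using b by (metis bij_betw_def image_mset_mset_set)
  then have "image_mset g (mset_set T) = image_mset (\<lambda>i. g (\<beta> i)) (mset_set S)"
    by (simp add: multiset.map_comp comp_def)
  also have "\<dots> = image_mset f (mset_set S)"
    using e assms by (intro image_mset_cong) auto
  finally show "image_mset f (mset_set S) = image_mset g (mset_set T)" by simp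
next
  assume eq: "image_mset f (mset_set S) = image_mset g (mset_set T)"
  have "card {i \<in> S. f i = v} = card {j \<in> T. g j = v}" for v
    using arg_cong[OF eq, of "\<lambda>M. count M v"] assms
    by (simp add: count_image_mset' conj_commute eq_commute[of v])
  then have "\<forall>v. \<exists>\<gamma>. bij_betw \<gamma> {i \<in> S. f i = v} {j \<in> T. g j = v}"
    using assms by (simp add: finite_same_card_bij)
  then obtain \<gamma> where g: "\<And>v. bij_betw (\<gamma> v) {i \<in> S. f i = v} {j \<in> T. g j = v}"
    by metis
  have mem: "\<gamma> (f i) i \<in> T \<and> g (\<gamma> (f i) i) = f i" if "i \<in> S" for i
    using bij_betwE[OF g[of "f i"]] that by blast
  have "bij_betw (\<lambda>i. \<gamma> (f i) i) S T"
    unfolding bij_betw_def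
  proof
    show "inj_on (\<lambda>i. \<gamma> (f i) i) S"
    proof (rule inj_onI)
      fix i j assume ij: "i \<in> S" "j \<in> S" "\<gamma> (f i) i = \<gamma> (f j) j"
      then have "f i = f j" using mem by metis
      then show "i = j"
        using ij g[of "f j"] unfolding bij_betw_def inj_on_def by auto
    qed
    show "(\<lambda>i. \<gamma> (f i) i) ` S = T"
    proof
      show "(\<lambda>i. \<gamma> (f i) i) ` S \<subseteq> T" using mem by auto
      show "T \<subseteq> (\<lambda>i. \<gamma> (f i) i) ` S"
      proof
        fix j assume "j \<in> T"
        then have "j \<in> \<gamma> (g j) ` {i \<in> S. f i = g j}"
          using g[of "g j"] unfolding bij_betw_def by auto
        then obtain i where "i \<in> S" "f i = g j" "j = \<gamma> (g j) i" by auto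
        then have "j = \<gamma> (f i) i" by simp
        with \<open>i \<in> S\<close> show "j \<in> (\<lambda>i. \<gamma> (f i) i) ` S" by blast
      qed
    qed
  qed
  with mem show "same_multiset (S, f) (T, g)"
    by (auto simp: same_multiset_def)
qed

definition HH_SB ::
  "'b set \<Rightarrow> 'x set \<Rightarrow> ('b \<Rightarrow> 'b \<Rightarrow> 'b) \<Rightarrow> ('b \<Rightarrow> 'b \<Rightarrow> 'b) \<Rightarrow> ('x \<Rightarrow> 'b \<Rightarrow> 'x)
     \<Rightarrow> R4 set \<Rightarrow> (real^2 \<Rightarrow> R4) set
     \<Rightarrow> ((R3 set \<Rightarrow> 'b) \<times> (R3 set \<Rightarrow> 'x), (('x \<times> 'b list) \<Rightarrow>\<^sub>0 int) set set) family" where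
  "HH_SB B X ud ov act G \<eta> =
     (Col_SB B X ud ov act G \<eta>,
      \<lambda>C. homology_class (C_SB B X) (bd_SB B X ud ov act) 3 (W_SB B X G \<eta> C))"

definition HH_LB ::
  "'x set \<Rightarrow> ('x \<Rightarrow> 'x \<Rightarrow> 'x \<Rightarrow> 'x) \<Rightarrow> R4 set \<Rightarrow> (real^2 \<Rightarrow> R4) set
     \<Rightarrow> (R3 set \<Rightarrow> 'x \<times> 'x, (('x \<times> 'x) list \<Rightarrow>\<^sub>0 int) set set) family" where
  "HH_LB X br G \<eta> =
     (Col_LB X br G \<eta>, \<lambda>C. homology_class (C_LB X) (bd_LB X br) 3 (W_LB X G \<eta> C))"

definition Phi_SB ::
  "'b set \<Rightarrow> 'x set \<Rightarrow> ('b \<Rightarrow> 'b \<Rightarrow> 'b) \<Rightarrow> ('b \<Rightarrow> 'b \<Rightarrow> 'b) \<Rightarrow> ('x \<Rightarrow> 'b \<Rightarrow> 'x)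
     \<Rightarrow> ((('x \<times> 'b list) \<Rightarrow>\<^sub>0 int) set \<Rightarrow> 'a) \<Rightarrow> R4 set \<Rightarrow> (real^2 \<Rightarrow> R4) set
     \<Rightarrow> ((R3 set \<Rightarrow> 'b) \<times> (R3 set \<Rightarrow> 'x), 'a) family" where
  "Phi_SB B X ud ov act \<theta> G \<eta> = (Col_SB B X ud ov act G \<eta>, \<lambda>C. \<theta> (W_SB B X G \<eta> C))"

definition Phi_LB ::
  "'x set \<Rightarrow> ('x \<Rightarrow> 'x \<Rightarrow> 'x \<Rightarrow> 'x) \<Rightarrow> ((('x \<times> 'x) list \<Rightarrow>\<^sub>0 int) set \<Rightarrow> 'a) \<Rightarrow> R4 set \<Rightarrow> (real^2 \<Rightarrow> R4) set
     \<Rightarrow> (R3 set \<Rightarrow> 'x \<times> 'x, 'a) family" where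
  "Phi_LB X br \<theta> G \<eta> = (Col_LB X br G \<eta>, \<lambda>C. \<theta> (W_LB X G \<eta> C))"

end

theory Submission
  imports Defs "HOL-Homology.Brouwer_Degree"
begin

text \<open>
  A shadow coloring gives each semi-sheet \<open>s\<close> the pair of colors of the regions on the negative
  and on the positive side of \<open>s\<close>; by strong connectivity this pair determines the biquandle
  color of \<open>s\<close>, and it satisfies the local biquandle rules. For the converse, a local biquandle
  coloring prescribes region colors near every point of the diagram \<open>D\<close>. By compactness these
  fit together to a locally constant function on \<open>N - D\<close> for a connected open neighbourhood \<open>N\<close>
  of \<open>D\<close>, and since 3-space is unicoherent, \<open>N\<close> meets every region in a connected set; so the
  regions get well-defined colors. That a semi-sheet has only one normal direction rests on the
  fact that the identity of the 2-sphere is not homotopic to a reflection. The chain map sends the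
  3-chain of a shadow coloring to the one of the corresponding local biquandle coloring.
\<close>

section \<open>Homotopies of spheres\<close>

text \<open>As all charts are merely topological, a normal vector has no derivative behind it. A
  side of \<open>D\<close> is recorded by \<open>germ\<close> instead: the two values that a
  function on the complement takes on the half balls of a right-handed chart. Extending sheet colors
  to regions thus becomes a problem about locally constant functions with prescribed germs. Two
  facts drive the gluing. If \<open>W\<close> is open and connected and meets \<open>D\<close>,
  every component of \<open>W - D\<close> abuts \<open>D\<close> at a regular point of
  \<open>W\<close>, so a function is determined by its germs. And connectedness of the diagram makes
  \<open>N\<close> connected, which unicoherence requires: for two disjoint spheres, the region
  outside both could be given unrelated colors by the two sheets. A further obstacle is that a chart
  centred at a point of one kind does not say of which kind the neighbouring points are. Numbers of
  preimages decide this, except between regular and branch points, which both have one; there the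
  double points accumulating at a branch point make the difference.\<close>

definition mirror3 :: "real^3 \<Rightarrow> real^3" where
  "mirror3 x = (\<chi> i. if i = 3 then - x $ 3 else x $ i)"

lemma norm3: "norm (x::real^3) = sqrt ((x$1)^2 + (x$2)^2 + (x$3)^2)"
  by (simp add: norm_vec_def L2_set_def sum_3)

abbreviation sphere_homotopic :: "('a::euclidean_space \<Rightarrow> 'a) \<Rightarrow> ('a \<Rightarrow> 'a) \<Rightarrow> bool" where
  "sphere_homotopic \<equiv> homotopic_with_canon (\<lambda>_. True) (sphere 0 1) (sphere 0 1)"

text \<open>Conjugation with the standard 2-sphere of the homology library turns
  \<open>mirror3\<close> into the reflection in one coordinate, whose Brouwer degree is -1, while
  the identity has degree 1. This is the only place where degree theory enters.\<close>

lemma id_not_homotopic_mirror3: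
  "\<not> sphere_homotopic id mirror3"
proof
  assume h: "sphere_homotopic id mirror3"
  \<comment> \<open>Coordinate 3 goes to index 0 because \<open>Brouwer_degree2_reflection\<close>
    negates that index.\<close>
  define f :: "(nat \<Rightarrow> real) \<Rightarrow> real^3" where "f x = (\<chi> i. if i = 3 then x 0 else if i = 1 then x 1 else x 2)" for x
  define g :: "real^3 \<Rightarrow> nat \<Rightarrow> real" where
    "g v i = (if i = 0 then v $ 3 else if i = 1 then v $ 1 else if i = 2 then v $ 2 else 0)" for v i
  have sum2: "(\<Sum>i\<le>(2::nat). h i) = h 0 + h 1 + h 2" for h :: "nat \<Rightarrow> real"
    by (simp add: numeral_2_eq_2)
  have nrm: "norm (f x) = sqrt (\<Sum>i\<le>(2::nat). (x i)\<^sup>2)" for x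
    unfolding sum2 norm3 by (simp add: f_def add_ac)
  have f: "continuous_map (nsphere 2) (top_of_set (sphere 0 1)) f"
    unfolding continuous_map_in_subtopology
  proof
    define S where "S = {x :: nat \<Rightarrow> real. (\<Sum>i\<le>2. (x i)\<^sup>2) = 1 \<and> (\<forall>i>2. x i = 0)}"
    have "continuous_on S (\<lambda>x. if i = 3 then x 0 else if i = 1 then x 1 else x 2)" for i :: 3
      by (cases "i = 3"; cases "i = 1") (simp_all add: continuous_on_subset[OF continuous_on_product_coordinates])
    then have "continuous_on S f" by (simp add: f_def continuous_on_vec_lambda)
    then show "continuous_map (nsphere 2) euclidean f"
      by (simp add: nsphere euclidean_product_topology S_def)
    show "f \<in> topspace (nsphere 2) \<rightarrow> sphere 0 1"
      by (auto simp: nsphere nrm)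
  qed
  have g: "continuous_map (top_of_set (sphere 0 1)) (nsphere 2) g"
    unfolding nsphere continuous_map_in_subtopology continuous_map_componentwise_UNIV
  proof (intro conjI allI)
    fix k
    show "continuous_map (top_of_set (sphere 0 1)) euclideanreal (\<lambda>x. g x k)"
      by (cases "k = 0"; cases "k = 1"; cases "k = 2") (simp_all add: g_def continuous_intros)
  qed (auto simp: g_def sum2 norm3 add_ac)
  have "homotopic_with (\<lambda>_. True) (nsphere 2) (nsphere 2) (g \<circ> id \<circ> f) (g \<circ> mirror3 \<circ> f)"
    using homotopic_with_compose_continuous_map_right[OF homotopic_with_compose_continuous_map_left[OF h g] f, of "\<lambda>_. True"]
    by simp
  then have "Brouwer_degree2 2 (g \<circ> id \<circ> f) = Brouwer_degree2 2 (g \<circ> mirror3 \<circ> f)"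
    by (rule Brouwer_degree2_homotopic)
  moreover have "Brouwer_degree2 2 (g \<circ> id \<circ> f) = Brouwer_degree2 2 id"
    by (rule Brouwer_degree2_eq) (auto simp: nsphere g_def f_def)
  moreover have "Brouwer_degree2 2 (g \<circ> mirror3 \<circ> f) = Brouwer_degree2 2 (\<lambda>x i. if i = 0 then -x i else x i)"
    by (rule Brouwer_degree2_eq) (auto simp: nsphere g_def f_def mirror3_def)
  ultimately show False by (simp add: Brouwer_degree2_reflection)
qed


text \<open>The segment between two unit vectors meets 0 only if they are antipodal. So the
  straight-line homotopy stays in the punctured space, and \<open>sgn\<close> pushes it to the
  sphere.\<close>

lemma homotopic_nonantipodal:
  fixes f g :: "'a::topological_space \<Rightarrow> 'b::real_normed_vector"
  assumes "continuous_on S f" "continuous_on S g"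
    and f: "f ` S \<subseteq> sphere 0 1" and g: "g ` S \<subseteq> sphere 0 1" and ne: "\<And>x. x \<in> S \<Longrightarrow> g x \<noteq> - f x"
  shows "homotopic_with_canon (\<lambda>_. True) S (sphere 0 1) f g"
proof -
  have "homotopic_with_canon (\<lambda>_. True) S (- {0}) f g"
  proof (rule homotopic_with_linear)
    fix x assume x: "x \<in> S"
    show "closed_segment (f x) (g x) \<subseteq> - {0}"
    proof
      fix y assume "y \<in> closed_segment (f x) (g x)"
      then obtain t where t: "0 \<le> t" "t \<le> 1" "y = (1 - t) *\<^sub>R f x + t *\<^sub>R g x"
        by (auto simp: closed_segment_def)
      have n: "norm (f x) = 1" "norm (g x) = 1" using f g x by auto
      have "y \<noteq> 0"
      proof
        assume "y = 0"
        then have e: "(1 - t) *\<^sub>R f x = - (t *\<^sub>R g x)" using t(3) by (simp add: eq_neg_iff_add_eq_0)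
        then have "norm ((1 - t) *\<^sub>R f x) = norm (t *\<^sub>R g x)" by simp
        then have "1 - t = t" using t n by simp
        then have "t = 1/2" by simp
        then have "(1/2) *\<^sub>R (g x + f x) = 0"
          using e unfolding \<open>t = 1/2\<close> by (simp add: algebra_simps)
        then show False using ne[OF x] by (simp add: eq_neg_iff_add_eq_0)
      qed
      then show "y \<in> - {0}" by simp
    qed
  qed (use assms in auto)
  then have "homotopic_with_canon (\<lambda>_. True) S (sphere 0 1) (sgn \<circ> f) (sgn \<circ> g)"
    by (rule homotopic_with_compose_continuous_left)
      (auto intro!: continuous_intros simp: norm_sgn)
  then show ?thesis
    by (rule homotopic_with_eq) (use f g in \<open>auto simp: sgn_div_norm\<close>)
qed

text \<open>Multiplicativity of the local degree, phrased with homotopy representatives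
  \<open>k\<close> and \<open>k'\<close> so that one factor may be a reflection.\<close>

lemma homotopic_sgn_compose:
  fixes f g :: "'a::euclidean_space \<Rightarrow> 'a"
  assumes U: "open U" "u \<in> U" "continuous_on U g" "inj_on g U"
    and V: "open V" "g u \<in> V" "continuous_on V f" "inj_on f V"
    and hg: "\<forall>\<^sub>F r in at_right (0::real). sphere_homotopic
               (\<lambda>x. sgn (g (u + r *\<^sub>R x) - g u)) k"
    and hf: "\<forall>\<^sub>F r in at_right (0::real). sphere_homotopic
               (\<lambda>x. sgn (f (g u + r *\<^sub>R x) - f (g u))) k'"
  shows "\<forall>\<^sub>F r in at_right (0::real). sphere_homotopic
               (\<lambda>x. sgn (f (g (u + r *\<^sub>R x)) - f (g u))) (k' \<circ> k)"
proof -
  obtain e where e: "e > 0" "ball (g u) e \<subseteq> V" using V open_contains_ball by blast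
  have "\<forall>\<^sub>F r in at_right (0::real). r \<in> {0<..<e}"
    using e(1) by (rule eventually_at_right_real)
  from eventually_happens[OF eventually_conj[OF this hf]] obtain s where s: "0 < s" "s < e"
    and hs: "sphere_homotopic
               (\<lambda>x. sgn (f (g u + s *\<^sub>R x) - f (g u))) k'"
    by auto
  have "isCont g u" using U continuous_on_eq_continuous_at by blast
  then obtain d1 where d1: "d1 > 0" "\<And>y. dist y u < d1 \<Longrightarrow> dist (g y) (g u) < e"
    using e(1) unfolding continuous_at_eps_delta by blast
  obtain d2 where d2: "d2 > 0" "ball u d2 \<subseteq> U" using U open_contains_ball by blast
  have "\<forall>\<^sub>F r in at_right (0::real). r \<in> {0<..<min d1 d2}"
    using d1 d2 by (intro eventually_at_right_real) auto
  with hg show ?thesis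
  proof eventually_elim
    case (elim r)
    then have r: "0 < r" "r < d1" "r < d2" by auto
    define D where "D x = g (u + r *\<^sub>R x) - g u" for x
    have inU: "u + r *\<^sub>R x \<in> U" if "x \<in> sphere 0 1" for x
      using d2 r that by (auto simp: subset_iff dist_norm)
    have D0: "D x \<noteq> 0" if "x \<in> sphere 0 1" for x
    proof
      assume "D x = 0"
      then have "u + r *\<^sub>R x = u" using inj_onD[OF U(4) _ inU[OF that] U(2)] by (simp add: D_def)
      then show False using r that by auto
    qed
    have Dn: "norm (D x) < e" if "x \<in> sphere 0 1" for x
      using d1(2)[of "u + r *\<^sub>R x"] r that by (simp add: D_def dist_norm)
    have Dc: "continuous_on (sphere 0 1) D"
      unfolding D_def by (intro continuous_intros continuous_on_compose2[OF U(3)]) (use inU in auto)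
    \<comment> \<open>The direction \<open>sgn (D x)\<close> is kept while the length of
      \<open>D x\<close> is deformed to the fixed radius \<open>s\<close>. Both lengths lie strictly
      between 0 and \<open>e\<close>, so injectivity of \<open>f\<close> on \<open>V\<close> keeps
      the difference of values away from 0.\<close>
    define m where "m p = (1 - fst p) * norm (D (snd p)) + fst p * s" for p :: "real \<times> 'a"
    have m: "0 < m p" "m p < e" if "p \<in> {0..1} \<times> sphere 0 1" for p
    proof -
      obtain t x where p: "p = (t, x)" by (cases p)
      have t: "0 \<le> t" "t \<le> 1" and x: "x \<in> sphere 0 1" using that p by auto
      have "0 < norm (D x)" "norm (D x) < e" using D0 Dn x by auto
      then have "norm (D x) \<in> {0<..<e}" "s \<in> {0<..<e}" using s by auto
      moreover have "convex {0<..<e}" by (rule convex_real_interval)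
      ultimately have "(1 - t) *\<^sub>R norm (D x) + t *\<^sub>R s \<in> {0<..<e}"
        using convexD_alt t by blast
      then show "0 < m p" "m p < e" by (auto simp: m_def p)
    qed
    define H where "H p = sgn (f (g u + m p *\<^sub>R sgn (D (snd p))) - f (g u))" for p
    have arg: "g u + m p *\<^sub>R sgn (D (snd p)) \<in> V" "g u + m p *\<^sub>R sgn (D (snd p)) \<noteq> g u"
      if "p \<in> {0..1} \<times> sphere 0 1" for p
    proof -
      have "D (snd p) \<noteq> 0" using D0 that by auto
      then have "norm (m p *\<^sub>R sgn (D (snd p))) = m p" using m[OF that] by (simp add: norm_sgn)
      then show "g u + m p *\<^sub>R sgn (D (snd p)) \<in> V" "g u + m p *\<^sub>R sgn (D (snd p)) \<noteq> g u"
        using m[OF that] e(2) by (auto simp: subset_iff dist_norm)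
    qed
    have ne: "f (g u + m p *\<^sub>R sgn (D (snd p))) - f (g u) \<noteq> 0" if "p \<in> {0..1} \<times> sphere 0 1" for p
      using arg[OF that] V(2,4) by (auto dest: inj_onD)
    have Dc2: "continuous_on ({0..1} \<times> sphere 0 1) (\<lambda>p::real \<times> 'a. D (snd p))"
      by (rule continuous_on_compose2[OF Dc]) (auto intro: continuous_intros)
    have "continuous_on ({0..1} \<times> sphere 0 1) H"
      unfolding H_def
    proof (intro continuous_on_sgn continuous_on_diff continuous_on_const)
      show "continuous_on ({0..1} \<times> sphere 0 1) (\<lambda>p. f (g u + m p *\<^sub>R sgn (D (snd p))))"
        by (rule continuous_on_compose2[OF V(3)])
          (use arg D0 in \<open>auto simp: m_def intro!: continuous_intros Dc2\<close>)
      show "\<forall>p\<in>{0..1} \<times> sphere 0 1. f (g u + m p *\<^sub>R sgn (D (snd p))) - f (g u) \<noteq> 0"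
        using ne by blast
    qed
    moreover have "H ` ({0..1} \<times> sphere 0 1) \<subseteq> sphere 0 1"
      using ne by (auto simp: H_def norm_sgn)
    ultimately have "sphere_homotopic
        (\<lambda>x. H (0, x)) (\<lambda>x. H (1, x))"
      unfolding homotopic_with_def by (intro exI[of _ H]) (auto simp: continuous_map_subtopology_eu)
    moreover have "sphere_homotopic
       ((\<lambda>x. sgn (f (g u + s *\<^sub>R x) - f (g u))) \<circ> (\<lambda>x. sgn (g (u + r *\<^sub>R x) - g u))) (k' \<circ> k)"
      by (rule homotopic_compose[OF _ hs]) (use elim in simp)
    moreover have "(\<lambda>x. sgn (f (g u + s *\<^sub>R x) - f (g u))) \<circ> (\<lambda>x. sgn (g (u + r *\<^sub>R x) - g u))
        = (\<lambda>x. H (1, x))"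
      by (auto simp: H_def m_def D_def)
    ultimately have "sphere_homotopic (\<lambda>x. H (0, x)) (k' \<circ> k)"
      using homotopic_with_trans by metis
    moreover have "H (0, x) = sgn (f (g (u + r *\<^sub>R x)) - f (g u))" for x
    proof -
      have "norm v *\<^sub>R sgn v = v" for v :: 'a by (cases "v = 0") (simp_all add: sgn_div_norm)
      then show ?thesis by (simp add: H_def m_def D_def)
    qed
    ultimately show ?case by simp
  qed
qed

section \<open>A plane in 3-space, its orientation and its two sides\<close>

abbreviation emb :: "real^2 \<Rightarrow> real^3" where "emb u \<equiv> vector [u $ 1, u $ 2, 0]"
definition pr :: "real^3 \<Rightarrow> real^2" where "pr x = vector [x $ 1, x $ 2]"

lemma norm_pr: "(norm (pr x))\<^sup>2 = (x $ 1)\<^sup>2 + (x $ 2)\<^sup>2"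
  by (simp add: norm_vec_def L2_set_def sum_2 pr_def)

lemma norm2_square: "(norm (x::real^2))\<^sup>2 = (x $ 1)\<^sup>2 + (x $ 2)\<^sup>2"
  by (simp add: norm_vec_def L2_set_def sum_2)

lemma norm3_square: "(norm (x::real^3))\<^sup>2 = (x $ 1)\<^sup>2 + (x $ 2)\<^sup>2 + (x $ 3)\<^sup>2"
  by (simp add: norm_vec_def L2_set_def sum_3)

lemma vec3_eq_iff: "(x::real^3) = y \<longleftrightarrow> x $ 1 = y $ 1 \<and> x $ 2 = y $ 2 \<and> x $ 3 = y $ 3"
  by (simp add: vec_eq_iff forall_3)

lemma vec2_eq_iff: "(x::real^2) = y \<longleftrightarrow> x $ 1 = y $ 1 \<and> x $ 2 = y $ 2"
  by (simp add: vec_eq_iff forall_2)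

lemma continuous_on_vector3 [continuous_intros]:
  assumes "continuous_on S f" "continuous_on S g" "continuous_on S h"
  shows "continuous_on S (\<lambda>x. vector [f x, g x, h x] :: real^3)"
proof -
  have "(vector [a, b, c] :: real^3) = (\<chi> i. if i = 1 then a else if i = 2 then b else c)" for a b c
    by (simp add: vec3_eq_iff)
  moreover have "continuous_on S (\<lambda>x. if i = 1 then f x else if i = 2 then g x else h x)" for i :: 3
    using assms by (cases "i = 1"; cases "i = 2") simp_all
  ultimately show ?thesis by (simp add: continuous_on_vec_lambda)
qed

lemma continuous_on_vector2 [continuous_intros]:
  assumes "continuous_on S f" "continuous_on S g"
  shows "continuous_on S (\<lambda>x. vector [f x, g x] :: real^2)"
proof -
  have "(vector [a, b] :: real^2) = (\<chi> i. if i = 1 then a else b)" for a b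
    by (simp add: vec2_eq_iff)
  moreover have "continuous_on S (\<lambda>x. if i = 1 then f x else g x)" for i :: 2
    using assms by (cases "i = 1") simp_all
  ultimately show ?thesis by (simp add: continuous_on_vec_lambda)
qed

lemma continuous_pr [continuous_intros]: "continuous_on S f \<Longrightarrow> continuous_on S (\<lambda>x. pr (f x))"
  unfolding pr_def by (intro continuous_intros)

text \<open>\<open>K\<close> acts on the equator as \<open>k\<close> and exchanges the hemispheres,
  so it is homotopic to the suspension of \<open>k\<close> followed by the reflection. Suspending
  the homotopy from \<open>k\<close> to \<open>id\<close> leaves only the reflection.\<close>

lemma suspension_homotopic_mirror3:
  fixes k :: "real^2 \<Rightarrow> real^2" and K :: "real^3 \<Rightarrow> real^3"
  assumes h: "sphere_homotopic k id"
    and K: "continuous_on (sphere 0 1) K" "K ` sphere 0 1 \<subseteq> sphere 0 1"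
    and eq: "\<And>u. u \<in> sphere 0 1 \<Longrightarrow> K (emb u) = emb (k u)"
    and pos: "\<And>x. x \<in> sphere 0 1 \<Longrightarrow> x $ 3 > 0 \<Longrightarrow> K x $ 3 < 0"
    and neg: "\<And>x. x \<in> sphere 0 1 \<Longrightarrow> x $ 3 < 0 \<Longrightarrow> K x $ 3 > 0"
  shows "sphere_homotopic K mirror3"
proof -
  obtain H :: "real \<times> (real^2) \<Rightarrow> real^2" where H': "continuous_map (prod_topology (top_of_set {0..1}) (top_of_set (sphere 0 1)))
      (top_of_set (sphere 0 1)) H" "\<forall>u. H (0, u) = k u" "\<forall>u. H (1, u) = id u"
    using h unfolding homotopic_with_def by blast
  have "continuous_on ({0..1} \<times> sphere 0 1) H \<and> H \<in> ({0..1} \<times> sphere 0 1) \<rightarrow> sphere 0 1"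
    using H'(1) by (simp add: continuous_map_subtopology_eu)
  then have H: "continuous_on ({0..1} \<times> sphere 0 1) H" "H ` ({0..1} \<times> sphere 0 1) \<subseteq> sphere 0 1"
    by blast+
  note H = H H'(2,3)[rule_format, unfolded id_apply]
  \<comment> \<open>Radial extension of the homotopy from the circle to the plane. Where
    \<open>pr (snd p)\<close> vanishes \<open>sgn\<close> jumps, but the norm in front forces the
    limit 0.\<close>
  define q where "q p = norm (pr (snd p)) *\<^sub>R H (fst p, sgn (pr (snd p)))" for p :: "real \<times> (real^3)"
  define T where "T = {0..1::real} \<times> (UNIV :: (real^3) set)"
  have Hn: "norm (H (t, u)) = 1" if "t \<in> {0..1}" "u \<in> sphere 0 1" for t u
    using H(2) that by fastforce
  have nq: "norm (q p) = norm (pr (snd p))" if "p \<in> T" for p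
    using that Hn[of "fst p" "sgn (pr (snd p))"]
    by (cases "pr (snd p) = 0") (auto simp: q_def T_def norm_sgn)
  have "continuous_on T q"
    unfolding continuous_on_def
  proof
    fix p0 assume p0: "p0 \<in> T"
    show "(q \<longlongrightarrow> q p0) (at p0 within T)"
    proof (cases "pr (snd p0) = 0")
      case True
      have "((\<lambda>p. norm (pr (snd p))) \<longlongrightarrow> norm (pr (snd p0))) (at p0 within T)"
      proof -
        have "continuous_on T (\<lambda>p. norm (pr (snd p)))" by (intro continuous_intros)
        then show ?thesis using p0 by (simp add: continuous_on_def)
      qed
      then have "((\<lambda>p. norm (pr (snd p))) \<longlongrightarrow> 0) (at p0 within T)" using True by simp
      moreover have "\<forall>\<^sub>F p in at p0 within T. norm (q p) \<le> norm (pr (snd p))"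
        using nq by (auto simp: eventually_at_filter)
      ultimately have "(q \<longlongrightarrow> 0) (at p0 within T)" by (rule Lim_null_comparison[rotated])
      moreover have "q p0 = 0" using True by (simp add: q_def)
      ultimately show ?thesis by simp
    next
      case False
      define O' where "O' = {p :: real \<times> (real^3). pr (snd p) \<noteq> 0}"
      have "open O'" unfolding O'_def by (intro open_Collect_neq continuous_intros)
      have "continuous_on (T \<inter> O') q"
        unfolding q_def
        by (intro continuous_intros continuous_on_compose2[OF H(1)]) (auto simp: T_def O'_def norm_sgn)
      then have "(q \<longlongrightarrow> q p0) (at p0 within (T \<inter> O'))"
        using False p0 by (simp add: continuous_on_def O'_def)
      moreover have "at p0 within (T \<inter> O') = at p0 within T"
        by (rule at_within_nhd[of _ O']) (use False \<open>open O'\<close> in \<open>auto simp: O'_def\<close>)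
      ultimately show ?thesis by simp
    qed
  qed
  define F where "F p = (vector [q p $ 1, q p $ 2, - (snd p $ 3)] :: real^3)" for p
  have Fc: "continuous_on T F"
    unfolding F_def using \<open>continuous_on T q\<close> by (intro continuous_intros)
  have Fn: "norm (F p) = 1" if "p \<in> {0..1} \<times> sphere 0 1" for p
  proof -
    have p: "p \<in> T" "norm (snd p) = 1" using that by (auto simp: T_def)
    have "(norm (F p))\<^sup>2 = (norm (q p))\<^sup>2 + (snd p $ 3)\<^sup>2"
      by (simp add: norm3_square norm2_square F_def)
    also have "\<dots> = (norm (snd p))\<^sup>2" using nq[OF p(1)] by (simp add: norm_pr norm3_square)
    finally have "(norm (F p))\<^sup>2 = 1\<^sup>2" using p by simp
    then show ?thesis by (rule power2_eq_imp_eq) auto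
  qed
  have "continuous_on ({0..1} \<times> sphere 0 1) F"
    using Fc by (rule continuous_on_subset) (auto simp: T_def)
  then have FF: "sphere_homotopic (\<lambda>x. F (0, x)) (\<lambda>x. F (1, x))"
    unfolding homotopic_with_def using Fn
    by (intro exI[of _ F]) (auto simp: continuous_map_subtopology_eu)
  have F1: "F (1, x) = mirror3 x" for x
  proof -
    have "norm v *\<^sub>R sgn v = v" for v :: "real^2" by (cases "v = 0") (simp_all add: sgn_div_norm)
    then have "q (1, x) = pr x" by (simp add: q_def H(4))
    then show ?thesis by (simp add: F_def mirror3_def vec3_eq_iff pr_def)
  qed
  have c0: "continuous_on (sphere 0 1) (\<lambda>x. F (0, x))"
    by (rule continuous_on_compose2[OF Fc]) (auto simp: T_def intro: continuous_intros)
  \<comment> \<open>Off the equator the third coordinates of both maps have the same sign; on the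
    equator both maps equal \<open>emb (k (pr x))\<close>. Hence the values are never
    antipodal.\<close>
  have KF: "sphere_homotopic K (\<lambda>x. F (0, x))"
  proof (rule homotopic_nonantipodal[OF K(1) c0 K(2)])
    show "(\<lambda>x. F (0, x)) ` sphere 0 1 \<subseteq> sphere 0 1" using Fn by auto
    fix x :: "real^3" assume x: "x \<in> sphere 0 1"
    show "F (0, x) \<noteq> - K x"
    proof
      assume a: "F (0, x) = - K x"
      then have a3: "- (x $ 3) = - (K x $ 3)" by (simp add: F_def vec3_eq_iff)
      have "x $ 3 = 0" using a3 pos[OF x] neg[OF x] by linarith
      then have n1: "norm (pr x) = 1" using x norm_pr[of x] norm3_square[of x]
        by (intro power2_eq_imp_eq[of "norm (pr x)" 1]) auto
      then have p1: "sgn (pr x) = pr x" by (simp add: sgn_div_norm)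
      have "x = emb (pr x)" using \<open>x $ 3 = 0\<close> by (simp add: vec3_eq_iff pr_def)
      then have "K x = emb (k (pr x))" using eq[of "pr x"] n1 by simp
      moreover have "F (0, x) = emb (k (pr x))"
        using \<open>x $ 3 = 0\<close> n1 by (simp add: F_def q_def p1 H(3) vec3_eq_iff)
      ultimately have "K x = - K x" using a by simp
      then have "2 *\<^sub>R K x = 0" unfolding scaleR_2 eq_neg_iff_add_eq_0 .
      then have "K x = 0" by simp
      then show False using K(2) x by force
    qed
  qed
  show ?thesis using homotopic_with_trans[OF KF FF] by (simp add: F1)
qed

lemma open_embeddingD:
  assumes "open_embedding \<phi>"
  shows "continuous_on UNIV \<phi>" "inj \<phi>" "open U \<Longrightarrow> open (\<phi> ` U)" "open (range \<phi>)"
    "continuous_on (range \<phi>) (inv_into UNIV \<phi>)"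
proof -
  show 1: "continuous_on UNIV \<phi>" "inj \<phi>" "\<And>U. open U \<Longrightarrow> open (\<phi> ` U)" "open (range \<phi>)"
    using assms by (auto simp: open_embedding_def)
  show "continuous_on (range \<phi>) (inv_into UNIV \<phi>)"
    by (rule continuous_on_inverse_open_map[OF 1(1) refl])
      (use 1 in \<open>auto simp: openin_open_eq\<close>)
qed

text \<open>With the sides swapped, the transition map from \<phi> to \<phi>' would keep the
  oriented plane and exchange the half spaces, hence look like \<open>mirror3\<close> on small
  spheres. Followed by \<phi>', which has local degree 1, it gives \<phi>, which also has local
  degree 1: the identity would be homotopic to \<open>mirror3\<close>.\<close>

lemma open_embedding_sides_not_swapped:
  fixes \<phi> \<phi>' :: "real^3 \<Rightarrow> real^3" and g0 :: "real^2 \<Rightarrow> real^2"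
  assumes emb: "open_embedding \<phi>" "open_embedding \<phi>'"
    and or: "orientation_preserving_at \<phi> 0" "orientation_preserving_at \<phi>' 0" "orientation_preserving_at g0 0"
    and eq0: "\<phi> 0 = \<phi>' 0"
    and d: "d > 0" and plane: "\<And>u. u \<in> ball 0 d \<Longrightarrow> \<phi> (emb u) = \<phi>' (emb (g0 u))"
    and pos: "\<And>x. x \<in> ball 0 d \<Longrightarrow> x $ 3 > 0 \<Longrightarrow> \<phi> x \<in> \<phi>' ` {y. y $ 3 < 0}"
    and neg: "\<And>x. x \<in> ball 0 d \<Longrightarrow> x $ 3 < 0 \<Longrightarrow> \<phi> x \<in> \<phi>' ` {y. y $ 3 > 0}"
  shows False
proof -
  note E = open_embeddingD[OF emb(1)] and E' = open_embeddingD[OF emb(2)]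
  define g where "g x = inv_into UNIV \<phi>' (\<phi> x)" for x
  have nemb: "norm (emb u) = norm u" for u :: "real^2"
    by (rule power2_eq_imp_eq) (simp_all add: norm2_square norm3_square)
  have semb: "sgn (emb u) = emb (sgn u)" for u :: "real^2"
    by (simp only: sgn_div_norm nemb) (simp add: vec3_eq_iff)
  have emb0: "emb (0::real^2) = 0" by (simp add: vec3_eq_iff)
  have inr: "\<phi> x \<in> range \<phi>'" if "x \<in> ball 0 d" for x
  proof (cases "x $ 3 = 0")
    case True
    then have "x = emb (pr x)" by (simp add: vec3_eq_iff pr_def)
    moreover have "pr x \<in> ball 0 d" using that nemb[of "pr x"] calculation by simp
    ultimately show ?thesis using plane[of "pr x"] by (metis rangeI)
  next
    case False
    then show ?thesis using pos[OF that] neg[OF that] by (cases "x $ 3 > 0") auto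
  qed
  have gi: "\<phi>' (g x) = \<phi> x" if "x \<in> ball 0 d" for x
    using inr[OF that] by (simp add: g_def f_inv_into_f)
  have ge: "g x = y" if "\<phi> x = \<phi>' y" for x y using that E'(2) by (simp add: g_def)
  have gc: "continuous_on (ball 0 d) g"
    unfolding g_def using inr
    by (intro continuous_on_compose2[OF E'(5)] continuous_on_subset[OF E(1)]) auto
  have ginj: "inj_on g (ball 0 d)"
    by (rule inj_onI) (metis gi E(2) injD)
  have g00: "g 0 = 0" using ge eq0 by simp
  have g0u: "g (emb u) = emb (g0 u)" if "u \<in> ball 0 d" for u using ge plane that by simp
  have "emb (g0 0) = 0" using g0u[of 0] d g00 emb0 by simp
  then have g000: "g0 0 = 0" by (simp add: vec3_eq_iff vec2_eq_iff)
  have "\<forall>\<^sub>F r in at_right (0::real). r \<in> {0<..<d}" using d by (rule eventually_at_right_real)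
  moreover have "\<forall>\<^sub>F r in at_right (0::real). sphere_homotopic
          (\<lambda>x. sgn (g0 (0 + r *\<^sub>R x) - g0 0)) id"
    using or(3) by (simp add: orientation_preserving_at_def)
  ultimately have G: "\<forall>\<^sub>F r in at_right (0::real). sphere_homotopic
               (\<lambda>x. sgn (g (0 + r *\<^sub>R x) - g 0)) mirror3"
  proof eventually_elim
    case (elim r)
    then have r: "0 < r" "r < d" by auto
    have inb: "r *\<^sub>R x \<in> ball 0 d" if "x \<in> sphere 0 1" for x :: "real^3" using r that by simp
    have inb2: "r *\<^sub>R x \<in> ball 0 d" if "x \<in> sphere 0 1" for x :: "real^2" using r that by simp
    have gn: "g (r *\<^sub>R x) \<noteq> 0" if "x \<in> sphere 0 1" for x
    proof
      assume "g (r *\<^sub>R x) = 0"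
      then have "r *\<^sub>R x = 0" using inj_onD[OF ginj _ inb[OF that], of 0] g00 d by simp
      then show False using r that by auto
    qed
    show ?case
    proof (rule suspension_homotopic_mirror3[OF elim(2)])
      show "continuous_on (sphere 0 1) (\<lambda>x. sgn (g (0 + r *\<^sub>R x) - g 0))"
        using inb gn g00 by (intro continuous_intros continuous_on_compose2[OF gc]) auto
      show "(\<lambda>x. sgn (g (0 + r *\<^sub>R x) - g 0)) ` sphere 0 1 \<subseteq> sphere 0 1"
        using gn g00 by (auto simp: norm_sgn)
      fix u :: "real^2" assume u: "u \<in> sphere 0 1"
      have "r *\<^sub>R emb u = emb (r *\<^sub>R u)" by (simp add: vec3_eq_iff)
      then have "g (r *\<^sub>R emb u) = emb (g0 (r *\<^sub>R u))" using g0u[OF inb2[OF u]] by simp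
      then show "sgn (g (0 + r *\<^sub>R emb u) - g 0) = emb (sgn (g0 (0 + r *\<^sub>R u) - g0 0))"
        by (simp only: g00 g000 add_0 diff_zero semb)
    next
      fix x :: "real^3" assume x: "x \<in> sphere 0 1"
      { assume "x $ 3 > 0"
        then obtain y where "y $ 3 < 0" "\<phi> (r *\<^sub>R x) = \<phi>' y" using pos[OF inb[OF x]] r by auto
        then have "g (r *\<^sub>R x) $ 3 < 0" using ge by auto
        then show "sgn (g (0 + r *\<^sub>R x) - g 0) $ 3 < 0"
          using gn[OF x] by (simp add: g00 sgn_div_norm divide_neg_pos mult_neg_pos field_simps) }
      { assume "x $ 3 < 0"
        then obtain y where "y $ 3 > 0" "\<phi> (r *\<^sub>R x) = \<phi>' y" using neg[OF inb[OF x]] r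
          by (auto simp: mult_pos_neg)
        then have "g (r *\<^sub>R x) $ 3 > 0" using ge by auto
        then show "sgn (g (0 + r *\<^sub>R x) - g 0) $ 3 > 0"
          using gn[OF x] by (simp add: g00 sgn_div_norm) }
    qed
  qed
  have "\<forall>\<^sub>F r in at_right (0::real). sphere_homotopic
               (\<lambda>x. sgn (\<phi>' (g (0 + r *\<^sub>R x)) - \<phi>' (g 0))) (id \<circ> mirror3)"
    using or(2) d E'(1,2) g00
    by (intro homotopic_sgn_compose[OF open_ball _ gc ginj open_UNIV _ E'(1) _ G])
       (auto simp: orientation_preserving_at_def)
  moreover have "\<forall>\<^sub>F r in at_right (0::real). r \<in> {0<..<d}" using d by (rule eventually_at_right_real)
  moreover have "\<forall>\<^sub>F r in at_right (0::real). sphere_homotopic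
               (\<lambda>x. sgn (\<phi> (0 + r *\<^sub>R x) - \<phi> 0)) id"
    using or(1) by (simp add: orientation_preserving_at_def)
  ultimately have "\<forall>\<^sub>F r in at_right (0::real). sphere_homotopic id mirror3"
  proof eventually_elim
    case (elim r)
    have "sphere_homotopic
               (\<lambda>x. sgn (\<phi> (0 + r *\<^sub>R x) - \<phi> 0)) mirror3"
      by (rule homotopic_with_eq[OF elim(1)]) (use elim(2) gi gi[of 0] d in auto)
    then show ?case by (rule homotopic_with_trans[OF homotopic_with_symD[OF elim(3)]])
  qed
  then show False using id_not_homotopic_mirror3 by simp
qed

section \<open>Charts of the surface and their transition maps\<close>

lemma surface_chartD:
  assumes "surface_chart G c"
  shows "continuous_on UNIV c" "inj c" "range c \<subseteq> G" "openin (top_of_set G) (range c)"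
    "continuous_on (range c) (inv_into UNIV c)"
proof -
  show 1: "continuous_on UNIV c" "inj c" and 2: "openin (top_of_set G) (range c)"
    using assms by (auto simp: surface_chart_def)
  show 3: "range c \<subseteq> G" using openin_imp_subset[OF 2] .
  show "continuous_on (range c) (inv_into UNIV c)"
  proof (rule continuous_on_inverse_open_map[OF 1(1) refl])
    fix U :: "(real^2) set" assume "openin (top_of_set UNIV) U"
    then have "openin (top_of_set G) (c ` U)" using assms by (auto simp: surface_chart_def)
    then show "openin (top_of_set (range c)) (c ` U)"
      using 3 by (metis image_mono openin_subset_trans subset_UNIV)
  qed (use 1 in auto)
qed

lemma open_chart_preimage:
  assumes "surface_chart G c" "surface_chart G e"
  shows "open {u. c u \<in> range e}"
proof -
  obtain T where T: "open T" "range e = G \<inter> T"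
    using surface_chartD(4)[OF assms(2)] by (auto simp: openin_open)
  have "c u \<in> G" for u using surface_chartD(3)[OF assms(1)] by auto
  then have "{u. c u \<in> range e} = c -` T" using T by auto
  then show ?thesis
    using T(1) surface_chartD(1)[OF assms(1)] by (metis open_vimage)
qed

lemma continuous_on_transition:
  assumes "surface_chart G c" "surface_chart G e"
  shows "continuous_on {u. c u \<in> range e} (inv_into UNIV e \<circ> c)"
    "inj_on (inv_into UNIV e \<circ> c) {u. c u \<in> range e}"
proof -
  show "continuous_on {u. c u \<in> range e} (inv_into UNIV e \<circ> c)"
  proof (rule continuous_on_compose)
    show "continuous_on {u. c u \<in> range e} c"
      by (rule continuous_on_subset[OF surface_chartD(1)[OF assms(1)]]) auto
    show "continuous_on (c ` {u. c u \<in> range e}) (inv_into UNIV e)"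
      by (rule continuous_on_subset[OF surface_chartD(5)[OF assms(2)]]) auto
  qed
  show "inj_on (inv_into UNIV e \<circ> c) {u. c u \<in> range e}"
  proof (rule inj_onI)
    fix u v assume a: "u \<in> {u. c u \<in> range e}" "v \<in> {u. c u \<in> range e}"
      "(inv_into UNIV e \<circ> c) u = (inv_into UNIV e \<circ> c) v"
    then have "e (inv_into UNIV e (c u)) = e (inv_into UNIV e (c v))" by simp
    then have "c u = c v" using a(1,2) by (simp add: f_inv_into_f)
    then show "u = v" using surface_chartD(2)[OF assms(1)] by (simp add: inj_eq)
  qed
qed

text \<open>Only differences of values enter the local degree, so an additive constant is harmless;
  it accounts for charts with translated source, whose inverses differ by a constant.\<close>

lemma orientation_preserving_at_cong:
  assumes "open U" "u \<in> U" and eq: "\<And>x. x \<in> U \<Longrightarrow> f x = g x + b" and g: "orientation_preserving_at g u"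
  shows "orientation_preserving_at f u"
proof -
  obtain d where d: "d > 0" "ball u d \<subseteq> U" using assms open_contains_ball by blast
  have "\<forall>\<^sub>F r in at_right (0::real). r \<in> {0<..<d}" using d(1) by (rule eventually_at_right_real)
  with g[unfolded orientation_preserving_at_def] show ?thesis
    unfolding orientation_preserving_at_def
  proof eventually_elim
    case (elim r)
    have "u + r *\<^sub>R x \<in> U" if "x \<in> sphere 0 1" for x
      using d that elim by (auto simp: subset_iff dist_norm)
    then have "f (u + r *\<^sub>R x) - f u = g (u + r *\<^sub>R x) - g u" if "x \<in> sphere 0 1" for x
      using eq[OF assms(2)] eq that by simp
    then show ?case by (intro homotopic_with_eq[OF elim(1)]) auto
  qed
qed

lemma orientation_preserving_at_shift:
  "orientation_preserving_at (\<lambda>x. g (x + a)) u \<longleftrightarrow> orientation_preserving_at g (u + a)"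
  unfolding orientation_preserving_at_def by (simp add: algebra_simps)

lemma orientation_preserving_at_id: "orientation_preserving_at id u"
proof -
  have "\<forall>\<^sub>F r in at_right (0::real). r \<in> {0<..<1}" by (rule eventually_at_right_real) simp
  then show ?thesis
    unfolding orientation_preserving_at_def
  proof eventually_elim
    case (elim r)
    have "sphere_homotopic (id :: 'a \<Rightarrow> 'a) id"
      by (simp add: homotopic_with_refl continuous_map_id)
    then show ?case
      by (rule homotopic_with_eq) (use elim in \<open>auto simp: sgn_div_norm\<close>)
  qed
qed

section \<open>Charts of a diagram\<close>

lemma oriented_atlasD:
  assumes "oriented_atlas G \<omega>"
  shows "c \<in> \<omega> \<Longrightarrow> surface_chart G c"
    "c \<in> \<omega> \<Longrightarrow> c' \<in> \<omega> \<Longrightarrow> compatible_charts c c'"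
    "(\<Union>c\<in>\<omega>. range c) = G"
proof -
  note * = assms[unfolded oriented_atlas_def]
  have a: "\<forall>c\<in>\<omega>. surface_chart G c" using * by (elim conjE)
  have b: "G = (\<Union>c\<in>\<omega>. range c)" using * by (elim conjE)
  have c: "\<forall>c\<in>\<omega>. \<forall>c'\<in>\<omega>. compatible_charts c c'" using * by (elim conjE)
  show "c \<in> \<omega> \<Longrightarrow> surface_chart G c" using a by blast
  show "c \<in> \<omega> \<Longrightarrow> c' \<in> \<omega> \<Longrightarrow> compatible_charts c c'" using c by blast
  show "(\<Union>c\<in>\<omega>. range c) = G" by (rule b[symmetric])
qed

lemma convex_coord:
  "convex {x::real^3. x $ i < 0}" "convex {x::real^3. 0 < x $ i}"
proof -
  have eq: "(axis i 1 :: real^3) \<bullet> x = x $ i" for x by (simp add: inner_axis')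
  show "convex {x::real^3. x $ i < 0}" "convex {x::real^3. 0 < x $ i}"
    using convex_halfspace_lt[of "axis i 1 :: real^3" 0] convex_halfspace_gt[of 0 "axis i 1 :: real^3"]
    unfolding eq .
qed

lemma open_shift: "open U \<Longrightarrow> open ((\<lambda>u. u + a) ` U)" for a :: "'a::real_normed_vector"
  using open_translation[of U a] by (simp add: add.commute)

text \<open>The orientation data are contained in \<open>positive_chart\<close>, which is part of
  every right-handed chart; of the atlas itself it suffices to record that it covers
  \<open>G\<close>, a property that visibly survives an ambient isotopy.\<close>

locale diagram =
  fixes G :: "R4 set" and \<eta> :: "(real^2 \<Rightarrow> R4) set"
  assumes cover: "G = (\<Union>c\<in>\<eta>. range c)"
    and compact_G: "compact G"
    and nonempty_G: "G \<noteq> {}"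
    and regular: "regular_projection G \<eta>"
    and connected_image: "connected (fst ` G)"
begin

lemma cover_mem: "p \<in> G \<Longrightarrow> \<exists>c\<in>\<eta>. p \<in> range c"
  by (subst (asm) cover) blast

definition D :: "R3 set" where "D = fst ` G"
abbreviation R :: "R3 set" where "R \<equiv> regular_points G \<eta>"
abbreviation rhc :: "(real^2 \<Rightarrow> R4) \<Rightarrow> (R3 \<Rightarrow> R3) \<Rightarrow> bool" where "rhc \<equiv> right_handed_chart G \<eta>"

lemma connected_D: "connected D"
  using connected_image by (simp add: D_def)

lemma compact_D: "compact D"
  unfolding D_def by (rule compact_continuous_image[OF _ compact_G]) (intro continuous_intros)

lemma closed_D: "closed D"
  using compact_D compact_imp_closed by blast

lemma rhcD:
  assumes "rhc c \<phi>"
  shows "open_embedding \<phi>" "orientation_preserving \<phi>" "positive_chart G \<eta> c"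
    "fst (c u) = \<phi> (emb u)" "c u \<in> G" "surface_chart G c"
    "G \<inter> fst -` range \<phi> = range c"
proof -
  show p: "open_embedding \<phi>" "orientation_preserving \<phi>" "positive_chart G \<eta> c" "fst (c u) = \<phi> (emb u)"
    "G \<inter> fst -` range \<phi> = range c"
    using assms by (simp_all add: right_handed_chart_def)
  show "surface_chart G c"
    using oriented_atlasD(1)[OF p(3)[unfolded positive_chart_def]] by simp
  then show "c u \<in> G" using surface_chartD(3) by blast
qed

lemma rhc_G:
  assumes "rhc c \<phi>"
  shows "(\<phi> x, s) \<in> G \<longleftrightarrow> x $ 3 = 0 \<and> s = snd (c (pr x))"
proof
  assume "(\<phi> x, s) \<in> G"
  then have "(\<phi> x, s) \<in> range c" unfolding rhcD(7)[OF assms, symmetric] by simp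
  then obtain u where u: "(\<phi> x, s) = c u" by auto
  then have "\<phi> x = \<phi> (emb u)" using rhcD(4)[OF assms, of u] by (metis fst_conv)
  then have "x = emb u" using open_embeddingD(2)[OF rhcD(1)[OF assms]] by (simp add: inj_eq)
  moreover then have "u = pr x" by (simp add: vec2_eq_iff pr_def)
  ultimately show "x $ 3 = 0 \<and> s = snd (c (pr x))" using u by (metis snd_conv vector_3(3))
next
  assume a: "x $ 3 = 0 \<and> s = snd (c (pr x))"
  then have "x = emb (pr x)" by (simp add: vec3_eq_iff pr_def)
  then have "(\<phi> x, s) = c (pr x)" using rhcD(4)[OF assms, of "pr x"] a by (simp add: prod_eq_iff)
  then show "(\<phi> x, s) \<in> G" using rhcD(5)[OF assms] by simp
qed

lemma in_D: "q \<in> D \<longleftrightarrow> (\<exists>s. (q, s) \<in> G)"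
  unfolding D_def by force

lemma rhc_D: "rhc c \<phi> \<Longrightarrow> \<phi> x \<in> D \<longleftrightarrow> x $ 3 = 0"
  by (simp add: in_D rhc_G)

lemma regular_subset_D: "R \<subseteq> D"
  by (auto simp: regular_points_def rhc_D)

text \<open>Each of the two charts is compatible with the atlas \<eta>, but by definition not with
  the other. A chart \<open>e\<close> of the atlas around the common point mediates, and the local
  degrees multiply.\<close>

lemma transition_orientation:
  assumes c: "rhc c \<phi>" and c': "rhc c' \<phi>'" and eq: "\<phi> 0 = \<phi>' 0"
  obtains g0 d where "orientation_preserving_at g0 0" "d > 0"
    "\<And>u. u \<in> ball 0 d \<Longrightarrow> \<phi> (emb u) = \<phi>' (emb (g0 u))"
proof -
  note E' = open_embeddingD[OF rhcD(1)[OF c']] and E = open_embeddingD[OF rhcD(1)[OF c]]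
  have emb0: "emb (0::real^2) = 0" by (simp add: vec3_eq_iff)
  have c0: "c 0 = c' 0"
  proof -
    have "(\<phi>' 0, snd (c 0)) = c 0" using rhcD(4)[OF c, of 0] eq emb0 by (simp add: prod_eq_iff)
    then have "(\<phi>' 0, snd (c 0)) \<in> G" using rhcD(5)[OF c] by simp
    then have "snd (c 0) = snd (c' (pr 0))" using rhc_G[OF c'] by simp
    moreover have "pr 0 = 0" by (simp add: pr_def vec2_eq_iff)
    ultimately show ?thesis using rhcD(4)[OF c, of 0] rhcD(4)[OF c', of 0] eq emb0 by (simp add: prod_eq_iff)
  qed
  obtain e where e: "e \<in> \<eta>" "c 0 \<in> range e" using rhcD(5)[OF c, of 0] cover_mem by blast
  obtain u1 where u1: "c 0 = e u1" using e by auto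
  note at = rhcD(3)[OF c, unfolded positive_chart_def] and at' = rhcD(3)[OF c', unfolded positive_chart_def]
  have se: "surface_chart G e" using oriented_atlasD(1)[OF at] e by simp
  have sc: "surface_chart G c" "surface_chart G c'" using rhcD(6) c c' by auto
  have "compatible_charts c e" using oriented_atlasD(2)[OF at] e by simp
  then have o1: "orientation_preserving_at (inv_into UNIV e \<circ> c) 0"
    unfolding compatible_charts_def using u1 by blast
  have "compatible_charts e c'" using oriented_atlasD(2)[OF at'] e by simp
  then have o2: "orientation_preserving_at (inv_into UNIV c' \<circ> e) u1"
    unfolding compatible_charts_def using u1 c0 by metis
  define g where "g = inv_into UNIV e \<circ> c"
  define f where "f = inv_into UNIV c' \<circ> e"
  have g0: "g 0 = u1" using u1 surface_chartD(2)[OF se] by (simp add: g_def)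
  have "\<forall>\<^sub>F r in at_right (0::real). sphere_homotopic
               (\<lambda>x. sgn (f (g (0 + r *\<^sub>R x)) - f (g 0))) (id \<circ> id)"
  proof (rule homotopic_sgn_compose[where u = 0 and f = f and g = g and k = id and k' = id and U = "{u. c u \<in> range e}" and V = "{u. e u \<in> range c'}"])
    show "open {u. c u \<in> range e}" "open {u. e u \<in> range c'}"
      using open_chart_preimage se sc by auto
    show "continuous_on {u. c u \<in> range e} g" "inj_on g {u. c u \<in> range e}"
       "continuous_on {u. e u \<in> range c'} f" "inj_on f {u. e u \<in> range c'}"
      unfolding g_def f_def using continuous_on_transition se sc by blast+
    show "0 \<in> {u. c u \<in> range e}" using e(2) by simp
    have "e (g 0) = c' 0" using g0 u1 c0 by simp
    then show "g 0 \<in> {u. e u \<in> range c'}" by simp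
    show "\<forall>\<^sub>F r in at_right 0. sphere_homotopic
          (\<lambda>x. sgn (g (0 + r *\<^sub>R x) - g 0)) id"
      using o1 by (simp add: orientation_preserving_at_def g_def)
    show "\<forall>\<^sub>F r in at_right 0. sphere_homotopic
          (\<lambda>x. sgn (f (g 0 + r *\<^sub>R x) - f (g 0))) id"
      using o2 unfolding g0 by (simp add: orientation_preserving_at_def f_def)
  qed
  then have o: "orientation_preserving_at (f \<circ> g) 0"
    by (simp add: orientation_preserving_at_def)
  define U where "U = {u. c u \<in> range e} \<inter> {u. \<phi> (emb u) \<in> range \<phi>'}"
  have "open {u. \<phi> (emb u) \<in> range \<phi>'}"
  proof -
    have "continuous_on UNIV (\<lambda>u. \<phi> (emb u))"
      by (rule continuous_on_compose2[OF E(1)]) (auto intro!: continuous_intros)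
    then show ?thesis using open_vimage[OF E'(4)] by (simp add: vimage_def)
  qed
  then have "open U" unfolding U_def using open_chart_preimage[OF sc(1) se] by auto
  moreover have "0 \<in> U" using e eq emb0 by (auto simp: U_def)
  ultimately obtain d where d: "d > 0" "ball 0 d \<subseteq> U" using open_contains_ball by blast
  show ?thesis
  proof (rule that[OF o d(1)])
    fix u assume "u \<in> ball (0::real^2) d"
    then have u: "c u \<in> range e" "\<phi> (emb u) \<in> range \<phi>'" using d by (auto simp: U_def)
    then have "c u \<in> range c'" unfolding rhcD(7)[OF c', symmetric] using rhcD(4,5)[OF c, of u] by simp
    moreover have "(f \<circ> g) u = inv_into UNIV c' (c u)"
      using u(1) by (simp add: f_def g_def f_inv_into_f)
    ultimately have "c' ((f \<circ> g) u) = c u" by (simp add: f_inv_into_f)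
    then show "\<phi> (emb u) = \<phi>' (emb ((f \<circ> g) u))" using rhcD(4)[OF c] rhcD(4)[OF c'] by metis
  qed
qed

text \<open>A half ball is connected and misses \<open>D\<close>, so it lands on one side in the
  other chart; orientations forbid an exchange of the sides.\<close>

lemma same_sides:
  assumes c: "rhc c \<phi>" and c': "rhc c' \<phi>'" and eq: "\<phi> 0 = \<phi>' 0"
  obtains e where "e > 0" "\<And>x. x \<in> ball 0 e \<Longrightarrow> x $ 3 < 0 \<Longrightarrow> \<phi> x \<in> \<phi>' ` {y. y $ 3 < 0}"
    "\<And>x. x \<in> ball 0 e \<Longrightarrow> x $ 3 > 0 \<Longrightarrow> \<phi> x \<in> \<phi>' ` {y. y $ 3 > 0}"
proof -
  note E' = open_embeddingD[OF rhcD(1)[OF c']] and E = open_embeddingD[OF rhcD(1)[OF c]]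
  obtain g0 d0 where g0: "orientation_preserving_at g0 0" "d0 > 0"
    "\<And>u. u \<in> ball 0 d0 \<Longrightarrow> \<phi> (emb u) = \<phi>' (emb (g0 u))"
    using transition_orientation[OF assms] by blast
  have "open (\<phi> -` range \<phi>')" using open_vimage[OF E'(4) E(1)] .
  moreover have "0 \<in> \<phi> -` range \<phi>'" using eq by auto
  ultimately obtain d1 where d1: "d1 > 0" "ball 0 d1 \<subseteq> \<phi> -` range \<phi>'"
    using open_contains_ball by blast
  define d where "d = min d0 d1"
  have d: "d > 0" "d \<le> d0" "ball 0 d \<subseteq> \<phi> -` range \<phi>'" using g0 d1 by (auto simp: d_def)
  define N P where "N = \<phi>' ` {y. y $ 3 < 0}" and "P = \<phi>' ` {y. y $ 3 > 0}"
  have oNP: "open N" "open P" unfolding N_def P_def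
    by (intro E'(3) open_Collect_less continuous_intros)+
  have dNP: "N \<inter> P = {}" using E'(2) by (auto simp: N_def P_def inj_eq)
  have side: "\<phi> ` A \<subseteq> N \<or> \<phi> ` A \<subseteq> P" if "A \<subseteq> ball 0 d" "convex A" "\<And>x. x \<in> A \<Longrightarrow> x $ 3 \<noteq> 0" for A
  proof -
    have "connected (\<phi> ` A)"
      using convex_connected[OF that(2)] E(1) by (meson connected_continuous_image continuous_on_subset subset_UNIV)
    moreover have "\<phi> ` A \<subseteq> N \<union> P"
    proof
      fix z assume "z \<in> \<phi> ` A"
      then obtain x where x: "x \<in> A" "z = \<phi> x" by auto
      then have "z \<in> range \<phi>'" using that(1) d(3) by blast
      then obtain y where y: "z = \<phi>' y" by auto
      have "z \<notin> D" using rhc_D[OF c] that(3) x by simp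
      then have "y $ 3 \<noteq> 0" using y rhc_D[OF c'] by simp
      then have "y $ 3 < 0 \<or> y $ 3 > 0" by auto
      then show "z \<in> N \<union> P" using y by (auto simp: N_def P_def)
    qed
    ultimately show ?thesis using connectedD[OF _ oNP, of "\<phi> ` A"] dNP by blast
  qed
  define An Ap where "An = ball 0 d \<inter> {x::real^3. x $ 3 < 0}" and "Ap = ball 0 d \<inter> {x::real^3. x $ 3 > 0}"
  have sn: "\<phi> ` An \<subseteq> N \<or> \<phi> ` An \<subseteq> P"
    unfolding An_def by (rule side) (auto intro!: convex_Int convex_coord)
  have sp: "\<phi> ` Ap \<subseteq> N \<or> \<phi> ` Ap \<subseteq> P"
    unfolding Ap_def by (rule side) (auto intro!: convex_Int convex_coord)
  \<comment> \<open>Without this, both half balls could land on the same side. The image of the ball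
    is a neighbourhood of the common point, so it contains points of the other chart on either side
    of its plane.\<close>
  have both: "\<exists>x\<in>An \<union> Ap. \<phi> x \<in> N" "\<exists>x\<in>An \<union> Ap. \<phi> x \<in> P"
  proof -
    have "open (\<phi>' -` \<phi> ` ball 0 d)" by (rule open_vimage[OF E(3) E'(1)]) simp
    moreover have "0 \<in> \<phi>' -` \<phi> ` ball 0 d" using eq d(1) by (auto intro!: image_eqI[of _ _ 0])
    ultimately obtain t where t: "t > 0" "ball 0 t \<subseteq> \<phi>' -` \<phi> ` ball 0 d" using open_contains_ball by blast
    have *: "\<exists>x\<in>An \<union> Ap. \<phi> x = \<phi>' y" if "y \<in> ball 0 t" "y $ 3 \<noteq> 0" for y
    proof -
      have "\<phi>' y \<in> \<phi> ` ball 0 d" using t that(1) by blast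
      then obtain x where x: "x \<in> ball 0 d" "\<phi>' y = \<phi> x" by blast
      then have "x $ 3 \<noteq> 0" using rhc_D[OF c] rhc_D[OF c'] that(2) by metis
      then show ?thesis using x by (intro bexI[of _ x]) (auto simp: An_def Ap_def)
    qed
    define y where "y = (t/2) *\<^sub>R (axis 3 1 :: real^3)"
    have y: "y \<in> ball 0 t" "- y \<in> ball 0 t" "y $ 3 > 0" using t by (auto simp: y_def)
    show "\<exists>x\<in>An \<union> Ap. \<phi> x \<in> N" using *[OF y(2)] y(3) by (force simp: N_def)
    show "\<exists>x\<in>An \<union> Ap. \<phi> x \<in> P" using *[OF y(1)] y(3) by (force simp: P_def)
  qed
  have "\<phi> ` An \<subseteq> N \<and> \<phi> ` Ap \<subseteq> P"
  proof (rule ccontr)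
    assume "\<not> (\<phi> ` An \<subseteq> N \<and> \<phi> ` Ap \<subseteq> P)"
    then have "\<phi> ` An \<subseteq> P \<and> \<phi> ` Ap \<subseteq> N" using sn sp both dNP by blast
    moreover have "orientation_preserving_at \<phi> 0" "orientation_preserving_at \<phi>' 0"
      using rhcD(2)[OF c] rhcD(2)[OF c'] by (auto simp: orientation_preserving_def)
    ultimately show False
      using open_embedding_sides_not_swapped[OF rhcD(1)[OF c] rhcD(1)[OF c'] _ _ g0(1) eq d(1)] g0(3) d(2)
      by (force simp: An_def Ap_def N_def P_def image_subset_iff)
  qed
  then show ?thesis by (intro that[OF d(1)]) (auto simp: An_def Ap_def N_def P_def)
qed

lemma compatible_shift:
  assumes "surface_chart G c" "surface_chart G e"
  shows "compatible_charts c e \<Longrightarrow> compatible_charts (\<lambda>u. c (u + a)) e"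
    "compatible_charts e c \<Longrightarrow> compatible_charts e (\<lambda>u. c (u + a))"
proof -
  assume 1: "compatible_charts c e"
  show "compatible_charts (\<lambda>u. c (u + a)) e"
    unfolding compatible_charts_def
  proof (intro allI impI)
    fix u u' assume "c (u + a) = e u'"
    then have "orientation_preserving_at (inv_into UNIV e \<circ> c) (u + a)"
      using 1 unfolding compatible_charts_def by blast
    then have "orientation_preserving_at (\<lambda>x. (inv_into UNIV e \<circ> c) (x + a)) u"
      by (simp only: orientation_preserving_at_shift)
    then show "orientation_preserving_at (inv_into UNIV e \<circ> (\<lambda>u. c (u + a))) u"
      by (simp add: comp_def)
  qed
next
  assume 1: "compatible_charts e c"
  have inj: "inj c" using surface_chartD(2)[OF assms(1)] .
  have invs: "inv_into UNIV (\<lambda>u. c (u + a)) (c v) = v - a" for v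
  proof -
    have "inj (\<lambda>u. c (u + a))" by (rule injI) (use inj in \<open>simp add: inj_eq\<close>)
    from inv_f_f[OF this, of "v - a"] show ?thesis by simp
  qed
  show "compatible_charts e (\<lambda>u. c (u + a))"
    unfolding compatible_charts_def
  proof (intro allI impI)
    fix u u' assume eq: "e u = c (u' + a)"
    then have o: "orientation_preserving_at (inv_into UNIV c \<circ> e) u"
      using 1 unfolding compatible_charts_def by blast
    show "orientation_preserving_at (inv_into UNIV (\<lambda>u. c (u + a)) \<circ> e) u"
    proof (rule orientation_preserving_at_cong[OF open_chart_preimage[OF assms(2,1)] _ _ o])
      show "u \<in> {u. e u \<in> range c}" using eq by auto
      fix x assume "x \<in> {u. e u \<in> range c}"
      then obtain v where "e x = c v" by auto
      then show "(inv_into UNIV (\<lambda>u. c (u + a)) \<circ> e) x = (inv_into UNIV c \<circ> e) x + (- a)"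
        using invs inj by simp
    qed
  qed
qed

text \<open>Regular points and germs are tied to the centre of a chart. Recentring makes one chart
  serve all points of its plane.\<close>

lemma rhc_shift:
  assumes c: "rhc c \<phi>"
  shows "rhc (\<lambda>u. c (u + a)) (\<lambda>x. \<phi> (x + emb a))"
proof -
  note E = open_embeddingD[OF rhcD(1)[OF c]]
  have sc: "surface_chart G c" using rhcD(6)[OF c] .
  have rc: "range (\<lambda>u. c (u + a)) = range c" "range (\<lambda>x. \<phi> (x + emb a)) = range \<phi>"
    by (auto simp: image_iff) (metis diff_add_cancel)+
  have at: "oriented_atlas G (insert c \<eta>)" using rhcD(3)[OF c] by (simp add: positive_chart_def)
  have sc': "surface_chart G (\<lambda>u. c (u + a))"
    unfolding surface_chart_def
  proof (intro conjI allI impI)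
    show "continuous_on UNIV (\<lambda>u. c (u + a))"
      by (rule continuous_on_compose2[OF surface_chartD(1)[OF sc]]) (auto intro!: continuous_intros)
    show "inj (\<lambda>u. c (u + a))" by (rule injI) (use surface_chartD(2)[OF sc] in \<open>simp add: inj_eq\<close>)
    fix U :: "(real^2) set" assume "open U"
    then have "open ((\<lambda>u. u + a) ` U)" by (rule open_shift)
    then have "openin (top_of_set G) (c ` (\<lambda>u. u + a) ` U)" using sc by (simp add: surface_chart_def)
    then show "openin (top_of_set G) ((\<lambda>u. c (u + a)) ` U)" by (simp add: image_image)
  qed
  have compat_self: "compatible_charts (\<lambda>u. c (u + a)) (\<lambda>u. c (u + a))"
  proof -
    have "inv_into UNIV (\<lambda>u. c (u + a)) \<circ> (\<lambda>u. c (u + a)) = id"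
      using surface_chartD(2)[OF sc'] by (simp add: fun_eq_iff)
    then show ?thesis by (simp add: compatible_charts_def orientation_preserving_at_id)
  qed
  have "oriented_atlas G (insert (\<lambda>u. c (u + a)) \<eta>)"
    unfolding oriented_atlas_def
  proof (intro conjI ballI)
    show "G = (\<Union>c\<in>insert (\<lambda>u. c (u + a)) \<eta>. range c)"
      using oriented_atlasD(3)[OF at] rc(1) by simp
    fix e assume e: "e \<in> insert (\<lambda>u. c (u + a)) \<eta>"
    show "surface_chart G e" using e sc' oriented_atlasD(1)[OF at] by blast
    fix e' assume e': "e' \<in> insert (\<lambda>u. c (u + a)) \<eta>"
    have k: "surface_chart G k" "compatible_charts c k" "compatible_charts k c" if "k \<in> \<eta>" for k
      using oriented_atlasD(1,2)[OF at] that by blast+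
    show "compatible_charts e e'"
      using e e' compat_self compatible_shift[OF sc k(1)] k(2,3) oriented_atlasD(2)[OF at, of e e']
      by blast
  qed
  moreover have "open_embedding (\<lambda>x. \<phi> (x + emb a))"
    unfolding open_embedding_def
  proof (intro conjI allI impI)
    show "continuous_on UNIV (\<lambda>x. \<phi> (x + emb a))"
      by (rule continuous_on_compose2[OF E(1)]) (auto intro!: continuous_intros)
    show "inj (\<lambda>x. \<phi> (x + emb a))" by (rule injI) (use E(2) in \<open>simp add: inj_eq\<close>)
    fix U :: "R3 set" assume "open U"
    then have "open ((\<lambda>u. u + emb a) ` U)" by (rule open_shift)
    then have "open (\<phi> ` (\<lambda>u. u + emb a) ` U)" by (rule E(3))
    then show "open ((\<lambda>x. \<phi> (x + emb a)) ` U)" by (simp add: image_image)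
  qed
  moreover have "orientation_preserving (\<lambda>x. \<phi> (x + emb a))"
    using rhcD(2)[OF c] by (simp add: orientation_preserving_def orientation_preserving_at_shift)
  moreover have "fst (c (u + a)) = \<phi> (emb u + emb a)" for u
  proof -
    have "emb (u + a) = emb u + emb a" by (simp add: vec3_eq_iff)
    then show ?thesis using rhcD(4)[OF c, of "u + a"] by metis
  qed
  ultimately show ?thesis
    using c unfolding right_handed_chart_def positive_chart_def rc by blast
qed

end

text \<open>On open sets this is local constancy. The version with connected subsets applies
  directly to images of half balls, octants and whole regions.\<close>

definition connected_constant :: "('a::topological_space \<Rightarrow> 'b) \<Rightarrow> 'a set \<Rightarrow> bool" where
  "connected_constant f A \<longleftrightarrow> (\<forall>K. connected K \<and> K \<subseteq> A \<longrightarrow> f constant_on K)"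

lemma connected_constantD: "connected_constant f A \<Longrightarrow> connected K \<Longrightarrow> K \<subseteq> A \<Longrightarrow> x \<in> K \<Longrightarrow> y \<in> K \<Longrightarrow> f x = f y"
proof -
  assume a: "connected_constant f A" "connected K" "K \<subseteq> A" "x \<in> K" "y \<in> K"
  then have "f constant_on K" unfolding connected_constant_def by blast
  then show "f x = f y" using a(4,5) unfolding constant_on_def by fastforce
qed

lemma connected_constant_subset: "connected_constant f A \<Longrightarrow> B \<subseteq> A \<Longrightarrow> connected_constant f B"
  unfolding connected_constant_def by blast

lemma connected_constantI:
  assumes "\<And>x. x \<in> A \<Longrightarrow> \<exists>V. open V \<and> x \<in> V \<and> (\<forall>y\<in>V \<inter> A. f y = f x)"
  shows "connected_constant f A"
  unfolding connected_constant_def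
proof (intro allI impI)
  fix K assume K: "connected K \<and> K \<subseteq> A"
  show "f constant_on K"
  proof (rule locally_constant_imp_constant)
    show "connected K" using K by blast
    fix a assume a: "a \<in> K"
    then obtain V where "open V" "a \<in> V" "\<forall>y\<in>V \<inter> A. f y = f a" using assms K by blast
    then show "\<exists>T. openin (top_of_set K) T \<and> a \<in> T \<and> (\<forall>x\<in>T. f x = f a)"
      using K a by (intro exI[of _ "K \<inter> V"]) auto
  qed
qed

lemma connected_constant_open:
  fixes A :: "'a::real_normed_vector set"
  assumes "connected_constant f A" "open A" "x \<in> A"
  shows "\<exists>V. open V \<and> x \<in> V \<and> V \<subseteq> A \<and> (\<forall>y\<in>V. f y = f x)"
proof -
  obtain e where e: "e > 0" "ball x e \<subseteq> A" using assms open_contains_ball by blast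
  have "f y = f x" if "y \<in> ball x e" for y
    by (rule connected_constantD[OF assms(1) connected_ball e(2) that]) (simp add: e(1))
  then have "\<forall>y\<in>ball x e. f y = f x" by blast
  moreover have "x \<in> ball x e" using e(1) by simp
  ultimately show ?thesis using e(2) open_ball by blast
qed

text \<open>With a reference point in place of \<open>a\<close>, the products say that the signs of
  the coordinates in \<open>J\<close> agree with those of that point; all sign patterns are thereby
  treated at once.\<close>

lemma convex_orthant: "convex {y::real^3. \<forall>j\<in>J. 0 < y $ j * a j}"
proof -
  have "{y::real^3. \<forall>j\<in>J. 0 < y $ j * a j} = (\<Inter>j\<in>J. {y. axis j (a j) \<bullet> y > 0})"
    by (auto simp: inner_axis' mult.commute)
  then show ?thesis by (auto intro!: convex_INT convex_halfspace_gt)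
qed

lemma open_orthant: "open {y::real^3. \<forall>j\<in>J. 0 < y $ j * a j}"
proof -
  have "{y::real^3. \<forall>j\<in>J. 0 < y $ j * a j} = (\<Inter>j\<in>J. {y. 0 < y $ j * a j})" by auto
  moreover have "finite J" by (rule finite_subset[OF subset_UNIV]) simp
  ultimately show ?thesis by (auto intro!: open_INT open_Collect_less continuous_intros)
qed

text \<open>Otherwise \<open>K\<close> would be closed as well as open in the connected set
  \<open>W\<close>, hence equal to \<open>W\<close>, which meets \<open>D\<close>.\<close>

lemma component_touches:
  assumes D: "closed D" and W: "open W" "connected W" "W \<inter> D \<noteq> {}"
    and K: "K \<in> components (W - D)"
  obtains e where "e \<in> W" "e \<in> D" "e \<in> closure (K :: 'a::real_normed_vector set)"
proof -
  have "open (W - D)" using D W by auto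
  then have oK: "open K" using K open_components by blast
  have KW: "K \<subseteq> W - D" "K \<noteq> {}" using K in_components_subset in_components_nonempty by blast+
  have cl: "closure K \<inter> (W - D) = K"
  proof -
    obtain T where T: "closed T" "K = (W - D) \<inter> T"
      using closedin_component[OF K] by (auto simp: closedin_closed)
    then have "closure K \<subseteq> T" by (simp add: closure_minimal)
    then show ?thesis using T(2) closure_subset[of K] by blast
  qed
  show thesis
  proof (rule ccontr)
    assume "\<not> thesis"
    then have "closure K \<inter> W = K" using that cl KW(1) closure_subset[of K] by blast
    then have "closedin (top_of_set W) K" by (metis closed_closure closedin_closed_Int inf_commute)
    moreover have "openin (top_of_set W) K" using oK KW(1) by (auto intro: open_subset)
    ultimately have "K = W" using W(2) KW(2) by (auto simp: connected_clopen)
    then show False using KW(1) W(3) by blast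
  qed
qed

section \<open>Boundary values at regular points\<close>

context diagram
begin

text \<open>The pair of values is what a local biquandle color prescribes on a sheet, listed in the
  direction of the normal vector. One chart is demanded; by \<open>germ_chart\<close> every other
  chart centred at \<open>q\<close> then gives the same pair.\<close>

definition germ :: "(R3 \<Rightarrow> 'v) \<Rightarrow> R3 \<Rightarrow> 'v \<Rightarrow> 'v \<Rightarrow> bool" where
  "germ f q v w \<longleftrightarrow> (\<exists>c \<phi> e. rhc c \<phi> \<and> \<phi> 0 = q \<and> e > 0 \<and>
     (\<forall>x\<in>ball 0 e. (x $ 3 < 0 \<longrightarrow> f (\<phi> x) = v) \<and> (0 < x $ 3 \<longrightarrow> f (\<phi> x) = w)))"

lemma chart_ball:
  assumes "open_embedding \<phi>" "open V" "\<phi> x \<in> V"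
  obtains e where "e > 0" "\<phi> ` ball x e \<subseteq> V"
proof -
  have "open (\<phi> -` V)" using open_vimage[OF assms(2) open_embeddingD(1)[OF assms(1)]] .
  then obtain e where "e > 0" "ball x e \<subseteq> \<phi> -` V" using assms(3) open_contains_ball by blast
  then show thesis using that by blast
qed

text \<open>This is where the uniqueness of the normal direction is used: by
  \<open>same_sides\<close> the half balls of two charts at \<open>q\<close> correspond to each
  other.\<close>

lemma germ_chart:
  assumes g: "germ f q v w" and c: "rhc c \<phi>" and q: "\<phi> 0 = q"
  obtains e where "e > 0" "\<And>x. x \<in> ball 0 e \<Longrightarrow> x $ 3 < 0 \<Longrightarrow> f (\<phi> x) = v"
    "\<And>x. x \<in> ball 0 e \<Longrightarrow> 0 < x $ 3 \<Longrightarrow> f (\<phi> x) = w"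
proof -
  obtain c' \<phi>' e' where c': "rhc c' \<phi>'" "\<phi>' 0 = q" "e' > 0"
    and n: "\<And>x. x \<in> ball 0 e' \<Longrightarrow> x $ 3 < 0 \<Longrightarrow> f (\<phi>' x) = v"
    and p: "\<And>x. x \<in> ball 0 e' \<Longrightarrow> 0 < x $ 3 \<Longrightarrow> f (\<phi>' x) = w"
    using g unfolding germ_def by blast
  obtain e1 where e1: "e1 > 0"
    "\<And>x. x \<in> ball 0 e1 \<Longrightarrow> x $ 3 < 0 \<Longrightarrow> \<phi> x \<in> \<phi>' ` {y. y $ 3 < 0}"
    "\<And>x. x \<in> ball 0 e1 \<Longrightarrow> x $ 3 > 0 \<Longrightarrow> \<phi> x \<in> \<phi>' ` {y. y $ 3 > 0}"
    using same_sides[OF c c'(1)] c'(2) q by metis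
  have emb: "open_embedding \<phi>'" by (rule rhcD(1)[OF c'(1)])
  have inj: "\<phi>' x = \<phi>' y \<longleftrightarrow> x = y" for x y using open_embeddingD(2)[OF emb] by (simp add: inj_eq)
  have "\<phi>' 0 \<in> \<phi>' ` ball 0 e'" using c'(3) by (intro imageI) simp
  then have "\<phi> 0 \<in> \<phi>' ` ball 0 e'" using c'(2) q by simp
  moreover have "open (\<phi>' ` ball 0 e')" by (rule open_embeddingD(3)[OF emb open_ball])
  ultimately obtain e2 where e2: "e2 > 0" "\<phi> ` ball 0 e2 \<subseteq> \<phi>' ` ball 0 e'"
    using chart_ball[OF rhcD(1)[OF c]] by blast
  show thesis
  proof (rule that[of "min e1 e2"])
    fix x :: R3 assume x: "x \<in> ball 0 (min e1 e2)"
    then have "\<phi> x \<in> \<phi>' ` ball 0 e'" using e2 by auto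
    then obtain y where y: "y \<in> ball 0 e'" "\<phi> x = \<phi>' y" by blast
    show "f (\<phi> x) = v" if "x $ 3 < 0"
    proof -
      have "y $ 3 < 0" using e1(2)[of x] that x y inj by auto
      then show ?thesis using n[OF y(1)] y(2) by simp
    qed
    show "f (\<phi> x) = w" if "0 < x $ 3"
    proof -
      have "0 < y $ 3" using e1(3)[of x] that x y inj by auto
      then show ?thesis using p[OF y(1)] y(2) by simp
    qed
  qed (use e1 e2 in auto)
qed

lemma small_axis:
  assumes "e > 0"
  shows "(e/2) *\<^sub>R (axis 3 1 :: R3) \<in> ball 0 e" "- ((e/2) *\<^sub>R (axis 3 1 :: R3)) \<in> ball 0 e"
    "((e/2) *\<^sub>R (axis 3 1 :: R3)) $ 3 > 0" "(- ((e/2) *\<^sub>R (axis 3 1 :: R3))) $ 3 < 0"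
proof -
  have "norm ((e/2) *\<^sub>R (axis 3 1 :: R3)) = e/2" using assms by (simp add: norm_axis_1)
  then show "(e/2) *\<^sub>R (axis 3 1 :: R3) \<in> ball 0 e" "- ((e/2) *\<^sub>R (axis 3 1 :: R3)) \<in> ball 0 e"
    using assms by simp_all
  show "((e/2) *\<^sub>R (axis 3 1 :: R3)) $ 3 > 0" "(- ((e/2) *\<^sub>R (axis 3 1 :: R3))) $ 3 < 0"
    using assms by (simp_all add: axis_def)
qed

lemma germ_unique:
  assumes f: "germ f q v w" and g: "germ f q v' w'"
  shows "v = v' \<and> w = w'"
proof -
  obtain c \<phi> e where c: "rhc c \<phi>" "\<phi> 0 = q" "e > 0"
    and n: "\<And>x. x \<in> ball 0 e \<Longrightarrow> x $ 3 < 0 \<Longrightarrow> f (\<phi> x) = v"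
    and p: "\<And>x. x \<in> ball 0 e \<Longrightarrow> 0 < x $ 3 \<Longrightarrow> f (\<phi> x) = w"
    using f unfolding germ_def by blast
  obtain e' where e': "e' > 0" "\<And>x. x \<in> ball 0 e' \<Longrightarrow> x $ 3 < 0 \<Longrightarrow> f (\<phi> x) = v'"
    "\<And>x. x \<in> ball 0 e' \<Longrightarrow> 0 < x $ 3 \<Longrightarrow> f (\<phi> x) = w'"
    using germ_chart[OF g c(1,2)] by blast
  define d where "d = min e e'"
  have d: "d > 0" "d \<le> e" "d \<le> e'" using c e' by (auto simp: d_def)
  define x where "x = (d/2) *\<^sub>R (axis 3 1 :: R3)"
  have "x \<in> ball 0 d" "- x \<in> ball 0 d" "x $ 3 > 0" "(- x) $ 3 < 0"
    using small_axis[OF d(1)] unfolding x_def by blast+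
  then show ?thesis using n[of "- x"] p[of x] e'(2)[of "- x"] e'(3)[of x] d by auto
qed

text \<open>Inside the chart the points of \<open>D\<close> are those of the plane, and the chart
  can be recentred at each of them.\<close>

lemma germ_near:
  assumes "germ f q v w"
  obtains V where "open V" "q \<in> V" "\<And>q'. q' \<in> V \<inter> D \<Longrightarrow> germ f q' v w"
proof -
  obtain c \<phi> e where c: "rhc c \<phi>" "\<phi> 0 = q" "e > 0"
    and n: "\<And>x. x \<in> ball 0 e \<Longrightarrow> x $ 3 < 0 \<Longrightarrow> f (\<phi> x) = v"
    and p: "\<And>x. x \<in> ball 0 e \<Longrightarrow> 0 < x $ 3 \<Longrightarrow> f (\<phi> x) = w"
    using assms unfolding germ_def by blast
  show thesis
  proof (rule that[of "\<phi> ` ball 0 e"])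
    show "open (\<phi> ` ball 0 e)" using open_embeddingD(3)[OF rhcD(1)[OF c(1)]] by auto
    show "q \<in> \<phi> ` ball 0 e" by (rule image_eqI[of _ _ 0]) (use c in auto)
    fix q' assume "q' \<in> \<phi> ` ball 0 e \<inter> D"
    then obtain x where x: "x \<in> ball 0 e" "q' = \<phi> x" "x $ 3 = 0" using rhc_D[OF c(1)] by auto
    then have xe: "x = emb (pr x)" by (simp add: vec3_eq_iff pr_def)
    have b: "y + x \<in> ball 0 e" if "y \<in> ball 0 (e - norm x)" for y
      using that norm_triangle_ineq[of y x] by auto
    have "rhc (\<lambda>u. c (u + pr x)) (\<lambda>y. \<phi> (y + x))"
      using rhc_shift[OF c(1), of "pr x"] xe by simp
    then show "germ f q' v w"
      unfolding germ_def using x b n p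
      by (intro exI[of _ "\<lambda>u. c (u + pr x)"] exI[of _ "\<lambda>y. \<phi> (y + x)"] exI[of _ "e - norm x"]) auto
  qed
qed

lemma germ_exists:
  assumes f: "connected_constant f (U - D)" and U: "open U" "q \<in> U" and q: "q \<in> R"
  obtains v w where "germ f q v w"
proof -
  obtain c \<phi> where c: "rhc c \<phi>" "\<phi> 0 = q" using q by (auto simp: regular_points_def)
  obtain e where e: "e > 0" "\<phi> ` ball 0 e \<subseteq> U"
    using chart_ball[OF rhcD(1)[OF c(1)] U(1), of 0] U(2) c(2) by blast
  have E: "continuous_on A \<phi>" for A
    using open_embeddingD(1)[OF rhcD(1)[OF c(1)]] continuous_on_subset by blast
  have con: "connected (\<phi> ` (ball 0 e \<inter> {x. x $ 3 < 0}))" "connected (\<phi> ` (ball 0 e \<inter> {x. 0 < x $ 3}))"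
    by (intro connected_continuous_image E convex_connected convex_Int convex_ball convex_coord)+
  have sub: "\<phi> ` (ball 0 e \<inter> {x. x $ 3 < 0}) \<subseteq> U - D" "\<phi> ` (ball 0 e \<inter> {x. 0 < x $ 3}) \<subseteq> U - D"
    using e(2) rhc_D[OF c(1)] by auto
  obtain v w where "\<forall>z\<in>\<phi> ` (ball 0 e \<inter> {x. x $ 3 < 0}). f z = v" "\<forall>z\<in>\<phi> ` (ball 0 e \<inter> {x. 0 < x $ 3}). f z = w"
    using f con sub unfolding connected_constant_def constant_on_def by metis
  then have "germ f q v w" unfolding germ_def using c e(1) by blast
  then show thesis by (rule that)
qed

text \<open>A germ exists at every point of \<open>A\<close>, is unique, and is shared by the
  neighbouring points of \<open>D\<close>. So the points of \<open>A\<close> with a given germ form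
  an open and closed subset.\<close>

lemma germ_propagate:
  assumes A: "connected A" "A \<subseteq> R" and U: "open U" "A \<subseteq> U" and f: "connected_constant f (U - D)"
    and q: "q \<in> A" "germ f q v w" and q': "q' \<in> A"
  shows "germ f q' v w"
proof (rule connected_induction_simple[where P = "\<lambda>a. germ f a v w", OF A(1) q(1) q' q(2)])
  fix a assume a: "a \<in> A"
  then obtain v' w' where "germ f a v' w'" using germ_exists[OF f U(1), of a] A(2) U(2) by (meson subsetD)
  then obtain V where V: "open V" "a \<in> V" "\<And>q'. q' \<in> V \<inter> D \<Longrightarrow> germ f q' v' w'"
    by (rule germ_near) (rule that)
  have "A \<subseteq> D" using A(2) regular_subset_D by blast
  then show "\<exists>T. openin (top_of_set A) T \<and> a \<in> T \<and> (\<forall>x\<in>T. \<forall>y\<in>T. germ f x v w \<longrightarrow> germ f y v w)"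
  proof (intro exI[of _ "A \<inter> V"] conjI ballI impI)
    show "openin (top_of_set A) (A \<inter> V)" "a \<in> A \<inter> V" using V(1,2) a by auto
    fix x y assume xy: "x \<in> A \<inter> V" "y \<in> A \<inter> V" "germ f x v w"
    then have "germ f x v' w'" "germ f y v' w'" using V(3) \<open>A \<subseteq> D\<close> by blast+
    then show "germ f y v w" using germ_unique[OF xy(3)] by metis
  qed
qed

lemma germ_normal:
  assumes n: "normal_crosses G \<eta> q N P" and V: "open V" "q \<in> V"
    and v: "\<And>z. z \<in> N \<inter> V - D \<Longrightarrow> f z = v" and w: "\<And>z. z \<in> P \<inter> V - D \<Longrightarrow> f z = w"
  shows "germ f q v w"
proof -
  obtain c \<phi> where c: "rhc c \<phi>" "\<phi> 0 = q" "\<phi> ` {x. x $ 3 < 0} \<subseteq> N" "\<phi> ` {x. 0 < x $ 3} \<subseteq> P"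
    using n unfolding normal_crosses_def by blast
  obtain e where e: "e > 0" "\<phi> ` ball 0 e \<subseteq> V"
    using chart_ball[OF rhcD(1)[OF c(1)] V(1), of 0] V(2) c(2) by blast
  have "f (\<phi> x) = v" if "x \<in> ball 0 e" "x $ 3 < 0" for x
  proof -
    have "\<phi> x \<in> N" using c(3) that by blast
    moreover have "\<phi> x \<in> V" using e(2) that by blast
    moreover have "\<phi> x \<notin> D" using rhc_D[OF c(1)] that by simp
    ultimately show ?thesis using v by blast
  qed
  moreover have "f (\<phi> x) = w" if "x \<in> ball 0 e" "0 < x $ 3" for x
  proof -
    have "\<phi> x \<in> P" using c(4) that by blast
    moreover have "\<phi> x \<in> V" using e(2) that by blast
    moreover have "\<phi> x \<notin> D" using rhc_D[OF c(1)] that by simp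
    ultimately show ?thesis using w by blast
  qed
  ultimately show ?thesis unfolding germ_def using c(1,2) e(1) by blast
qed

lemma crossing_chart_embedding: "crossing_chart G \<eta> I \<phi> h \<Longrightarrow> open_embedding \<phi>"
  by (simp add: crossing_chart_def)

lemma crossing_chart_G:
  assumes "crossing_chart G \<eta> I \<phi> h"
  shows "(\<phi> x, s) \<in> G \<longleftrightarrow> (\<exists>i\<in>I. x $ i = 0 \<and> s = h i x)"
proof -
  have e: "G \<inter> fst -` range \<phi> = {(\<phi> x, h i x) |i x. i \<in> I \<and> x $ i = 0}"
    using assms by (simp add: crossing_chart_def)
  have inj: "\<phi> x = \<phi> y \<longleftrightarrow> x = y" for x y
    using open_embeddingD(2)[OF crossing_chart_embedding[OF assms]] by (simp add: inj_eq)
  have "(\<phi> x, s) \<in> G \<longleftrightarrow> (\<phi> x, s) \<in> G \<inter> fst -` range \<phi>" by simp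
  also have "\<dots> \<longleftrightarrow> (\<exists>i\<in>I. x $ i = 0 \<and> s = h i x)" unfolding e using inj by auto
  finally show ?thesis .
qed

lemma crossing_chart_D: "crossing_chart G \<eta> I \<phi> h \<Longrightarrow> \<phi> x \<in> D \<longleftrightarrow> (\<exists>i\<in>I. x $ i = 0)"
  unfolding in_D crossing_chart_G by blast

lemma crossing_chart_normal:
  assumes "crossing_chart G \<eta> I \<phi> h" "i \<in> I" "x $ i = 0" "\<And>j. j \<in> I - {i} \<Longrightarrow> x $ j \<noteq> 0"
  shows "normal_crosses G \<eta> (\<phi> x) (\<phi> ` {y. y $ i < 0}) (\<phi> ` {y. 0 < y $ i})"
proof -
  note * = assms(1)[unfolded crossing_chart_def]
  have "\<forall>i\<in>I. \<forall>x. x $ i = 0 \<and> (\<forall>j\<in>I - {i}. x $ j \<noteq> 0) \<longrightarrow>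
        normal_crosses G \<eta> (\<phi> x) (\<phi> ` {y. y $ i < 0}) (\<phi> ` {y. 0 < y $ i})"
    using * by (elim conjE)
  then show ?thesis using assms(2-4) by blast
qed

lemma normal_crosses_regular: "normal_crosses G \<eta> q N P \<Longrightarrow> q \<in> R"
  unfolding normal_crosses_def regular_points_def by blast

end

section \<open>Unicoherence for open sets\<close>

text \<open>The values lie in the discrete set of integral multiples of 2 pi i.\<close>

lemma exp_eq_1_constant:
  fixes a :: "'a::topological_space \<Rightarrow> complex"
  assumes "connected S" "continuous_on S a" and e: "\<And>x. x \<in> S \<Longrightarrow> exp (a x) = 1"
  shows "a constant_on S"
proof (rule continuous_discrete_range_constant[OF assms(1,2)])
  fix x assume x: "x \<in> S"
  have "2 * pi \<le> norm (a y - a x)" if "y \<in> S" "a y \<noteq> a x" for y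
  proof -
    have "exp (a y) = exp (a x)" using e x that by simp
    then obtain n :: int where n: "a y = a x + of_int (2 * n) * pi * \<i>" using exp_eq by blast
    then have "n \<noteq> 0" using that by auto
    then have "1 \<le> \<bar>real_of_int n\<bar>" by linarith
    then have "2 * pi * 1 \<le> 2 * pi * \<bar>real_of_int n\<bar>" by (intro mult_left_mono) auto
    then show ?thesis using n by (simp add: norm_mult mult_ac)
  qed
  then show "\<exists>e>0. \<forall>y. y \<in> S \<and> a y \<noteq> a x \<longrightarrow> e \<le> norm (a y - a x)"
    by (intro exI[of _ "2 * pi"]) auto
qed

text \<open>It will be applied to a region and to the union of a neighbourhood of the diagram with
  all other regions.\<close>

lemma open_unicoherent:
  fixes S T :: "'a::euclidean_space set"
  assumes S: "open S" "connected S" and T: "open T" "connected T" and un: "S \<union> T = UNIV"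
  shows "connected (S \<inter> T)"
proof (rule ccontr)
  assume "\<not> connected (S \<inter> T)"
  then obtain P' Q' where PQ': "open P'" "open Q'" "P' \<inter> (S \<inter> T) \<noteq> {}" "Q' \<inter> (S \<inter> T) \<noteq> {}"
    "P' \<inter> Q' \<inter> (S \<inter> T) = {}" "S \<inter> T \<subseteq> P' \<union> Q'"
    unfolding connected_def by blast
  define P Q where "P = P' \<inter> (S \<inter> T)" and "Q = Q' \<inter> (S \<inter> T)"
  have PQ: "open P" "open Q" "P \<noteq> {}" "Q \<noteq> {}" "P \<inter> Q = {}" "P \<union> Q = S \<inter> T"
    using PQ' S T by (auto simp: P_def Q_def)
  have dis: "- T \<inter> - S = {}" and clS: "closed (- S)" and clT: "closed (- T)" using un S T by auto
  obtain h :: "'a \<Rightarrow> real" where h: "continuous_on UNIV h"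
    "\<And>x. x \<in> - T \<Longrightarrow> h x = 0" "\<And>x. x \<in> - S \<Longrightarrow> h x = 1"
    by (rule Urysohn[OF clT clS dis, of 0 1]) (rule that)
  \<comment> \<open>A frontier point of \<open>P\<close> lies in neither \<open>P\<close> nor
    \<open>Q\<close>, hence outside \<open>S\<close> or outside \<open>T\<close>; there
    \<open>h\<close> is 1 or 0, so that \<open>exp (c * of_real (h x))\<close> is 1 and the two
    pieces of \<open>g\<close> fit together.\<close>
  have "closure P \<inter> Q = {}" using PQ by (simp add: open_Int_closure_eq_empty Int_commute)
  then have fr: "x \<in> - T \<or> x \<in> - S" if "x \<in> closure P" "x \<notin> P" for x
    using that PQ(6) by blast
  define c where "c = 2 * complex_of_real pi * \<i>"
  have ec: "exp c = 1" using exp_two_pi_i by (simp add: c_def mult_ac)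
  have hc: "continuous_on A (\<lambda>x. c * of_real (h x))" for A
    using h(1) continuous_on_subset by (intro continuous_intros) blast
  \<comment> \<open>If \<open>S \<inter> T\<close> were disconnected, a loop through \<open>P\<close> and \<open>Q\<close> would wind around the circle under
    \<open>g\<close>, which is impossible as \<open>g\<close> has a logarithm \<open>\<theta>\<close>.\<close>
  define g where "g x = (if x \<in> P then exp (c * of_real (h x)) else 1)" for x
  have "continuous_on (closure P \<union> - P) g"
    unfolding g_def
  proof (rule continuous_on_cases)
    show "\<forall>x. x \<in> closure P \<and> x \<notin> P \<or> x \<in> - P \<and> x \<in> P \<longrightarrow> exp (c * of_real (h x)) = 1"
      using fr h(2,3) ec by fastforce
  qed (use PQ hc in \<open>auto intro!: continuous_on_exp\<close>)
  moreover have "closure P \<union> - P = UNIV" using closure_subset[of P] by blast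
  ultimately have "continuous_on UNIV g" by simp
  moreover have "contractible (UNIV :: 'a set)" by (simp add: convex_imp_contractible)
  moreover have "g x \<noteq> 0" for x by (simp add: g_def)
  ultimately obtain \<theta> where \<theta>: "continuous_on UNIV \<theta>" "\<And>x. g x = exp (\<theta> x)"
    by (rule continuous_logarithm_on_contractible[of UNIV g]) auto
  \<comment> \<open>Inside \<open>S\<close> the frontier of \<open>P\<close> lies outside
    \<open>T\<close>, where \<open>h\<close> is 0, so \<open>L 0\<close> is continuous on
    \<open>S\<close>; likewise \<open>L 1\<close> is continuous on \<open>T\<close>, as
    \<open>h\<close> is 1 outside \<open>S\<close>. Both are logarithms of 1 and hence constant
    there. They agree at a point of \<open>Q\<close> but differ by \<open>c\<close> at a point of
    \<open>P\<close>, which is the contradiction.\<close>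
  define L where "L d x = \<theta> x - (if x \<in> P then c * of_real (h x - d) else 0)" for d :: real and x
  have L: "L d constant_on A"
    if A: "connected A" and d: "d = 0 \<or> d = 1" and fr': "\<And>x. x \<in> A \<Longrightarrow> x \<in> closure P \<Longrightarrow> x \<notin> P \<Longrightarrow> h x = d" for d A
  proof (rule exp_eq_1_constant[OF A])
    have "continuous_on (A \<inter> closure P \<union> A \<inter> - P) (\<lambda>x. if x \<in> P then c * of_real (h x - d) else 0)"
    proof (rule continuous_on_cases_local)
      have "A \<inter> closure P \<union> A \<inter> - P = A" using closure_subset[of P] by blast
      then show "closedin (top_of_set (A \<inter> closure P \<union> A \<inter> - P)) (A \<inter> closure P)"
        "closedin (top_of_set (A \<inter> closure P \<union> A \<inter> - P)) (A \<inter> - P)"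
        using closedin_closed_Int[OF closed_Compl[OF PQ(1)], of A] closedin_closed_Int[of "closure P" A] by simp_all
      show "continuous_on (A \<inter> closure P) (\<lambda>x. c * of_real (h x - d))"
        using h(1) by (intro continuous_intros) (blast intro: continuous_on_subset)
    qed (use fr' in auto)
    moreover have "A \<inter> closure P \<union> A \<inter> - P = A" using closure_subset[of P] by blast
    ultimately show "continuous_on A (L d)"
      unfolding L_def using \<theta>(1) by (auto intro!: continuous_on_diff intro: continuous_on_subset)
    fix x assume "x \<in> A"
    have "exp (c * of_real (h x - d)) = exp (c * of_real (h x))"
      using d ec by (auto simp: right_diff_distrib exp_diff)
    then show "exp (L d x) = 1"
      using \<theta>(2)[of x] by (auto simp: L_def g_def exp_diff)
  qed
  have LS: "L 0 constant_on S" by (rule L) (use S fr h(2) in auto)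
  have LT: "L 1 constant_on T" by (rule L) (use T fr h(3) in auto)
  obtain p q where p: "p \<in> P" and q: "q \<in> Q" using PQ by blast
  have "p \<in> S" "p \<in> T" "q \<in> S" "q \<in> T" "q \<notin> P" using p q PQ by blast+
  then have "L 0 p = L 0 q" "L 1 p = L 1 q" using LS LT unfolding constant_on_def by metis+
  then have "L 0 p = L 1 p" using \<open>q \<notin> P\<close> by (simp add: L_def)
  then have "c = 0" using p by (simp add: L_def right_diff_distrib)
  then show False by (simp add: c_def)
qed

section \<open>The points of a diagram\<close>

lemma umbrella_eq_iff:
  "umbrella u = x \<longleftrightarrow> x $ 1 = u $ 1 \<and> x $ 2 = (u $ 2)\<^sup>2 \<and> x $ 3 = u $ 1 * u $ 2"
  by (auto simp: umbrella_def vec3_eq_iff)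

lemma umbrella_nth: "umbrella u $ 1 = u $ 1" "umbrella u $ 2 = (u $ 2)\<^sup>2" "umbrella u $ 3 = u $ 1 * u $ 2"
  by (simp_all add: umbrella_def)

context diagram
begin

text \<open>By the regularity of the projection, the number of preimages identifies most of the points
  met inside a chart.\<close>

definition fib :: "R3 \<Rightarrow> real set" where "fib q = {s. (q, s) \<in> G}"

lemma fib_in_D: "fib q \<noteq> {} \<longleftrightarrow> q \<in> D"
  by (auto simp: fib_def in_D)

lemma D_cases:
  "q \<in> D \<longleftrightarrow> q \<in> R \<or> q \<in> double_points G \<eta> \<or> q \<in> triple_points G \<eta> \<or> q \<in> branch_points G"
  using regular[unfolded regular_projection_def, folded D_def] by (simp add: disj_assoc)

lemma card_fib_regular: "q \<in> R \<Longrightarrow> card (fib q) = 1"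
proof -
  assume "q \<in> R"
  then obtain c \<phi> where "rhc c \<phi>" "\<phi> 0 = q" by (auto simp: regular_points_def)
  then have "fib q = {snd (c (pr 0))}" by (auto simp: fib_def rhc_G)
  then show ?thesis by simp
qed

lemma fib_crossing:
  assumes "crossing_chart G \<eta> I \<phi> h"
  shows "fib (\<phi> x) = (\<lambda>i. h i x) ` {i \<in> I. x $ i = 0}"
  by (auto simp: fib_def crossing_chart_G[OF assms])

lemma card_fib_double_chart:
  assumes "double_chart G \<eta> \<phi>" "x $ 1 = 0" "x $ 2 = 0"
  shows "card (fib (\<phi> x)) = 2"
proof -
  obtain h where h: "crossing_chart G \<eta> {1, 2} \<phi> h" "h 2 x < h 1 x"
    using assms unfolding double_chart_def by blast
  have "{i \<in> {1, 2}. x $ i = 0} = {1, 2}" using assms by auto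
  then have "fib (\<phi> x) = {h 1 x, h 2 x}" using fib_crossing[OF h(1)] by simp
  then show ?thesis using h(2) by simp
qed

lemma card_fib_double: "q \<in> double_points G \<eta> \<Longrightarrow> card (fib q) = 2"
  using card_fib_double_chart[of _ 0] by (auto simp: double_points_def)

lemma card_fib_triple: "q \<in> triple_points G \<eta> \<Longrightarrow> card (fib q) = 3"
proof -
  assume "q \<in> triple_points G \<eta>"
  then obtain \<phi> where \<phi>: "triple_chart G \<eta> \<phi>" "q = \<phi> 0" by (auto simp: triple_points_def)
  then obtain h where h: "crossing_chart G \<eta> {1, 2, 3} \<phi> h" "h 2 (0::R3) < h 1 0" "h 3 (0::R3) < h 2 0"
    unfolding triple_chart_def by fastforce
  have "{i \<in> {1, 2, 3}. (0::R3) $ i = 0} = {1, 2, 3}" by auto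
  then have "fib q = {h 1 0, h 2 0, h 3 0}" using fib_crossing[OF h(1), of 0] \<phi>(2) by simp
  then show ?thesis using h(2,3) by simp
qed

lemma branch_chart_embedding: "branch_chart G \<phi> \<Longrightarrow> open_embedding \<phi>"
  unfolding branch_chart_def by (elim conjE)

lemma branch_chart_G:
  assumes "branch_chart G \<phi>"
  obtains h where "\<And>x s. (\<phi> x, s) \<in> G \<longleftrightarrow> (\<exists>u. x = umbrella u \<and> s = h u)"
    "\<And>u v. umbrella u = umbrella v \<Longrightarrow> h u = h v \<Longrightarrow> u = v"
proof -
  obtain h :: "real^2 \<Rightarrow> real" where h: "inj (\<lambda>u. (\<phi> (umbrella u), h u))"
    "G \<inter> fst -` range \<phi> = range (\<lambda>u. (\<phi> (umbrella u), h u))"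
    using assms unfolding branch_chart_def by (elim conjE exE)
  have inj: "\<phi> x = \<phi> y \<longleftrightarrow> x = y" for x y
    using open_embeddingD(2)[OF branch_chart_embedding[OF assms]] by (simp add: inj_eq)
  show thesis
  proof (rule that)
    fix x s
    have "(\<phi> x, s) \<in> G \<longleftrightarrow> (\<phi> x, s) \<in> G \<inter> fst -` range \<phi>" by simp
    also have "\<dots> \<longleftrightarrow> (\<exists>u. x = umbrella u \<and> s = h u)" unfolding h(2) by (auto simp: inj)
    finally show "(\<phi> x, s) \<in> G \<longleftrightarrow> (\<exists>u. x = umbrella u \<and> s = h u)" .
  next
    fix u v assume "umbrella u = umbrella v" "h u = h v"
    then show "u = v" using injD[OF h(1), of u v] by simp
  qed
qed

lemma branch_chart_D: "branch_chart G \<phi> \<Longrightarrow> \<phi> x \<in> D \<longleftrightarrow> x \<in> range umbrella"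
  by (rule branch_chart_G, assumption) (auto simp: in_D)

text \<open>The umbrella identifies only the points \<open>u\<close> and \<open>- u\<close> of the
  line \<open>u $ 1 = 0\<close>, and the embedding separates these two by their heights.\<close>

lemma card_fib_branch_chart:
  assumes "branch_chart G \<phi>"
  shows "u $ 1 \<noteq> 0 \<or> u $ 2 = 0 \<Longrightarrow> card (fib (\<phi> (umbrella u))) = 1"
    "u $ 1 = 0 \<Longrightarrow> u $ 2 \<noteq> 0 \<Longrightarrow> card (fib (\<phi> (umbrella u))) = 2"
proof -
  obtain h where h: "\<And>x s. (\<phi> x, s) \<in> G \<longleftrightarrow> (\<exists>u. x = umbrella u \<and> s = h u)"
    "\<And>u v. umbrella u = umbrella v \<Longrightarrow> h u = h v \<Longrightarrow> u = v"
    by (rule branch_chart_G[OF assms]) (rule that)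
  have f: "fib (\<phi> (umbrella u)) = h ` {v. umbrella v = umbrella u}"
    unfolding fib_def h(1) eq_commute[of "umbrella u"] by blast
  show "card (fib (\<phi> (umbrella u))) = 1" if "u $ 1 \<noteq> 0 \<or> u $ 2 = 0"
  proof -
    have "{v. umbrella v = umbrella u} = {u}"
      using that by (auto simp: umbrella_eq_iff umbrella_nth vec2_eq_iff)
    then show ?thesis unfolding f by simp
  qed
  show "card (fib (\<phi> (umbrella u))) = 2" if "u $ 1 = 0" "u $ 2 \<noteq> 0"
  proof -
    have "{v. umbrella v = umbrella u} = {u, - u}"
      using that by (auto simp: umbrella_eq_iff umbrella_nth vec2_eq_iff power2_eq_iff)
    moreover have "h u \<noteq> h (- u)"
    proof
      assume "h u = h (- u)"
      moreover have "umbrella u = umbrella (- u)" using that by (simp add: umbrella_eq_iff umbrella_nth)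
      ultimately have "u = - u" using h(2) by blast
      then show False using that by (simp add: vec2_eq_iff)
    qed
    ultimately show ?thesis unfolding f by simp
  qed
qed

lemma umbrella_0: "umbrella 0 = 0"
  by (simp add: umbrella_eq_iff)

lemma card_fib_branch: "q \<in> branch_points G \<Longrightarrow> card (fib q) = 1"
  using card_fib_branch_chart(1)[of _ 0] by (auto simp: branch_points_def umbrella_0)

text \<open>Regular, double, triple and branch points have 1, 2, 3 and 1 preimages, so the number 2
  is characteristic.\<close>

lemma card_fib_2_double: "card (fib q) = 2 \<Longrightarrow> q \<in> double_points G \<eta>"
proof -
  assume c: "card (fib q) = 2"
  then have "q \<in> D" using fib_in_D by fastforce
  then show ?thesis using c card_fib_regular card_fib_triple card_fib_branch unfolding D_cases by force
qed

text \<open>The line of double points of the umbrella ends at its apex.\<close>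

lemma branch_accumulates:
  assumes "q \<in> branch_points G" "open V" "q \<in> V"
  shows "\<exists>q'\<in>V. card (fib q') = 2"
proof -
  obtain \<phi> where \<phi>: "branch_chart G \<phi>" "q = \<phi> 0" using assms(1) by (auto simp: branch_points_def)
  obtain e where e: "e > 0" "\<phi> ` ball 0 e \<subseteq> V"
    using chart_ball[OF branch_chart_embedding[OF \<phi>(1)] assms(2), of 0] assms(3) \<phi>(2) by metis
  \<comment> \<open>The umbrella sends this point to \<open>vector [0, e/2, 0]\<close>, which lies
    in the ball of radius \<open>e\<close>.\<close>
  define u where "u = (vector [0, sqrt (e/2)] :: real^2)"
  have "norm (umbrella u) = e/2" using e(1) by (simp add: norm3 umbrella_nth u_def)
  then have "\<phi> (umbrella u) \<in> V" using e by auto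
  moreover have "card (fib (\<phi> (umbrella u))) = 2"
    using card_fib_branch_chart(2)[OF \<phi>(1), of u] e(1) by (simp add: u_def)
  ultimately show ?thesis by blast
qed

text \<open>A single preimage leaves a regular or a branch point. Near a branch point there would be
  fibres of size 2, but the half space on the side of \<open>umbrella u\<close> contains only points
  with at most one preimage.\<close>

lemma branch_chart_regular:
  assumes \<phi>: "branch_chart G \<phi>" and u: "u $ 1 \<noteq> 0"
  shows "\<phi> (umbrella u) \<in> R"
proof -
  have c: "card (fib (\<phi> (umbrella u))) = 1" using card_fib_branch_chart(1)[OF \<phi>] u by blast
  have "\<phi> (umbrella u) \<in> D" using branch_chart_D[OF \<phi>] by blast
  moreover have "\<phi> (umbrella u) \<notin> branch_points G"
  proof
    assume b: "\<phi> (umbrella u) \<in> branch_points G"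
    define V where "V = \<phi> ` {x. 0 < x $ 1 * u $ 1}"
    have "open V" unfolding V_def
      by (intro open_embeddingD(3)[OF branch_chart_embedding[OF \<phi>]] open_Collect_less continuous_intros)
    moreover have "umbrella u \<in> {x. 0 < x $ 1 * u $ 1}"
      using u by (auto simp: umbrella_nth zero_less_mult_iff)
    ultimately obtain q' where q': "q' \<in> V" "card (fib q') = 2"
      using branch_accumulates[OF b] unfolding V_def by blast
    then obtain x where x': "q' = \<phi> x" "0 < x $ 1 * u $ 1" by (auto simp: V_def)
    then have x: "q' = \<phi> x" "x $ 1 \<noteq> 0" by auto
    have "fib q' \<noteq> {}" using q'(2) by auto
    then have "\<phi> x \<in> D" using fib_in_D[of q'] x(1) by simp
    then obtain u' where "x = umbrella u'" using branch_chart_D[OF \<phi>] by blast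
    then show False using q'(2) x card_fib_branch_chart(1)[OF \<phi>, of u'] by (simp add: umbrella_nth)
  qed
  ultimately show ?thesis using c card_fib_double card_fib_triple unfolding D_cases by force
qed

text \<open>The two parts allow a triple or branch point in the closure of a component to be
  replaced by a regular or double point nearby.\<close>

lemma isolated_points:
  assumes "q \<in> triple_points G \<eta> \<or> q \<in> branch_points G"
  shows "\<exists>V. open V \<and> q \<in> V \<and> V \<inter> D - {q} \<subseteq> R \<union> double_points G \<eta>"
    "open W \<Longrightarrow> q \<in> W \<Longrightarrow> W \<inter> D - {q} \<noteq> {}"
proof -
  have "(\<exists>V. open V \<and> q \<in> V \<and> V \<inter> D - {q} \<subseteq> R \<union> double_points G \<eta>) \<and>
     (\<forall>W. open W \<and> q \<in> W \<longrightarrow> W \<inter> D - {q} \<noteq> {})"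
    using assms
  proof
    assume "q \<in> branch_points G"
    then obtain \<phi> where \<phi>: "branch_chart G \<phi>" "q = \<phi> 0" by (auto simp: branch_points_def)
    have "range \<phi> \<inter> D - {q} \<subseteq> R \<union> double_points G \<eta>"
    proof
      fix z assume "z \<in> range \<phi> \<inter> D - {q}"
      then obtain u where u: "z = \<phi> (umbrella u)" "z \<noteq> q" using branch_chart_D[OF \<phi>(1)] by auto
      show "z \<in> R \<union> double_points G \<eta>"
      proof (cases "u $ 1 = 0")
        case True
        have "umbrella u \<noteq> 0" using u \<phi>(2) by auto
        then have "u $ 2 \<noteq> 0" using True by (auto simp: umbrella_eq_iff)
        then show ?thesis using card_fib_2_double card_fib_branch_chart(2)[OF \<phi>(1)] True u(1) by blast
      next
        case False
        then show ?thesis using branch_chart_regular[OF \<phi>(1)] u(1) by blast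
      qed
    qed
    moreover have "W \<inter> D - {q} \<noteq> {}" if "open W" "q \<in> W" for W
    proof -
      obtain q' where q': "q' \<in> W" "card (fib q') = 2"
        using branch_accumulates[OF \<open>q \<in> branch_points G\<close> \<open>open W\<close> \<open>q \<in> W\<close>] by blast
      then have "q' \<in> D" using fib_in_D[of q'] by force
      moreover have "q' \<noteq> q" using q'(2) card_fib_branch[OF \<open>q \<in> branch_points G\<close>] by auto
      ultimately show ?thesis using q'(1) by blast
    qed
    ultimately show ?thesis
      using open_embeddingD(4)[OF branch_chart_embedding[OF \<phi>(1)]] \<phi>(2) by blast
  next
    assume "q \<in> triple_points G \<eta>"
    then obtain \<phi> where \<phi>: "triple_chart G \<eta> \<phi>" "q = \<phi> 0" by (auto simp: triple_points_def)
    then obtain h where cc: "crossing_chart G \<eta> {1, 2, 3} \<phi> h"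
      and h: "\<And>x. x $ 1 = 0 \<Longrightarrow> x $ 2 = 0 \<Longrightarrow> h 2 x < h 1 x" "\<And>x. x $ 2 = 0 \<Longrightarrow> x $ 3 = 0 \<Longrightarrow> h 3 x < h 2 x"
        "\<And>x. x $ 1 = 0 \<Longrightarrow> x $ 3 = 0 \<Longrightarrow> h 3 x < h 1 x"
      unfolding triple_chart_def by blast
    have "range \<phi> \<inter> D - {q} \<subseteq> R \<union> double_points G \<eta>"
    proof
      fix z assume "z \<in> range \<phi> \<inter> D - {q}"
      then obtain x where x: "z = \<phi> x" "\<phi> x \<in> D" "x \<noteq> 0" using \<phi>(2) by auto
      have one: "z \<in> R" if "i \<in> {1, 2, 3}" "x $ i = 0" "\<And>j. j \<in> {1, 2, 3} \<Longrightarrow> j \<noteq> i \<Longrightarrow> x $ j \<noteq> 0" for i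
        using normal_crosses_regular[OF crossing_chart_normal[OF cc that(1,2)]] that(3) x(1) by simp
      have two: "z \<in> double_points G \<eta>"
        if ij: "i \<in> {1, 2, 3}" "j \<in> {1, 2, 3}" "i \<noteq> j" "x $ i = 0" "x $ j = 0"
          and k: "\<And>k. k \<in> {1, 2, 3} \<Longrightarrow> k \<noteq> i \<Longrightarrow> k \<noteq> j \<Longrightarrow> x $ k \<noteq> 0" for i j
      proof -
        have "{i \<in> {1, 2, 3}. x $ i = 0} = {i, j}" using ij k by blast
        then have "fib z = {h i x, h j x}" using fib_crossing[OF cc, of x] x(1) by simp
        moreover have "h i x \<noteq> h j x" using ij h[of x] by auto
        ultimately show ?thesis using card_fib_2_double by simp
      qed
      have "x $ 1 \<noteq> 0 \<or> x $ 2 \<noteq> 0 \<or> x $ 3 \<noteq> 0" using x(3) by (simp add: vec3_eq_iff)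
      moreover have "x $ 1 = 0 \<or> x $ 2 = 0 \<or> x $ 3 = 0" using x(2) crossing_chart_D[OF cc, of x] by simp
      ultimately show "z \<in> R \<union> double_points G \<eta>"
        using one[of 1] one[of 2] one[of 3] two[of 1 2] two[of 1 3] two[of 2 3] by auto
    qed
    moreover have "W \<inter> D - {q} \<noteq> {}" if "open W" "q \<in> W" for W
    proof -
      have emb: "open_embedding \<phi>" by (rule crossing_chart_embedding[OF cc])
      obtain e where e: "e > 0" "\<phi> ` ball 0 e \<subseteq> W"
        using chart_ball[OF emb \<open>open W\<close>, of 0] \<open>q \<in> W\<close> \<phi>(2) by metis
      define x where "x = (e/2) *\<^sub>R (axis 3 1 :: R3)"
      have x: "x \<in> ball 0 e" "x $ 3 > 0" using small_axis[OF e(1)] unfolding x_def by blast+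
      have "x $ 1 = 0" by (simp add: x_def axis_def)
      then have "\<phi> x \<in> D" using crossing_chart_D[OF cc] by blast
      moreover have "x \<noteq> 0" using x(2) by auto
      then have "\<phi> x \<noteq> q" using \<phi>(2) open_embeddingD(2)[OF emb] by (simp add: inj_eq)
      ultimately show ?thesis using e(2) x(1) by blast
    qed
    ultimately show ?thesis
      using open_embeddingD(4)[OF crossing_chart_embedding[OF cc]] \<phi>(2) by blast
  qed
  then show "\<exists>V. open V \<and> q \<in> V \<and> V \<inter> D - {q} \<subseteq> R \<union> double_points G \<eta>"
    "open W \<Longrightarrow> q \<in> W \<Longrightarrow> W \<inter> D - {q} \<noteq> {}" by blast+
qed


section \<open>Functions on the complement are determined by their germs\<close>

lemma germ_cong:
  assumes g: "germ g q v w" and V: "open V" "q \<in> V" and eq: "\<And>z. z \<in> V - D \<Longrightarrow> f z = g z"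
  shows "germ f q v w"
proof -
  obtain c \<phi> e where c: "rhc c \<phi>" "\<phi> 0 = q" "e > 0"
    and n: "\<And>x. x \<in> ball 0 e \<Longrightarrow> x $ 3 < 0 \<Longrightarrow> g (\<phi> x) = v"
    and p: "\<And>x. x \<in> ball 0 e \<Longrightarrow> 0 < x $ 3 \<Longrightarrow> g (\<phi> x) = w"
    using g unfolding germ_def by blast
  obtain e2 where e2: "e2 > 0" "\<phi> ` ball 0 e2 \<subseteq> V"
    using chart_ball[OF rhcD(1)[OF c(1)] V(1), of 0] V(2) c(2) by blast
  have fg: "f (\<phi> x) = g (\<phi> x)" if "x \<in> ball 0 e2" "x $ 3 \<noteq> 0" for x
    using eq[of "\<phi> x"] e2(2) that rhc_D[OF c(1)] by blast
  show ?thesis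
    unfolding germ_def
  proof (intro exI conjI ballI impI)
    show "rhc c \<phi>" "\<phi> 0 = q" "0 < min e e2" using c e2 by auto
    fix x :: R3 assume x: "x \<in> ball 0 (min e e2)"
    show "f (\<phi> x) = v" if "x $ 3 < 0" using n[of x] fg[of x] x that by simp
    show "f (\<phi> x) = w" if "0 < x $ 3" using p[of x] fg[of x] x that by simp
  qed
qed

text \<open>A regular point of \<open>D\<close> at which \<open>K\<close> is accessible from one
  side. There a germ tells the value of a function that is constant on \<open>K\<close>.\<close>

definition side_in :: "R3 set \<Rightarrow> R3 set \<Rightarrow> bool" where
  "side_in W K \<longleftrightarrow> (\<exists>q c \<phi> e. q \<in> W \<and> rhc c \<phi> \<and> \<phi> 0 = q \<and> e > 0 \<and>
     (\<phi> ` (ball 0 e \<inter> {x. x $ 3 < 0}) \<subseteq> K \<or> \<phi> ` (ball 0 e \<inter> {x. 0 < x $ 3}) \<subseteq> K))"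

lemma component_subset:
  fixes C :: "R3 set"
  assumes K: "K \<in> components (W - D)" and C: "convex C" "continuous_on C \<phi>" "\<phi> ` C \<subseteq> W - D"
    and x: "x \<in> C" "\<phi> x \<in> K"
  shows "\<phi> ` C \<subseteq> K"
proof (rule components_maximal[OF K])
  show "connected (\<phi> ` C)" by (rule connected_continuous_image[OF C(2) convex_connected[OF C(1)]])
qed (use C x in auto)

lemma open_component: "open W \<Longrightarrow> K \<in> components (W - D) \<Longrightarrow> open K"
  by (meson closed_D open_Diff open_components)

lemma side_in_regular:
  assumes W: "open W" and K: "K \<in> components (W - D)" and e: "e \<in> W" "e \<in> closure K" and r: "e \<in> R"
  shows "side_in W K"
proof -
  obtain c \<phi> where c: "rhc c \<phi>" "\<phi> 0 = e" using r by (auto simp: regular_points_def)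
  note E = open_embeddingD[OF rhcD(1)[OF c(1)]]
  obtain d where d: "d > 0" "\<phi> ` ball 0 d \<subseteq> W"
    using chart_ball[OF rhcD(1)[OF c(1)] W, of 0] e(1) c(2) by blast
  have cont: "continuous_on A \<phi>" for A using E(1) continuous_on_subset by blast
  have "open (\<phi> ` ball 0 d)" "e \<in> \<phi> ` ball 0 d"
    using E(3)[OF open_ball] c(2) d(1) by (auto intro!: image_eqI[of _ _ 0])
  then have "\<phi> ` ball 0 d \<inter> K \<noteq> {}" using e(2) open_Int_closure_eq_empty by blast
  then obtain x where x: "x \<in> ball 0 d" "\<phi> x \<in> K" by blast
  have "K \<subseteq> W - D" using K in_components_subset by blast
  then have "x $ 3 \<noteq> 0" using x(2) rhc_D[OF c(1)] by blast
  then have "x $ 3 < 0 \<or> 0 < x $ 3" by auto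
  then show ?thesis
  proof
    assume "x $ 3 < 0"
    have "\<phi> ` (ball 0 d \<inter> {x. x $ 3 < 0}) \<subseteq> K"
    proof (rule component_subset[OF K _ cont])
      show "\<phi> ` (ball 0 d \<inter> {x. x $ 3 < 0}) \<subseteq> W - D" using d(2) rhc_D[OF c(1)] by auto
      show "x \<in> ball 0 d \<inter> {x. x $ 3 < 0}" "\<phi> x \<in> K" using x \<open>x $ 3 < 0\<close> by auto
    qed (intro convex_Int convex_ball convex_coord)
    then show ?thesis unfolding side_in_def using c d(1) e(1) by blast
  next
    assume "0 < x $ 3"
    have "\<phi> ` (ball 0 d \<inter> {x. 0 < x $ 3}) \<subseteq> K"
    proof (rule component_subset[OF K _ cont])
      show "\<phi> ` (ball 0 d \<inter> {x. 0 < x $ 3}) \<subseteq> W - D" using d(2) rhc_D[OF c(1)] by auto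
      show "x \<in> ball 0 d \<inter> {x. 0 < x $ 3}" "\<phi> x \<in> K" using x \<open>0 < x $ 3\<close> by auto
    qed (intro convex_Int convex_ball convex_coord)
    then show ?thesis unfolding side_in_def using c d(1) e(1) by blast
  qed
qed

text \<open>Near the double point \<open>K\<close> contains an open quadrant. Any point on the part
  of the plane \<open>x $ 1 = 0\<close> bounding this quadrant is regular and has the quadrant on
  one of its sides.\<close>

lemma side_in_double:
  assumes W: "open W" and K: "K \<in> components (W - D)" and e: "e \<in> W" "e \<in> closure K" and r: "e \<in> double_points G \<eta>"
  shows "side_in W K"
proof -
  obtain \<phi> where \<phi>: "double_chart G \<eta> \<phi>" "\<phi> 0 = e" using r by (auto simp: double_points_def)
  then obtain h where cc: "crossing_chart G \<eta> {1, 2} \<phi> h" unfolding double_chart_def by blast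
  have emb: "open_embedding \<phi>" using crossing_chart_embedding[OF cc] .
  note E = open_embeddingD[OF emb]
  have inj: "\<phi> x = \<phi> y \<longleftrightarrow> x = y" for x y using E(2) by (simp add: inj_eq)
  obtain d where d: "d > 0" "\<phi> ` ball 0 d \<subseteq> W"
    using chart_ball[OF emb W, of 0] e(1) \<phi>(2) by blast
  have cont: "continuous_on A \<phi>" for A using E(1) continuous_on_subset by blast
  have "open (\<phi> ` ball 0 d)" "e \<in> \<phi> ` ball 0 d"
    using E(3)[OF open_ball] \<phi>(2) d(1) by (auto intro!: image_eqI[of _ _ 0])
  then have "\<phi> ` ball 0 d \<inter> K \<noteq> {}" using e(2) open_Int_closure_eq_empty by blast
  then obtain y where y: "y \<in> ball 0 d" "\<phi> y \<in> K" by blast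
  have KW: "K \<subseteq> W - D" using K in_components_subset by blast
  then have y0: "y $ 1 \<noteq> 0" "y $ 2 \<noteq> 0" using y(2) crossing_chart_D[OF cc] by blast+
  define Q where "Q = ball 0 d \<inter> {z::R3. \<forall>j\<in>{1, 2}. 0 < z $ j * y $ j}"
  have QK: "\<phi> ` Q \<subseteq> K"
  proof (rule component_subset[OF K _ cont])
    show "convex Q" unfolding Q_def by (intro convex_Int convex_ball convex_orthant)
    show "\<phi> ` Q \<subseteq> W - D" using d(2) crossing_chart_D[OF cc] unfolding Q_def by fastforce
    show "y \<in> Q" using y(1) y0 by (auto simp: Q_def zero_less_mult_iff)
  qed (rule y(2))
  \<comment> \<open>Projection of \<open>y\<close> to the wall of its quadrant; the norm does not
    grow, so the point stays in the ball.\<close>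
  define x :: R3 where "x = vector [0, y $ 2, y $ 3]"
  have "norm x \<le> norm y" by (simp add: x_def norm3)
  then have x: "x \<in> ball 0 d" "x $ 1 = 0" "x $ 2 = y $ 2" using y(1) by (auto simp: x_def)
  have "normal_crosses G \<eta> (\<phi> x) (\<phi> ` {z. z $ 1 < 0}) (\<phi> ` {z. 0 < z $ 1})"
    by (rule crossing_chart_normal[OF cc]) (use x y0 in auto)
  then obtain c \<psi> where c: "rhc c \<psi>" "\<psi> 0 = \<phi> x" "\<psi> ` {x. x $ 3 < 0} \<subseteq> \<phi> ` {z. z $ 1 < 0}"
    "\<psi> ` {x. 0 < x $ 3} \<subseteq> \<phi> ` {z. 0 < z $ 1}"
    unfolding normal_crosses_def by blast
  define V where "V = \<phi> ` (ball 0 d \<inter> {z. 0 < z $ 2 * y $ 2})"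
  have "open V" unfolding V_def
    by (intro E(3) open_Int open_ball open_Collect_less continuous_intros)
  moreover have "x \<in> ball 0 d \<inter> {z. 0 < z $ 2 * y $ 2}" using x y0 by (auto simp: zero_less_mult_iff)
  then have "\<psi> 0 \<in> V" using c(2) by (simp add: V_def)
  ultimately obtain d' where d': "d' > 0" "\<psi> ` ball 0 d' \<subseteq> V"
    using chart_ball[OF rhcD(1)[OF c(1)]] by blast
  have "\<psi> 0 \<in> W" using c(2) d(2) x(1) by auto
  have "y $ 1 < 0 \<or> 0 < y $ 1" using y0 by auto
  then have "\<psi> ` (ball 0 d' \<inter> {x. x $ 3 < 0}) \<subseteq> K \<or> \<psi> ` (ball 0 d' \<inter> {x. 0 < x $ 3}) \<subseteq> K"
  proof
    assume y1: "y $ 1 < 0"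
    have "\<psi> ` (ball 0 d' \<inter> {x. x $ 3 < 0}) \<subseteq> \<phi> ` Q"
    proof
      fix p assume "p \<in> \<psi> ` (ball 0 d' \<inter> {x. x $ 3 < 0})"
      then have "p \<in> V" "p \<in> \<phi> ` {z. z $ 1 < 0}" using d'(2) c(3) by blast+
      then obtain z where "p = \<phi> z" "z $ 1 < 0" "z \<in> ball 0 d" "0 < z $ 2 * y $ 2"
        by (auto simp: V_def inj)
      then show "p \<in> \<phi> ` Q" using y1 by (auto simp: Q_def mult_neg_neg)
    qed
    then show ?thesis using QK by blast
  next
    assume y1: "0 < y $ 1"
    have "\<psi> ` (ball 0 d' \<inter> {x. 0 < x $ 3}) \<subseteq> \<phi> ` Q"
    proof
      fix p assume "p \<in> \<psi> ` (ball 0 d' \<inter> {x. 0 < x $ 3})"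
      then have "p \<in> V" "p \<in> \<phi> ` {z. 0 < z $ 1}" using d'(2) c(4) by blast+
      then obtain z where "p = \<phi> z" "0 < z $ 1" "z \<in> ball 0 d" "0 < z $ 2 * y $ 2"
        by (auto simp: V_def inj)
      then show "p \<in> \<phi> ` Q" using y1 by (auto simp: Q_def)
    qed
    then show ?thesis using QK by blast
  qed
  then show ?thesis unfolding side_in_def using c(1) d'(1) \<open>\<psi> 0 \<in> W\<close> by blast
qed

text \<open>At a triple or branch point \<open>e\<close>, a small punctured ball is connected. If
  the closure of \<open>K\<close> met \<open>D\<close> in no other point of the ball,
  \<open>K\<close> would fill the punctured ball, although \<open>D\<close> accumulates at
  \<open>e\<close>.\<close>

lemma side_in_component:
  assumes W: "open W" and K: "K \<in> components (W - D)" and e: "e \<in> W" "e \<in> D" "e \<in> closure K"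
  shows "side_in W K"
proof (cases "e \<in> R \<union> double_points G \<eta>")
  case True
  then show ?thesis using side_in_regular[OF W K e(1,3)] side_in_double[OF W K e(1,3)] by blast
next
  case False
  then have sp: "e \<in> triple_points G \<eta> \<or> e \<in> branch_points G" using e(2) D_cases by blast
  then obtain V where V: "open V" "e \<in> V" "V \<inter> D - {e} \<subseteq> R \<union> double_points G \<eta>"
    using isolated_points(1) by blast
  have "open (V \<inter> W)" "e \<in> V \<inter> W" using V W e by auto
  then obtain d where d: "d > 0" "ball e d \<subseteq> V \<inter> W" using open_contains_ball by blast
  define P where "P = ball e d - {e}"
  have cP: "connected P" unfolding P_def by (rule connected_punctured_ball) simp
  have oP: "open P" unfolding P_def by auto
  have KW: "K \<subseteq> W - D" using K in_components_subset by blast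
  have "\<exists>e2\<in>closure K \<inter> D. e2 \<in> P"
  proof (rule ccontr)
    assume no: "\<not> ?thesis"
    have "closure K \<inter> (W - D) \<subseteq> K"
    proof -
      obtain T where T: "closed T" "K = (W - D) \<inter> T"
        using closedin_component[OF K] by (auto simp: closedin_closed)
      then have "closure K \<subseteq> T" by (simp add: closure_minimal)
      then show ?thesis using T(2) by blast
    qed
    then have "P \<inter> closure K = P \<inter> K" using no d(2) closure_subset[of K] unfolding P_def by blast
    then have "closedin (top_of_set P) (P \<inter> K)" by (metis closed_closure closedin_closed_Int)
    moreover have "openin (top_of_set P) (P \<inter> K)" using open_component[OF W K] by (simp add: openin_open_Int)
    moreover have "P \<inter> K \<noteq> {}"
    proof -
      have "e \<in> ball e d \<inter> closure K" using e(3) d(1) by simp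
      then have "ball e d \<inter> K \<noteq> {}" using open_Int_closure_eq_empty[OF open_ball, of e d K] by blast
      then show ?thesis using KW e(2) by (auto simp: P_def)
    qed
    ultimately have "P \<inter> K = P" using cP by (auto simp: connected_clopen)
    then have "ball e d \<inter> D - {e} = {}" using KW unfolding P_def by blast
    then show False using isolated_points(2)[OF sp open_ball] d(1) by simp
  qed
  then obtain e2 where e2: "e2 \<in> closure K" "e2 \<in> D" "e2 \<in> P" by blast
  then have "e2 \<in> W" "e2 \<in> R \<union> double_points G \<eta>" using d(2) V(3) unfolding P_def by blast+
  then show ?thesis using side_in_regular[OF W K _ e2(1)] side_in_double[OF W K _ e2(1)] by blast
qed

lemma side_in_component_connected:
  assumes "open W" "connected W" "W \<inter> D \<noteq> {}" "K \<in> components (W - D)"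
  shows "side_in W K"
proof -
  obtain e where "e \<in> W" "e \<in> D" "e \<in> closure K"
    by (rule component_touches[OF closed_D assms]) (rule that)
  then show ?thesis by (rule side_in_component[OF assms(1,4)])
qed

text \<open>Every component of \<open>W - D\<close> has a side at some regular point, and there the
  common germ fixes the values of both functions. This serves the gluing of local sections as well
  as the injectivity of the correspondence of colorings.\<close>

lemma germ_determines:
  assumes W: "open W" "connected W" "W \<inter> D \<noteq> {}"
    and f: "connected_constant f (W - D)" and g: "connected_constant g (W - D)"
    and q: "\<And>q. q \<in> W \<inter> R \<Longrightarrow> \<exists>v w. germ f q v w \<and> germ g q v w"
    and z: "z \<in> W - D"
  shows "f z = g z"
proof -
  obtain K where K: "K \<in> components (W - D)" "z \<in> K" using z by (metis UnionE Union_components)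
  then have KW: "K \<subseteq> W - D" "connected K" using in_components_subset in_components_connected by blast+
  obtain q c \<phi> e where c: "q \<in> W" "rhc c \<phi>" "\<phi> 0 = q" "e > 0"
     "\<phi> ` (ball 0 e \<inter> {x. x $ 3 < 0}) \<subseteq> K \<or> \<phi> ` (ball 0 e \<inter> {x. 0 < x $ 3}) \<subseteq> K"
    using side_in_component_connected[OF W K(1)] unfolding side_in_def by blast
  have "q \<in> R" using c by (auto simp: regular_points_def)
  then obtain v w where vw: "germ f q v w" "germ g q v w" using q c(1) by blast
  obtain e1 where e1: "e1 > 0" "\<And>x. x \<in> ball 0 e1 \<Longrightarrow> x $ 3 < 0 \<Longrightarrow> f (\<phi> x) = v"
    "\<And>x. x \<in> ball 0 e1 \<Longrightarrow> 0 < x $ 3 \<Longrightarrow> f (\<phi> x) = w"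
    using germ_chart[OF vw(1) c(2,3)] by blast
  obtain e2 where e2: "e2 > 0" "\<And>x. x \<in> ball 0 e2 \<Longrightarrow> x $ 3 < 0 \<Longrightarrow> g (\<phi> x) = v"
    "\<And>x. x \<in> ball 0 e2 \<Longrightarrow> 0 < x $ 3 \<Longrightarrow> g (\<phi> x) = w"
    using germ_chart[OF vw(2) c(2,3)] by blast
  define d where "d = min e (min e1 e2)"
  have d: "d > 0" "d \<le> e" "d \<le> e1" "d \<le> e2" using c e1 e2 by (auto simp: d_def)
  define x where "x = (d/2) *\<^sub>R (axis 3 1 :: R3)"
  have x: "x \<in> ball 0 d" "- x \<in> ball 0 d" "x $ 3 > 0" "(- x) $ 3 < 0"
    using small_axis[OF d(1)] unfolding x_def by blast+
  have mem: "- x \<in> ball 0 e \<inter> {x. x $ 3 < 0}" "x \<in> ball 0 e \<inter> {x. 0 < x $ 3}" using x d(2) by auto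
  have "f (\<phi> (- x)) = g (\<phi> (- x))" "f (\<phi> x) = g (\<phi> x)"
    using e1(2)[of "- x"] e1(3)[of x] e2(2)[of "- x"] e2(3)[of x] x d(3,4) by simp_all
  then have "\<exists>y\<in>K. f y = g y" using c(5) mem by blast
  then obtain y where "y \<in> K" "f y = g y" by blast
  then show ?thesis using connected_constantD[OF f KW(2,1) K(2)] connected_constantD[OF g KW(2,1) K(2)] by simp
qed

end

section \<open>Region colorings near a point of the diagram\<close>

context diagram
begin

lemma crossing_constant_on:
  assumes cc: "crossing_chart G \<eta> I \<phi> h" and B: "convex B" and f: "connected_constant f (\<phi> ` B - D)"
    and mem: "y \<in> B" "z \<in> B" and yz: "\<And>j. j \<in> I \<Longrightarrow> 0 < y $ j * z $ j"
  shows "f (\<phi> y) = f (\<phi> z)"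
proof -
  define K where "K = B \<inter> {x::R3. \<forall>j\<in>I. 0 < x $ j * z $ j}"
  have "convex K" unfolding K_def by (intro convex_Int B convex_orthant)
  moreover have "continuous_on K \<phi>"
    by (rule continuous_on_subset[OF open_embeddingD(1)[OF crossing_chart_embedding[OF cc]]]) simp
  ultimately have "connected (\<phi> ` K)" by (intro connected_continuous_image convex_connected)
  moreover have "\<phi> ` K \<subseteq> \<phi> ` B - D"
    using crossing_chart_D[OF cc] by (fastforce simp: K_def)
  moreover have "y \<in> K" using yz mem by (simp add: K_def)
  moreover have "z \<in> K" using yz mem by (fastforce simp: K_def zero_less_mult_iff)
  ultimately show ?thesis using connected_constantD[OF f] by blast
qed

text \<open>The set \<open>B\<close> may be a small ball instead of the whole chart: at triple
  points it is applied to a section defined only near a double point of the chart.\<close>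

lemma crossing_germ_on:
  assumes cc: "crossing_chart G \<eta> I \<phi> h" and B: "convex B" "open B" and f: "connected_constant f (\<phi> ` B - D)"
    and i: "i \<in> I" "x $ i = 0" and nz: "\<And>j. j \<in> I - {i} \<Longrightarrow> x $ j \<noteq> 0"
    and x: "x \<in> B" and t: "t > 0" "x - axis i t \<in> B" "x + axis i t \<in> B"
  shows "germ f (\<phi> x) (f (\<phi> (x - axis i t))) (f (\<phi> (x + axis i t)))"
proof (rule germ_normal[OF crossing_chart_normal[OF cc i nz]])
  define V where "V = B \<inter> {y::R3. \<forall>j\<in>I - {i}. 0 < y $ j * x $ j}"
  have emb: "open_embedding \<phi>" using crossing_chart_embedding[OF cc] .
  have inj: "\<phi> x = \<phi> y \<longleftrightarrow> x = y" for x y using open_embeddingD(2)[OF emb] by (simp add: inj_eq)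
  show "open (\<phi> ` V)" unfolding V_def by (intro open_embeddingD(3)[OF emb] open_Int B open_orthant)
  have "x \<in> V" using nz x by (auto simp: V_def zero_less_mult_iff) (meson linorder_neqE_linordered_idom)
  then show "\<phi> x \<in> \<phi> ` V" by blast
  have ax: "(x - axis i t) $ j = (if j = i then - t else x $ j)" "(x + axis i t) $ j = (if j = i then t else x $ j)" for j
    using i(2) by (auto simp: axis_def)
  show "f z = f (\<phi> (x - axis i t))" if z: "z \<in> \<phi> ` {y. y $ i < 0} \<inter> \<phi> ` V - D" for z
  proof -
    obtain y where y: "z = \<phi> y" "y $ i < 0" "y \<in> V" using z inj by auto
    have "0 < y $ j * (x - axis i t) $ j" if "j \<in> I" for j
      unfolding ax using y that t(1) by (auto simp: V_def mult_neg_neg mult_pos_neg mult_neg_pos)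
    then show ?thesis using crossing_constant_on[OF cc B(1) f, of y "x - axis i t"] y t(2)
      by (simp add: V_def)
  qed
  show "f z = f (\<phi> (x + axis i t))" if z: "z \<in> \<phi> ` {y. 0 < y $ i} \<inter> \<phi> ` V - D" for z
  proof -
    obtain y where y: "z = \<phi> y" "0 < y $ i" "y \<in> V" using z inj by auto
    have "0 < y $ j * (x + axis i t) $ j" if "j \<in> I" for j
      unfolding ax using y that t(1) by (auto simp: V_def)
    then show ?thesis using crossing_constant_on[OF cc B(1) f, of y "x + axis i t"] y t(3)
      by (simp add: V_def)
  qed
qed

abbreviation sheet :: "R3 \<Rightarrow> R3 set" where "sheet \<equiv> sheet_at G \<eta>"

lemma sheet_eq: "connected A \<Longrightarrow> A \<subseteq> R \<Longrightarrow> x \<in> A \<Longrightarrow> y \<in> A \<Longrightarrow> sheet x = sheet y"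
  unfolding sheet_at_def
proof (rule connected_component_eq)
  assume "connected A" "A \<subseteq> R" "x \<in> A" "y \<in> A"
  then show "x \<in> connected_component_set R y" unfolding mem_Collect_eq connected_component_def by blast
qed

lemma crossing_face:
  assumes cc: "crossing_chart G \<eta> I \<phi> h" and i: "i \<in> I" "x $ i = 0" "y $ i = 0"
    and xy: "\<And>j. j \<in> I - {i} \<Longrightarrow> 0 < x $ j * y $ j"
  shows "sheet (\<phi> x) = sheet (\<phi> y)" "\<phi> x \<in> R"
proof -
  define A where "A = {z::R3. \<forall>j\<in>I - {i}. 0 < z $ j * y $ j} \<inter> {z. z $ i = 0}"
  have "convex {z::R3. z $ i = 0}"
    using convex_hyperplane[of "axis i (1::real) :: R3" 0] by (simp add: inner_axis')
  then have "convex A" unfolding A_def by (intro convex_Int convex_orthant)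
  moreover have "continuous_on A \<phi>"
    by (rule continuous_on_subset[OF open_embeddingD(1)[OF crossing_chart_embedding[OF cc]]]) simp
  ultimately have "connected (\<phi> ` A)" by (intro connected_continuous_image convex_connected)
  moreover have A: "\<phi> ` A \<subseteq> R"
  proof
    fix q assume "q \<in> \<phi> ` A"
    then obtain z where z: "q = \<phi> z" "z $ i = 0" "\<And>j. j \<in> I - {i} \<Longrightarrow> 0 < z $ j * y $ j"
      by (auto simp: A_def)
    have "z $ j \<noteq> 0" if "j \<in> I - {i}" for j using z(3)[OF that] by auto
    then show "q \<in> R" using normal_crosses_regular[OF crossing_chart_normal[OF cc i(1) z(2)]] z(1) by blast
  qed
  moreover have x: "x \<in> A" using xy i by (simp add: A_def)
  moreover have "y \<in> A" using xy i by (fastforce simp: A_def zero_less_mult_iff)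
  ultimately show "sheet (\<phi> x) = sheet (\<phi> y)" by (intro sheet_eq) auto
  show "\<phi> x \<in> R" using A x by blast
qed

lemma sign_function_connected_constant:
  assumes cc: "crossing_chart G \<eta> I \<phi> h"
    and F: "\<And>s t. (\<And>i. i \<in> I \<Longrightarrow> s i = t i) \<Longrightarrow> F s = F t"
    and f: "\<And>x. f (\<phi> x) = F (\<lambda>i. 0 < x $ i)"
  shows "connected_constant f (range \<phi> - D)"
proof (rule connected_constantI)
  fix z assume "z \<in> range \<phi> - D"
  then obtain x where x: "z = \<phi> x" "\<And>i. i \<in> I \<Longrightarrow> x $ i \<noteq> 0" using crossing_chart_D[OF cc] by blast
  define V where "V = {y::R3. \<forall>j\<in>I. 0 < y $ j * x $ j}"
  have "open (\<phi> ` V)" unfolding V_def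
    by (intro open_embeddingD(3)[OF crossing_chart_embedding[OF cc]] open_orthant)
  moreover have "x \<in> V" using x(2) by (auto simp: V_def zero_less_mult_iff) (meson linorder_neqE_linordered_idom)
  moreover have fV: "f (\<phi> y) = f (\<phi> x)" if "y \<in> V" for y
    unfolding f by (rule F) (use that in \<open>fastforce simp: V_def zero_less_mult_iff\<close>)
  moreover have "\<forall>y\<in>\<phi> ` V. f y = f z" unfolding x(1) using fV by blast
  ultimately show "\<exists>V. open V \<and> z \<in> V \<and> (\<forall>y\<in>V \<inter> (range \<phi> - D). f y = f z)"
    unfolding x(1) by blast
qed

text \<open>A solution over \<open>U\<close> of the problem to find region colors that induce the
  sheet colors \<open>C\<close>.\<close>

definition local_section :: "(R3 set \<Rightarrow> 'v \<times> 'v) \<Rightarrow> R3 set \<Rightarrow> (R3 \<Rightarrow> 'v) \<Rightarrow> bool" where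
  "local_section C U f \<longleftrightarrow> open U \<and> connected_constant f (U - D) \<and>
     (\<forall>q\<in>U \<inter> R. germ f q (fst (C (sheet q))) (snd (C (sheet q))))"

text \<open>The only consequence of the local biquandle rules that matters for the existence of region
  colors: at a double point the two sheets prescribe the same colors for the four quadrants.\<close>

definition consistent :: "(R3 set \<Rightarrow> 'v \<times> 'v) \<Rightarrow> bool" where
  "consistent C \<longleftrightarrow> (\<forall>\<phi>. double_chart G \<eta> \<phi> \<longrightarrow>
     fst (C (sheet_u1 G \<eta> \<phi>)) = fst (C (sheet_o1 G \<eta> \<phi>)) \<and>
     fst (C (sheet_u2 G \<eta> \<phi>)) = snd (C (sheet_o1 G \<eta> \<phi>)) \<and>
     fst (C (sheet_o2 G \<eta> \<phi>)) = snd (C (sheet_u1 G \<eta> \<phi>)) \<and>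
     snd (C (sheet_u2 G \<eta> \<phi>)) = snd (C (sheet_o2 G \<eta> \<phi>)))"

lemma local_section_subset: "local_section C U f \<Longrightarrow> open V \<Longrightarrow> V \<subseteq> U \<Longrightarrow> local_section C V f"
  unfolding local_section_def by (auto intro: connected_constant_subset)

lemma germ_rhc:
  assumes "rhc c \<phi>" "\<phi> 0 = q"
    and "\<And>x. x $ 3 < 0 \<Longrightarrow> f (\<phi> x) = v" "\<And>x. 0 < x $ 3 \<Longrightarrow> f (\<phi> x) = w"
  shows "germ f q v w"
  unfolding germ_def
proof (intro exI conjI ballI impI)
  show "rhc c \<phi>" "\<phi> 0 = q" "(0::real) < 1" using assms by auto
qed (use assms in auto)

lemma local_section_regular:
  assumes q: "q \<in> R"
  shows "\<exists>U f. q \<in> U \<and> local_section C U f"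
proof -
  obtain c \<phi> where c: "rhc c \<phi>" "\<phi> 0 = q" using q by (auto simp: regular_points_def)
  note E = open_embeddingD[OF rhcD(1)[OF c(1)]]
  define f where "f z = (if inv_into UNIV \<phi> z $ 3 < 0 then fst (C (sheet q)) else snd (C (sheet q)))" for z
  have f: "f (\<phi> x) = (if x $ 3 < 0 then fst (C (sheet q)) else snd (C (sheet q)))" for x
    using E(2) by (simp add: f_def)
  have fc: "connected_constant f (range \<phi> - D)"
  proof (rule connected_constantI)
    fix z assume "z \<in> range \<phi> - D"
    then obtain x where x: "z = \<phi> x" "x $ 3 \<noteq> 0" using rhc_D[OF c(1)] by blast
    define V where "V = {y::R3. 0 < y $ 3 * x $ 3}"
    have "open (\<phi> ` V)" unfolding V_def by (intro E(3) open_Collect_less continuous_intros)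
    moreover have "x \<in> V" using x(2) by (auto simp: V_def zero_less_mult_iff)
    moreover have fV: "f (\<phi> y) = f (\<phi> x)" if "y \<in> V" for y
      unfolding f using that by (auto simp: V_def zero_less_mult_iff)
    moreover have "\<forall>y\<in>\<phi> ` V. f y = f z" unfolding x(1) using fV by blast
    ultimately show "\<exists>V. open V \<and> z \<in> V \<and> (\<forall>y\<in>V \<inter> (range \<phi> - D). f y = f z)"
      unfolding x(1) by blast
  qed
  \<comment> \<open>The whole plane of the chart is connected and regular, so it lies in one
    semi-sheet; one germ at \<open>q\<close> therefore settles all points of it.\<close>
  define A where "A = \<phi> ` range emb"
  have "continuous_on UNIV (\<lambda>u. \<phi> (emb u))"
    by (rule continuous_on_compose2[OF E(1)]) (auto intro!: continuous_intros)
  then have "connected ((\<lambda>u. \<phi> (emb u)) ` UNIV)" by (rule connected_continuous_image[OF _ convex_connected[OF convex_UNIV]])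
  then have A1: "connected A" by (simp add: A_def image_image)
  have A2: "A \<subseteq> R"
  proof
    fix z assume "z \<in> A"
    then obtain u where u: "z = \<phi> (emb u)" by (auto simp: A_def)
    have "rhc (\<lambda>v. c (v + u)) (\<lambda>x. \<phi> (x + emb u))" by (rule rhc_shift[OF c(1)])
    then show "z \<in> R" unfolding regular_points_def mem_Collect_eq u
      by (intro exI[of _ "\<lambda>v. c (v + u)"] exI[of _ "\<lambda>x. \<phi> (x + emb u)"]) simp
  qed
  have "0 = emb 0" by (simp add: vec3_eq_iff)
  then have qA: "q \<in> A" using c(2) unfolding A_def by blast
  have A3: "q' \<in> A" if q': "q' \<in> range \<phi> \<inter> R" for q'
  proof -
    obtain x where x: "q' = \<phi> x" using q' by blast
    have "\<phi> x \<in> D" using q' x regular_subset_D by auto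
    then have "x $ 3 = 0" using rhc_D[OF c(1)] by simp
    then have "x = emb (pr x)" by (simp add: vec3_eq_iff pr_def)
    then show ?thesis using x unfolding A_def by blast
  qed
  have g: "germ f q (fst (C (sheet q))) (snd (C (sheet q)))"
    by (rule germ_rhc[OF c]) (simp_all add: f)
  have "germ f q' (fst (C (sheet q'))) (snd (C (sheet q')))" if "q' \<in> range \<phi> \<inter> R" for q'
  proof -
    have "q' \<in> A" by (rule A3[OF that])
    moreover have "A \<subseteq> range \<phi>" by (auto simp: A_def)
    ultimately have "germ f q' (fst (C (sheet q))) (snd (C (sheet q)))"
      by (intro germ_propagate[OF A1 A2 E(4) _ fc qA g])
    moreover have "sheet q' = sheet q" using sheet_eq[OF A1 A2 \<open>q' \<in> A\<close> qA] .
    ultimately show ?thesis by simp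
  qed
  then have "local_section C (range \<phi>) f" unfolding local_section_def using E(4) fc by blast
  moreover have "q \<in> range \<phi>" using c(2) by blast
  ultimately show ?thesis by blast
qed

lemma local_section_double:
  assumes C: "consistent C" and q: "q \<in> double_points G \<eta>"
  shows "\<exists>U f. q \<in> U \<and> local_section C U f"
proof -
  obtain \<phi> where \<phi>: "double_chart G \<eta> \<phi>" "\<phi> 0 = q" using q by (auto simp: double_points_def)
  then obtain h where cc: "crossing_chart G \<eta> {1, 2} \<phi> h" unfolding double_chart_def by blast
  note E = open_embeddingD[OF crossing_chart_embedding[OF cc]]
  define u1 u2 o1 o2 where "u1 = C (sheet_u1 G \<eta> \<phi>)" and "u2 = C (sheet_u2 G \<eta> \<phi>)"
    and "o1 = C (sheet_o1 G \<eta> \<phi>)" and "o2 = C (sheet_o2 G \<eta> \<phi>)"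
  have fl: "fst u1 = fst o1" "fst u2 = snd o1" "fst o2 = snd u1" "snd u2 = snd o2"
    using C \<phi>(1) unfolding consistent_def u1_def u2_def o1_def o2_def by blast+
  \<comment> \<open>The colors of the four quadrants are read off from the two halves of the
    under-sheet alone; the equations \<open>fl\<close> show that they also fit the
    over-sheet.\<close>
  define F where "F s = (if s 1 then (if s 2 then snd u2 else fst u2) else (if s 2 then snd u1 else fst u1))" for s :: "3 \<Rightarrow> bool"
  define f where "f z = F (\<lambda>i. 0 < inv_into UNIV \<phi> z $ i)" for z
  have f: "f (\<phi> x) = F (\<lambda>i. 0 < x $ i)" for x using E(2) by (simp add: f_def)
  have fc: "connected_constant f (range \<phi> - D)"
    by (rule sign_function_connected_constant[where F = F and f = f, OF cc _ f]) (simp add: F_def)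
  have "germ f q' (fst (C (sheet q'))) (snd (C (sheet q')))" if q': "q' \<in> range \<phi> \<inter> R" for q'
  proof -
    obtain x where x: "q' = \<phi> x" using q' by blast
    have "\<phi> x \<in> D" using q' x regular_subset_D by auto
    then have "x $ 1 = 0 \<or> x $ 2 = 0" using crossing_chart_D[OF cc, of x] by simp
    moreover have "\<not> (x $ 1 = 0 \<and> x $ 2 = 0)"
      using card_fib_double_chart[OF \<phi>(1), of x] card_fib_regular[of q'] q' x by auto
    ultimately consider (o) "x $ 1 = 0" "x $ 2 \<noteq> 0" | (u) "x $ 2 = 0" "x $ 1 \<noteq> 0" by blast
    then show ?thesis
    proof cases
      case o
      have g: "germ f q' (f (\<phi> (x - axis 1 1))) (f (\<phi> (x + axis 1 1)))"
        unfolding x by (rule crossing_germ_on[OF cc convex_UNIV open_UNIV fc]) (use o in auto)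
      have ax: "(x - axis 1 1) $ 1 = -1" "(x + axis 1 1) $ 1 = 1" "(x - axis 1 1) $ 2 = x $ 2" "(x + axis 1 1) $ 2 = x $ 2"
        using o by (simp_all add: axis_def)
      show ?thesis
      proof (cases "x $ 2 < 0")
        case True
        have "sheet q' = sheet_o1 G \<eta> \<phi>" unfolding sheet_o1_def x
          by (rule crossing_face(1)[OF cc, of 1]) (use o True in auto)
        then show ?thesis using g[unfolded f F_def ax] fl True by (simp add: o1_def)
      next
        case False
        have "sheet q' = sheet_o2 G \<eta> \<phi>" unfolding sheet_o2_def x
          by (rule crossing_face(1)[OF cc, of 1]) (use o False in auto)
        then show ?thesis using g[unfolded f F_def ax] fl False o by (simp add: o2_def)
      qed
    next
      case u
      have g: "germ f q' (f (\<phi> (x - axis 2 1))) (f (\<phi> (x + axis 2 1)))"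
        unfolding x by (rule crossing_germ_on[OF cc convex_UNIV open_UNIV fc]) (use u in auto)
      have ax: "(x - axis 2 1) $ 2 = -1" "(x + axis 2 1) $ 2 = 1" "(x - axis 2 1) $ 1 = x $ 1" "(x + axis 2 1) $ 1 = x $ 1"
        using u by (simp_all add: axis_def)
      show ?thesis
      proof (cases "x $ 1 < 0")
        case True
        have "sheet q' = sheet_u1 G \<eta> \<phi>" unfolding sheet_u1_def x
          by (rule crossing_face(1)[OF cc, of 2]) (use u True in auto)
        then show ?thesis using g[unfolded f F_def ax] True by (simp add: u1_def)
      next
        case False
        have "sheet q' = sheet_u2 G \<eta> \<phi>" unfolding sheet_u2_def x
          by (rule crossing_face(1)[OF cc, of 2]) (use u False in auto)
        then show ?thesis using g[unfolded f F_def ax] False u by (simp add: u2_def)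
      qed
    qed
  qed
  then have "local_section C (range \<phi>) f" unfolding local_section_def using E(4) fc by blast
  moreover have "q \<in> range \<phi>" using \<phi>(2) by blast
  ultimately show ?thesis by blast
qed

end

section \<open>Triple points\<close>

lemma third_index: "i \<noteq> j \<Longrightarrow> \<exists>k::3. k \<noteq> i \<and> k \<noteq> j \<and> (\<forall>l. l = i \<or> l = j \<or> l = k)"
proof (rule ccontr)
  assume ij: "i \<noteq> j" and no: "\<not> (\<exists>k::3. k \<noteq> i \<and> k \<noteq> j \<and> (\<forall>l. l = i \<or> l = j \<or> l = k))"
  then show False using exhaust_3[of i] exhaust_3[of j] unfolding not_ex forall_3 by (elim disjE) simp_all
qed

context diagram
begin

text \<open>Each of the three faces of an octant proposes a color for it. Two faces meet along an
  edge of double points, where a local section is already available and forces the two proposals to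
  coincide.\<close>

lemma local_section_triple:
  assumes C: "consistent C" and q: "q \<in> triple_points G \<eta>"
  shows "\<exists>U f. q \<in> U \<and> local_section C U f"
proof -
  obtain \<phi> where \<phi>: "triple_chart G \<eta> \<phi>" "\<phi> 0 = q" using q by (auto simp: triple_points_def)
  then obtain h where cc: "crossing_chart G \<eta> {1, 2, 3} \<phi> h"
      and h: "\<And>x. x $ 1 = 0 \<Longrightarrow> x $ 2 = 0 \<Longrightarrow> h 2 x < h 1 x" "\<And>x. x $ 2 = 0 \<Longrightarrow> x $ 3 = 0 \<Longrightarrow> h 3 x < h 2 x"
        "\<And>x. x $ 1 = 0 \<Longrightarrow> x $ 3 = 0 \<Longrightarrow> h 3 x < h 1 x"
    unfolding triple_chart_def by blast
  have I: "{1, 2, 3} = (UNIV :: 3 set)" using exhaust_3 by auto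
  note cc = cc[unfolded I]
  note emb = crossing_chart_embedding[OF cc]
  note E = open_embeddingD[OF emb]
  have hne: "h i x \<noteq> h j x" if "i \<noteq> j" "x $ i = 0" "x $ j = 0" for i j x
    using that h[of x] exhaust_3[of i] exhaust_3[of j] by auto
  define sg where "sg b = (if b then 1 else -1 :: real)" for b
  have sg: "sg b \<noteq> 0" "0 < sg b * sg b" "0 < sg b \<longleftrightarrow> b" "sg b < 0 \<longleftrightarrow> \<not> b" "\<bar>sg b\<bar> = 1" for b
    by (auto simp: sg_def)
  \<comment> \<open>\<open>s\<close> encodes an octant by its positive coordinates;
    \<open>fp i s\<close> is a point on its \<open>i\<close>-th face, and \<open>col i s\<close> is
    the color proposed by that face, on the side on which the octant lies.\<close>
  define fp :: "3 \<Rightarrow> (3 \<Rightarrow> bool) \<Rightarrow> R3" where "fp i s = (\<chi> j. if j = i then 0 else sg (s j))" for i s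
  define col where "col i s = (if s i then snd else fst) (C (sheet (\<phi> (fp i s))))" for i s
  have col: "col i s = col j s" if ij: "i \<noteq> j" for i j s
  proof -
    obtain k where k: "k \<noteq> i" "k \<noteq> j" and all: "\<And>l. l = i \<or> l = j \<or> l = k"
      using third_index[OF ij] by blast
    \<comment> \<open>A point on the edge shared by the faces \<open>i\<close> and \<open>j\<close>
      of the octant. Its fibre has two elements, so it is a double point.\<close>
    define a :: R3 where "a = axis k (sg (s k))"
    have ai: "a $ i = 0" "a $ j = 0" "a $ k = sg (s k)" using k by (auto simp: a_def axis_def)
    have "l = i \<or> l = j" if "a $ l = 0" for l using all[of l] ai(3) sg(1) that by auto
    then have "{l \<in> UNIV. a $ l = 0} = {i, j}" using ai(1,2) by blast
    then have "fib (\<phi> a) = {h i a, h j a}" using fib_crossing[OF cc, of a] by simp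
    then have "card (fib (\<phi> a)) = 2" using hne[OF ij ai(1,2)] by simp
    then obtain U g where U: "\<phi> a \<in> U" "local_section C U g" using local_section_double[OF C card_fib_2_double] by blast
    then have "open U" by (simp add: local_section_def)
    then obtain e where e: "e > 0" "\<phi> ` ball a e \<subseteq> U" using chart_ball[OF emb _ U(1)] by blast
    have "connected_constant g (U - D)" using U(2) by (simp add: local_section_def)
    then have gc: "connected_constant g (\<phi> ` ball a e - D)" by (rule connected_constant_subset) (use e(2) in blast)
    \<comment> \<open>All points used below differ from \<open>a\<close> by at most two steps of
      length \<open>t\<close>, and \<open>2 * t\<close> is less than \<open>e\<close>.\<close>
    define t where "t = e / 4"
    have t: "t > 0" using e(1) by (simp add: t_def)
    \<comment> \<open>The octant point \<open>c\<close> lies next to face \<open>i\<close> and to face \<open>j\<close>, close to the double point \<open>a\<close>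
      on their common axis.\<close>
    define c where "c = a + axis i (sg (s i) * t) + axis j (sg (s j) * t)"
    have na: "norm (axis l r :: R3) = \<bar>r\<bar>" for l r
    proof -
      have "(axis l r :: R3) = r *\<^sub>R axis l 1" by (simp add: vec_eq_iff axis_def)
      then show ?thesis by simp
    qed
    have nt: "norm (axis l (sg b * t) :: R3) = t" "norm (axis l t :: R3) = t" for l b
      using t unfolding na abs_mult sg(5) by simp_all
    \<comment> \<open>The assumptions are repeated here so that the fact can also be used with
      \<open>i\<close> and \<open>j\<close> exchanged; both uses refer to the same point
      \<open>c\<close>. The point \<open>p\<close> below lies on face \<open>i\<close>, and one step
      across this face leads to \<open>c\<close>.\<close>
    have key: "col i s = g (\<phi> c)" if ij: "i \<noteq> j" "k \<noteq> i" "k \<noteq> j" and all: "\<And>l. l = i \<or> l = j \<or> l = k"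
      and ai: "a $ i = 0" "a $ j = 0" "a $ k = sg (s k)"
      and c: "c = a + axis i (sg (s i) * t) + axis j (sg (s j) * t)" for i j
    proof -
      define p where "p = a + axis j (sg (s j) * t)"
      have p: "p $ i = 0" "p $ j = sg (s j) * t" "p $ k = sg (s k)"
        using ij ai by (auto simp: p_def axis_def)
      have pne: "p $ l \<noteq> 0" if "l \<noteq> i" for l using all[of l] that p sg(1) t by auto
      have pin: "p \<in> ball a e" using nt(1)[of j "s j"] t by (simp add: p_def dist_norm t_def)
      have pm: "p - axis i t \<in> ball a e" "p + axis i t \<in> ball a e"
      proof -
        have "norm (a - (p - axis i t)) \<le> t + t"
          using norm_triangle_ineq[of "axis i t" "- axis j (sg (s j) * t)"] nt by (simp add: p_def)
        then show "p - axis i t \<in> ball a e" using t by (simp add: dist_norm t_def)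
        have "norm (a - (p + axis i t)) \<le> t + t"
          using norm_triangle_ineq[of "- axis i t" "- axis j (sg (s j) * t)"] nt by (simp add: p_def algebra_simps)
        then show "p + axis i t \<in> ball a e" using t by (simp add: dist_norm t_def)
      qed
      have fs: "0 < p $ l * fp i s $ l" if "l \<in> UNIV - {i}" for l
      proof -
        have "l = j \<or> l = k" using all[of l] that by auto
        then show ?thesis using ij p(2,3) t by (elim disjE) (simp_all add: fp_def sg_def)
      qed
      have f0: "fp i s $ i = 0" by (simp add: fp_def)
      have sh: "sheet (\<phi> p) = sheet (\<phi> (fp i s))" and pR: "\<phi> p \<in> R"
        using crossing_face[OF cc UNIV_I p(1) f0 fs] by blast+
      have g1: "germ g (\<phi> p) (g (\<phi> (p - axis i t))) (g (\<phi> (p + axis i t)))"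
        by (rule crossing_germ_on[OF cc convex_ball open_ball gc UNIV_I p(1) _ pin t pm]) (use pne in simp)
      have "\<phi> p \<in> U \<inter> R" using pin e(2) pR by blast
      then have g2: "germ g (\<phi> p) (fst (C (sheet (\<phi> p)))) (snd (C (sheet (\<phi> p))))"
        using U(2) unfolding local_section_def by blast
      have "c = (if s i then p + axis i t else p - axis i t)"
        unfolding c p_def by (simp add: sg_def vec_eq_iff axis_def)
      then show ?thesis using germ_unique[OF g1 g2] by (simp add: col_def sh)
    qed
    have "col i s = g (\<phi> c)" by (rule key[OF ij k all ai c_def])
    moreover have "col j s = g (\<phi> c)"
    proof (rule key[of j i])
      show "l = j \<or> l = i \<or> l = k" for l using all[of l] by auto
    qed (use ij k ai in \<open>auto simp: c_def\<close>)
    ultimately show ?thesis by simp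
  qed
  define f where "f z = col 1 (\<lambda>i. 0 < inv_into UNIV \<phi> z $ i)" for z
  have f: "f (\<phi> x) = col 1 (\<lambda>i. 0 < x $ i)" for x using E(2) by (simp add: f_def)
  have fc: "connected_constant f (range \<phi> - D)"
  proof (rule sign_function_connected_constant[where F = "col 1" and f = f, OF cc _ f])
    fix s t :: "3 \<Rightarrow> bool" assume "\<And>i. i \<in> UNIV \<Longrightarrow> s i = t i"
    then have "s = t" by auto
    then show "col 1 s = col 1 t" by simp
  qed
  have "germ f q' (fst (C (sheet q'))) (snd (C (sheet q')))" if q': "q' \<in> range \<phi> \<inter> R" for q'
  proof -
    obtain x where x: "q' = \<phi> x" using q' by blast
    have "\<phi> x \<in> D" using q' x regular_subset_D by auto
    then obtain i where i: "x $ i = 0" using crossing_chart_D[OF cc, of x] by blast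
    have ne: "x $ j \<noteq> 0" if "j \<noteq> i" for j
    proof
      assume j: "x $ j = 0"
      obtain a where "fib q' = {a}" using card_fib_regular[of q'] q' card_1_singletonE by blast
      then have "h i x = a \<and> h j x = a" using fib_crossing[OF cc, of x] i j x by auto
      then show False using hne[OF that j i] by simp
    qed
    have g: "germ f q' (f (\<phi> (x - axis i 1))) (f (\<phi> (x + axis i 1)))"
      unfolding x by (rule crossing_germ_on[OF cc convex_UNIV open_UNIV fc UNIV_I i]) (use ne in auto)
    have sh: "sheet q' = sheet (\<phi> (fp i s))" if "\<And>j. j \<noteq> i \<Longrightarrow> s j = (0 < x $ j)" for s
    proof -
      have f0: "fp i s $ i = 0" by (simp add: fp_def)
      have "0 < x $ l * fp i s $ l" if "l \<in> UNIV - {i}" for l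
        using ne[of l] that \<open>\<And>j. j \<noteq> i \<Longrightarrow> s j = (0 < x $ j)\<close>[of l]
        by (auto simp: fp_def sg_def)
      then show ?thesis unfolding x using crossing_face(1)[OF cc UNIV_I i f0] by blast
    qed
    have coli: "col 1 s = col i s" for s using col[of 1 i s] by (cases "i = 1") auto
    have "f (\<phi> (x - axis i 1)) = fst (C (sheet q'))" "f (\<phi> (x + axis i 1)) = snd (C (sheet q'))"
    proof -
      have s1: "sheet q' = sheet (\<phi> (fp i (\<lambda>j. 0 < (x - axis i 1) $ j)))" by (rule sh) (simp add: axis_def)
      have s2: "sheet q' = sheet (\<phi> (fp i (\<lambda>j. 0 < (x + axis i 1) $ j)))" by (rule sh) (simp add: axis_def)
      show "f (\<phi> (x - axis i 1)) = fst (C (sheet q'))"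
        unfolding f coli[of "\<lambda>j. 0 < (x - axis i 1) $ j"] unfolding col_def s1[symmetric]
        by (simp add: i axis_def)
      show "f (\<phi> (x + axis i 1)) = snd (C (sheet q'))"
        unfolding f coli[of "\<lambda>j. 0 < (x + axis i 1) $ j"] unfolding col_def s2[symmetric]
        by (simp add: i axis_def)
    qed
    then show ?thesis using g by simp
  qed
  then have "local_section C (range \<phi>) f" unfolding local_section_def using E(4) fc by blast
  moreover have "q \<in> range \<phi>" using \<phi>(2) by blast
  ultimately show ?thesis by blast
qed

end

section \<open>Branch points\<close>

lemma convex_halfspace_13: "convex {w::real^3. 0 < p * w $ 1 + r * w $ 3}"
proof -
  have "(vector [p, 0, r] :: real^3) \<bullet> w = p * w $ 1 + r * w $ 3" for w
    by (simp add: inner_vec_def sum_3)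
  then show ?thesis using convex_halfspace_gt[of 0 "vector [p, 0, r] :: real^3"] by simp
qed

lemma abs_nth_le_dist3: "\<bar>w $ i - x $ i\<bar> \<le> dist x (w :: real^3)"
  using component_le_norm_cart[of "w - x" i] by (simp add: dist_norm norm_minus_commute)

context diagram
begin

text \<open>Both kinds have one preimage. For a constant function, having a germ just means being
  regular, so \<open>germ_near\<close> shows that all points of \<open>D\<close> near a regular
  point are regular, whereas double points accumulate at a branch point.\<close>

lemma regular_not_branch: "q \<in> R \<Longrightarrow> q \<notin> branch_points G"
proof
  assume q: "q \<in> R" and b: "q \<in> branch_points G"
  obtain c \<phi> where c: "rhc c \<phi>" "\<phi> 0 = q" using q by (auto simp: regular_points_def)
  have "germ (\<lambda>_. ()) q () ()" by (rule germ_rhc[OF c]) simp_all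
  then obtain V where V: "open V" "q \<in> V" "\<And>q'. q' \<in> V \<inter> D \<Longrightarrow> germ (\<lambda>_. ()) q' () ()"
    by (rule germ_near) (rule that)
  obtain q' where q': "q' \<in> V" "card (fib q') = 2" using branch_accumulates[OF b V(1,2)] by blast
  then have "fib q' \<noteq> {}" by auto
  then have "germ (\<lambda>_. ()) q' () ()" using V(3) q'(1) fib_in_D by blast
  then have "q' \<in> R" unfolding germ_def regular_points_def by blast
  then show False using card_fib_regular q'(2) by fastforce
qed

text \<open>The branch point itself imposes no condition: the regular part of the umbrella consists
  of the images of the half planes \<open>u $ 1 > 0\<close> and \<open>u $ 1 < 0\<close>, and both
  reach the double line, where a section exists.\<close>

lemma local_section_branch:
  assumes C: "consistent C" and q: "q \<in> branch_points G"
  shows "\<exists>U f. q \<in> U \<and> local_section C U f"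
proof -
  obtain \<phi> where \<phi>: "branch_chart G \<phi>" "\<phi> 0 = q" using q by (auto simp: branch_points_def)
  note emb = branch_chart_embedding[OF \<phi>(1)]
  note E = open_embeddingD[OF emb]
  have cont: "continuous_on A \<phi>" for A by (rule continuous_on_subset[OF E(1)]) simp
  define x0 :: R3 where "x0 = vector [0, 1, 0]"
  have x0: "x0 $ 1 = 0" "x0 $ 2 = 1" "x0 $ 3 = 0" by (simp_all add: x0_def)
  have "x0 = umbrella (vector [0, 1])" by (simp add: x0_def umbrella_def)
  then have "card (fib (\<phi> x0)) = 2" using card_fib_branch_chart(2)[OF \<phi>(1), of "vector [0, 1]"] by simp
  then obtain U0 g where U0: "\<phi> x0 \<in> U0" "local_section C U0 g" using local_section_double[OF C card_fib_2_double] by blast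
  then have "open U0" and gc: "connected_constant g (U0 - D)" by (simp_all add: local_section_def)
  obtain e0 where e0: "e0 > 0" "\<phi> ` ball x0 e0 \<subseteq> U0" using chart_ball[OF emb \<open>open U0\<close> U0(1)] by blast
  \<comment> \<open>In the coordinates \<open>\<theta>\<close> the umbrella is the union of the planes \<open>w\<^sub>3 = \<plusminus> w\<^sub>1\<close> near the double
    point \<open>x0\<close>. The upper half \<open>w\<^sub>3 > 0\<close> meets all three regions of the complement and both sheets,
    so it suffices to copy the section \<open>g\<close> from there.\<close>
  define \<theta> :: "R3 \<Rightarrow> R3" where "\<theta> w = vector [w $ 1, (w $ 2)\<^sup>2, w $ 3 * w $ 2]" for w
  have \<theta>n: "\<theta> w $ 1 = w $ 1" "\<theta> w $ 2 = (w $ 2)\<^sup>2" "\<theta> w $ 3 = w $ 3 * w $ 2" for w by (simp_all add: \<theta>_def)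
  have \<theta>c: "continuous_on A \<theta>" for A unfolding \<theta>_def by (intro continuous_intros)
  have "\<theta> x0 = x0" by (simp add: \<theta>_def x0 vec3_eq_iff)
  then have "x0 \<in> \<theta> -` ball x0 e0" using e0(1) by simp
  moreover have "open (\<theta> -` ball x0 e0)" by (rule open_vimage[OF open_ball \<theta>c])
  ultimately obtain d0 where d0: "d0 > 0" "ball x0 d0 \<subseteq> \<theta> -` ball x0 e0" using open_contains_ball by blast
  define d where "d = min d0 1"
  have d: "d > 0" "d \<le> 1" "d \<le> d0" using d0(1) by (auto simp: d_def)
  define B where "B = ball x0 d"
  have BU: "\<phi> (\<theta> w) \<in> U0" if "w \<in> B" for w
  proof -
    have "w \<in> ball x0 d0" using that d(3) by (simp add: B_def)
    then show ?thesis using d0(2) e0(2) by blast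
  qed
  have B2: "0 < w $ 2" if "w \<in> B" for w
    using abs_nth_le_dist3[of w 2 x0] that d(2) by (simp add: B_def x0 abs_if split: if_splits)
  have inB: "vector [a, 1, b] \<in> B" if "a\<^sup>2 + b\<^sup>2 < d\<^sup>2" for a b
  proof -
    have "norm (x0 - vector [a, 1, b]) = sqrt (a\<^sup>2 + b\<^sup>2)" by (simp add: norm3 x0)
    also have "\<dots> < d" using that d(1) by (intro real_less_lsqrt) auto
    finally show ?thesis by (simp add: B_def dist_norm)
  qed
  have \<theta>D: "\<phi> (\<theta> w) \<in> D \<longleftrightarrow> w $ 3 = w $ 1 \<or> w $ 3 = - w $ 1" if "w \<in> B" for w
  proof -
    have "\<theta> w \<in> range umbrella \<longleftrightarrow> w $ 3 = w $ 1 \<or> w $ 3 = - w $ 1"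
    proof
      assume "\<theta> w \<in> range umbrella"
      then obtain u where u: "umbrella u = \<theta> w" by (metis imageE)
      then have u: "w $ 1 = u $ 1" "(u $ 2)\<^sup>2 = (w $ 2)\<^sup>2" "w $ 3 * w $ 2 = u $ 1 * u $ 2"
        by (simp_all add: umbrella_eq_iff \<theta>n)
      then have "u $ 2 = w $ 2 \<or> u $ 2 = - w $ 2" by (simp add: power2_eq_iff)
      then have "w $ 3 * w $ 2 = w $ 1 * w $ 2 \<or> w $ 3 * w $ 2 = (- w $ 1) * w $ 2"
        using u(1,3) by auto
      then show "w $ 3 = w $ 1 \<or> w $ 3 = - w $ 1"
        using B2[OF that] by (simp only: mult_cancel_right) auto
    next
      assume "w $ 3 = w $ 1 \<or> w $ 3 = - w $ 1"
      then have "umbrella (vector [w $ 1, w $ 2]) = \<theta> w \<or> umbrella (vector [w $ 1, - w $ 2]) = \<theta> w"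
        by (auto simp: umbrella_eq_iff \<theta>n)
      then show "\<theta> w \<in> range umbrella" by (metis rangeI)
    qed
    then show ?thesis using branch_chart_D[OF \<phi>(1)] by simp
  qed
  \<comment> \<open>Of the four sectors between the two planes, the upper one and the upper halves
    of the right and left ones. The idle coefficients match the shape of
    \<open>convex_halfspace_13\<close>.\<close>
  define SR where "SR = B \<inter> {w. 0 < 0 * w $ 1 + 1 * w $ 3} \<inter> {w. 0 < 1 * w $ 1 + (-1) * w $ 3}"
  define SL where "SL = B \<inter> {w. 0 < 0 * w $ 1 + 1 * w $ 3} \<inter> {w. 0 < (-1) * w $ 1 + (-1) * w $ 3}"
  define ST where "ST = B \<inter> {w. 0 < (-1) * w $ 1 + 1 * w $ 3} \<inter> {w. 0 < 1 * w $ 1 + 1 * w $ 3}"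
  have cv: "convex SR" "convex SL" "convex ST"
    unfolding SR_def SL_def ST_def B_def by (intro convex_Int convex_ball convex_halfspace_13)+
  have sub: "SR \<subseteq> B" "SL \<subseteq> B" "ST \<subseteq> B" by (auto simp: SR_def SL_def ST_def)
  have nD: "\<phi> (\<theta> w) \<notin> D" if "w \<in> SR \<or> w \<in> SL \<or> w \<in> ST" for w
  proof -
    have "w \<in> B" using that sub by blast
    moreover have "w $ 3 \<noteq> w $ 1 \<and> w $ 3 \<noteq> - w $ 1" using that by (auto simp: SR_def SL_def ST_def)
    ultimately show ?thesis using \<theta>D by blast
  qed
  have const: "g (\<phi> (\<theta> w)) = g (\<phi> (\<theta> w'))"
    if S: "convex S" "S \<subseteq> B" "\<And>w. w \<in> S \<Longrightarrow> \<phi> (\<theta> w) \<notin> D" "w \<in> S" "w' \<in> S" for S w w'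
  proof (rule connected_constantD[OF gc])
    show "connected (\<phi> ` \<theta> ` S)"
      by (intro connected_continuous_image cont \<theta>c convex_connected S)
    show "\<phi> ` \<theta> ` S \<subseteq> U0 - D" using S(2,3) BU by blast
  qed (use S in blast)+
  define pR pL pT :: R3 where "pR = vector [d/2, 1, d/4]" and "pL = vector [-d/2, 1, d/4]" and "pT = vector [0, 1, d/2]"
  have p: "pR \<in> SR" "pL \<in> SL" "pT \<in> ST"
  proof -
    have "pR \<in> B" "pL \<in> B" "pT \<in> B" unfolding pR_def pL_def pT_def
      by (rule inB; use d(1) in \<open>simp add: power2_eq_square field_simps\<close>)+
    then show "pR \<in> SR" "pL \<in> SL" "pT \<in> ST" using d(1)
      by (simp_all add: SR_def SL_def ST_def) (simp_all add: pR_def pL_def pT_def)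
  qed
  define vR vL vT where "vR = g (\<phi> (\<theta> pR))" and "vL = g (\<phi> (\<theta> pL))" and "vT = g (\<phi> (\<theta> pT))"
  have gR: "g (\<phi> (\<theta> w)) = vR" if "w \<in> SR" for w
    unfolding vR_def by (rule const[OF cv(1) sub(1) _ that p(1)]) (use nD in blast)
  have gL: "g (\<phi> (\<theta> w)) = vL" if "w \<in> SL" for w
    unfolding vL_def by (rule const[OF cv(2) sub(2) _ that p(2)]) (use nD in blast)
  have gT: "g (\<phi> (\<theta> w)) = vT" if "w \<in> ST" for w
    unfolding vT_def by (rule const[OF cv(3) sub(3) _ that p(3)]) (use nD in blast)
  \<comment> \<open>The umbrella has the equation
    \<open>(x $ 3)\<^sup>2 = (x $ 1)\<^sup>2 * x $ 2\<close>, apart from the half line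
    \<open>x $ 1 = x $ 3 = 0\<close>, \<open>x $ 2 < 0\<close>, which is not in its image. The
    inequality describes its interior, which falls into two parts by the sign of
    \<open>x $ 1\<close>; the outside is connected and passes around the apex.\<close>
  define F where "F x = (if (x $ 3)\<^sup>2 < (x $ 1)\<^sup>2 * x $ 2 then (if 0 < x $ 1 then vR else vL) else vT)" for x :: R3
  define f where "f z = F (inv_into UNIV \<phi> z)" for z
  have f: "f (\<phi> x) = F x" for x using E(2) by (simp add: f_def)
  define \<rho> :: "R3 \<Rightarrow> R3" where "\<rho> x = vector [x $ 1, sqrt (x $ 2), x $ 3 / sqrt (x $ 2)]" for x
  define E0 where "E0 = {x. 0 < x $ 2 \<and> 0 < x $ 3} \<inter> \<rho> -` B"
  have "open E0" unfolding E0_def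
  proof (rule continuous_open_preimage)
    show "continuous_on {x. 0 < x $ 2 \<and> 0 < x $ 3} \<rho>"
      unfolding \<rho>_def by (intro continuous_intros) auto
    show "open {x::R3. 0 < x $ 2 \<and> 0 < x $ 3}"
      by (intro open_Collect_conj open_Collect_less continuous_intros)
    show "open B" by (simp add: B_def)
  qed
  then have oE0: "open (\<phi> ` E0)" by (rule E(3))
  have \<theta>\<rho>: "\<theta> (\<rho> x) = x" if "x \<in> E0" for x
    using that by (simp add: E0_def \<theta>_def \<rho>_def vec3_eq_iff)
  have E0U: "\<phi> x \<in> U0" if "x \<in> E0" for x
    using BU[of "\<rho> x"] \<theta>\<rho>[OF that] that by (simp add: E0_def)
  have fg: "f z = g z" if z: "z \<in> \<phi> ` E0 - D" for z
  proof -
    obtain x where x: "z = \<phi> x" "x \<in> E0" using z by blast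
    define w where "w = \<rho> x"
    have w: "w \<in> B" "x = \<theta> w" using x(2) \<theta>\<rho>[OF x(2)] by (auto simp: E0_def w_def)
    have w3: "0 < w $ 3" using x(2) by (simp add: E0_def w_def \<rho>_def)
    have w2: "0 < w $ 2" by (rule B2[OF w(1)])
    have "\<phi> (\<theta> w) \<notin> D" using z x(1) w(2) by simp
    then have ne: "w $ 3 \<noteq> w $ 1" "w $ 3 \<noteq> - w $ 1" using \<theta>D[OF w(1)] by blast+
    have "(x $ 3)\<^sup>2 < (x $ 1)\<^sup>2 * x $ 2 \<longleftrightarrow> (w $ 3)\<^sup>2 * (w $ 2)\<^sup>2 < (w $ 1)\<^sup>2 * (w $ 2)\<^sup>2"
      by (simp add: w(2) \<theta>n power_mult_distrib)
    also have "\<dots> \<longleftrightarrow> (w $ 3)\<^sup>2 < (w $ 1)\<^sup>2" using w2 by simp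
    also have "\<dots> \<longleftrightarrow> w $ 3 < \<bar>w $ 1\<bar>" using w3 abs_le_square_iff[of "w $ 1" "w $ 3"] by (metis abs_of_pos not_le)
    finally have iff: "(x $ 3)\<^sup>2 < (x $ 1)\<^sup>2 * x $ 2 \<longleftrightarrow> w $ 3 < \<bar>w $ 1\<bar>" .
    have x1: "x $ 1 = w $ 1" by (simp add: w(2) \<theta>n)
    have "w $ 3 < w $ 1 \<or> w $ 3 < - w $ 1 \<or> (w $ 1 < w $ 3 \<and> - w $ 1 < w $ 3)"
      using ne by linarith
    then have "F x = g (\<phi> (\<theta> w))"
    proof (elim disjE conjE)
      assume a: "w $ 3 < w $ 1"
      then have "w \<in> SR" using w(1) w3 by (simp add: SR_def)
      then show ?thesis unfolding F_def iff unfolding x1 using gR a w3 by simp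
    next
      assume a: "w $ 3 < - w $ 1"
      then have "w \<in> SL" using w(1) w3 by (simp add: SL_def)
      then show ?thesis unfolding F_def iff unfolding x1 using gL a w3 by simp
    next
      assume a: "w $ 1 < w $ 3" "- w $ 1 < w $ 3"
      then have "w \<in> ST" using w(1) by (simp add: ST_def)
      then show ?thesis unfolding F_def iff unfolding x1 using gT a by simp
    qed
    then show ?thesis by (simp add: x(1) f w(2))
  qed
  have fc: "connected_constant f (range \<phi> - D)"
  proof (rule connected_constantI)
    fix z assume z: "z \<in> range \<phi> - D"
    then obtain x where x: "z = \<phi> x" by blast
    then have xu: "x \<notin> range umbrella" using z branch_chart_D[OF \<phi>(1)] by blast
    have "\<exists>V. open V \<and> x \<in> V \<and> (\<forall>y\<in>V. F y = F x)"
    proof (cases "(x $ 3)\<^sup>2 < (x $ 1)\<^sup>2 * x $ 2")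
      case True
      then have "x $ 1 \<noteq> 0" by (auto simp: not_less[symmetric])
      then have "x $ 1 < 0 \<or> 0 < x $ 1" by auto
      then show ?thesis
      proof
        assume "0 < x $ 1"
        moreover have "open {y::R3. (y $ 3)\<^sup>2 < (y $ 1)\<^sup>2 * y $ 2 \<and> 0 < y $ 1}"
          by (intro open_Collect_conj open_Collect_less continuous_intros)
        ultimately show ?thesis using True
          by (intro exI[of _ "{y. (y $ 3)\<^sup>2 < (y $ 1)\<^sup>2 * y $ 2 \<and> 0 < y $ 1}"]) (simp add: F_def)
      next
        assume "x $ 1 < 0"
        moreover have "open {y::R3. (y $ 3)\<^sup>2 < (y $ 1)\<^sup>2 * y $ 2 \<and> y $ 1 < 0}"
          by (intro open_Collect_conj open_Collect_less continuous_intros)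
        ultimately show ?thesis using True
          by (intro exI[of _ "{y. (y $ 3)\<^sup>2 < (y $ 1)\<^sup>2 * y $ 2 \<and> y $ 1 < 0}"]) (simp add: F_def)
      qed
    next
      case False
      have "(x $ 1)\<^sup>2 * x $ 2 < (x $ 3)\<^sup>2 \<or> x $ 2 < 0"
      proof (rule ccontr)
        assume "\<not> ?thesis"
        then have eq: "(x $ 3)\<^sup>2 = (x $ 1)\<^sup>2 * x $ 2" and x2: "0 \<le> x $ 2" using False by auto
        then have "(x $ 3)\<^sup>2 = (x $ 1 * sqrt (x $ 2))\<^sup>2" by (simp add: power_mult_distrib)
        then have "x $ 3 = x $ 1 * sqrt (x $ 2) \<or> x $ 3 = - (x $ 1 * sqrt (x $ 2))" by (simp add: power2_eq_iff)
        then have "umbrella (vector [x $ 1, sqrt (x $ 2)]) = x \<or> umbrella (vector [x $ 1, - sqrt (x $ 2)]) = x"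
          using x2 by (auto simp: umbrella_eq_iff)
        then show False using xu by (metis rangeI)
      qed
      then show ?thesis
      proof
        assume "(x $ 1)\<^sup>2 * x $ 2 < (x $ 3)\<^sup>2"
        moreover have "open {y::R3. (y $ 1)\<^sup>2 * y $ 2 < (y $ 3)\<^sup>2}"
          by (intro open_Collect_less continuous_intros)
        ultimately show ?thesis
          by (intro exI[of _ "{y. (y $ 1)\<^sup>2 * y $ 2 < (y $ 3)\<^sup>2}"]) (simp add: F_def)
      next
        assume x2: "x $ 2 < 0"
        have "\<not> (y $ 3)\<^sup>2 < (y $ 1)\<^sup>2 * y $ 2" if "y $ 2 < 0" for y :: R3
        proof -
          have "(y $ 1)\<^sup>2 * y $ 2 \<le> 0" using that by (simp add: mult_nonneg_nonpos)
          also have "\<dots> \<le> (y $ 3)\<^sup>2" by simp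
          finally show ?thesis by simp
        qed
        moreover have "open {y::R3. y $ 2 < 0}" by (intro open_Collect_less continuous_intros)
        ultimately show ?thesis using x2
          by (intro exI[of _ "{y. y $ 2 < 0}"]) (simp add: F_def)
      qed
    qed
    then obtain V where V: "open V" "x \<in> V" "\<forall>y\<in>V. F y = F x" by blast
    have "\<forall>y\<in>\<phi> ` V. f y = f z" using V(3) unfolding x by (simp add: f)
    then show "\<exists>V. open V \<and> z \<in> V \<and> (\<forall>y\<in>V \<inter> (range \<phi> - D). f y = f z)"
      using E(3)[OF V(1)] V(2) unfolding x by blast
  qed
  \<comment> \<open>One point of each half plane suffices: there \<open>f\<close> agrees with
    \<open>g\<close> near the sheet, and the germ is carried along the connected image of the half
    plane.\<close>
  have sheets: "germ f q' (fst (C (sheet q'))) (snd (C (sheet q')))"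
    if A: "convex A" "\<And>u. u \<in> A \<Longrightarrow> u $ 1 \<noteq> 0" and u0: "u0 \<in> A" "umbrella u0 \<in> E0" and q': "q' \<in> \<phi> ` umbrella ` A"
    for A u0 q'
  proof -
    have uc: "continuous_on A umbrella" unfolding umbrella_def by (intro continuous_intros)
    have A1: "connected (\<phi> ` umbrella ` A)"
      by (intro connected_continuous_image cont uc convex_connected A)
    have A2: "\<phi> ` umbrella ` A \<subseteq> R" using A(2) branch_chart_regular[OF \<phi>(1)] by blast
    have A3: "\<phi> (umbrella u0) \<in> \<phi> ` umbrella ` A" using u0(1) by blast
    have "\<phi> (umbrella u0) \<in> U0 \<inter> R" using E0U[OF u0(2)] A2 A3 by blast
    then have "germ g (\<phi> (umbrella u0)) (fst (C (sheet (\<phi> (umbrella u0))))) (snd (C (sheet (\<phi> (umbrella u0)))))"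
      using U0(2) unfolding local_section_def by blast
    then have gf: "germ f (\<phi> (umbrella u0)) (fst (C (sheet (\<phi> (umbrella u0))))) (snd (C (sheet (\<phi> (umbrella u0)))))"
      by (rule germ_cong[OF _ oE0 _ fg]) (use u0(2) in blast)
    have "germ f q' (fst (C (sheet (\<phi> (umbrella u0))))) (snd (C (sheet (\<phi> (umbrella u0)))))"
      by (rule germ_propagate[OF A1 A2 E(4) _ fc A3 gf q']) blast
    moreover have "sheet q' = sheet (\<phi> (umbrella u0))" by (rule sheet_eq[OF A1 A2 q' A3])
    ultimately show ?thesis by simp
  qed
  \<comment> \<open>For \<open>u $ 1 < 0\<close> the second coordinate has to be negative as well,
    so that \<open>u $ 1 * u $ 2\<close>, the height above the double line, is positive.\<close>
  have E0u: "umbrella (vector [d/4, 1]) \<in> E0" "umbrella (vector [- (d/4), - 1]) \<in> E0"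
  proof -
    have "vector [d/4, 1, d/4] \<in> B" "vector [-(d/4), 1, d/4] \<in> B"
      by (rule inB; use d(1) in \<open>simp add: power2_eq_square field_simps\<close>)+
    then show "umbrella (vector [d/4, 1]) \<in> E0" "umbrella (vector [- (d/4), - 1]) \<in> E0"
      using d(1) by (simp_all add: E0_def \<rho>_def umbrella_nth)
  qed
  have cA: "convex {u::real^2. 0 < u $ 1}" "convex {u::real^2. u $ 1 < 0}"
    using convex_halfspace_gt[of 0 "axis 1 (1::real) :: real^2"] convex_halfspace_lt[of "axis 1 (1::real) :: real^2" 0]
    by (simp_all add: inner_axis')
  have "germ f q' (fst (C (sheet q'))) (snd (C (sheet q')))" if q': "q' \<in> range \<phi> \<inter> R" for q'
  proof -
    obtain x where x: "q' = \<phi> x" using q' by blast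
    have "\<phi> x \<in> D" using q' x regular_subset_D by auto
    then obtain u where u: "x = umbrella u" using branch_chart_D[OF \<phi>(1)] by blast
    have "u $ 1 \<noteq> 0"
    proof
      assume u1: "u $ 1 = 0"
      have "card (fib q') \<noteq> 2" using card_fib_regular[of q'] q' by simp
      then have "u $ 2 = 0" using card_fib_branch_chart(2)[OF \<phi>(1) u1] x u by blast
      then have "umbrella u = 0" using u1 by (simp add: umbrella_eq_iff)
      then have "q' = q" using x u \<phi>(2) by simp
      then show False using regular_not_branch q q' by blast
    qed
    then have "u $ 1 < 0 \<or> 0 < u $ 1" by auto
    then show ?thesis
    proof
      assume "0 < u $ 1"
      then show ?thesis
        by (intro sheets[OF cA(1) _ _ E0u(1)]) (use x u d(1) in auto)
    next
      assume "u $ 1 < 0"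
      then show ?thesis
        by (intro sheets[OF cA(2) _ _ E0u(2)]) (use x u d(1) in auto)
    qed
  qed
  then have "local_section C (range \<phi>) f" unfolding local_section_def using E(4) fc by blast
  moreover have "q \<in> range \<phi>" using \<phi>(2) by blast
  ultimately show ?thesis by blast
qed

lemma local_section_exists: "consistent C \<Longrightarrow> q \<in> D \<Longrightarrow> \<exists>U f. q \<in> U \<and> local_section C U f"
  using D_cases local_section_regular local_section_double local_section_triple local_section_branch by metis

end

section \<open>Region colorings of the whole space\<close>

context diagram
begin

lemma nonempty_D: "D \<noteq> {}"
  using nonempty_G by (simp add: D_def)

text \<open>\<open>e\<close> is a Lebesgue number of the cover of the compact set \<open>D\<close>
  by domains of local sections.\<close>

lemma local_section_cover:
  assumes C: "consistent C"
  obtains e where "e > 0" "\<And>p. p \<in> D \<Longrightarrow> \<exists>f. local_section C (ball p e) f"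
proof -
  have "D \<subseteq> \<Union> {U. \<exists>f. local_section C U f}" using local_section_exists[OF C] by blast
  moreover have "open U" if "U \<in> {U. \<exists>f. local_section C U f}" for U using that by (auto simp: local_section_def)
  ultimately obtain e where e: "e > 0" "\<forall>x\<in>D. \<exists>U\<in>{U. \<exists>f. local_section C U f}. ball x e \<subseteq> U"
    using Heine_Borel_lemma[OF compact_D, of "{U. \<exists>f. local_section C U f}"] by metis
  have "\<exists>f. local_section C (ball p e) f" if p: "p \<in> D" for p
  proof -
    obtain U f where "ball p e \<subseteq> U" "local_section C U f" using e(2) p by blast
    then have "local_section C (ball p e) f" using local_section_subset[OF _ open_ball] by blast
    then show ?thesis by blast
  qed
  then show thesis using that e(1) by blast
qed

text \<open>Halving the radius leaves room for a ball of radius \<open>e/2\<close> around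
  \<open>z\<close> in both domains. This ball contains the centre \<open>p\<close>, so it meets
  \<open>D\<close>, and there both sections have the germs prescribed by \<open>C\<close>.\<close>

lemma local_section_agree:
  assumes f: "local_section C (ball p e) f" and g: "local_section C (ball p' e) g" and e: "e > 0" and D: "p \<in> D" "p' \<in> D"
    and z: "z \<in> ball p (e/2)" "z \<in> ball p' (e/2)" "z \<notin> D"
  shows "f z = g z"
proof -
  define W where "W = ball z (e/2)"
  have sub: "W \<subseteq> ball p e" "W \<subseteq> ball p' e"
  proof -
    have "y \<in> ball p e" "y \<in> ball p' e" if "y \<in> W" for y
      using dist_triangle[of p y z] dist_triangle[of p' y z] z(1,2) that by (simp_all add: W_def)
    then show "W \<subseteq> ball p e" "W \<subseteq> ball p' e" by blast+
  qed
  have f': "local_section C W f" and g': "local_section C W g"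
    using local_section_subset[OF f _ sub(1)] local_section_subset[OF g _ sub(2)] by (simp_all add: W_def)
  show ?thesis
  proof (rule germ_determines[of W])
    show "open W" "connected W" by (simp_all add: W_def)
    have "p \<in> W" using z(1) by (simp add: W_def dist_commute)
    then show "W \<inter> D \<noteq> {}" using D by blast
    show "connected_constant f (W - D)" "connected_constant g (W - D)" using f' g' by (simp_all add: local_section_def)
    show "\<exists>v w. germ f q v w \<and> germ g q v w" if "q \<in> W \<inter> R" for q
      using f' g' that unfolding local_section_def by blast
    show "z \<in> W - D" using z(3) e by (simp add: W_def)
  qed
qed

lemma connected_neighbourhood:
  assumes "e > 0"
  shows "open (\<Union>p\<in>D. ball p e)" "connected (\<Union>p\<in>D. ball p e)" "D \<subseteq> (\<Union>p\<in>D. ball p e)"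
proof -
  show "open (\<Union>p\<in>D. ball p e)" by blast
  show sub: "D \<subseteq> (\<Union>p\<in>D. ball p e)" using assms by force
  have "connected (D \<union> \<Union> ((\<lambda>p. ball p e) ` D))"
  proof (rule connected_Un_UN[OF connected_D])
    fix A assume A: "A \<in> (\<lambda>p. ball p e) ` D"
    then show "connected A" by auto
    show "D \<inter> A \<noteq> {}" using A assms by force
  qed
  moreover have "D \<union> \<Union> ((\<lambda>p. ball p e) ` D) = (\<Union>p\<in>D. ball p e)" using sub by blast
  ultimately show "connected (\<Union>p\<in>D. ball p e)" by simp
qed

text \<open>Every region touches \<open>D\<close>, so \<open>N\<close> together with all regions
  other than \<open>K\<close> is connected. With \<open>K\<close> it fills the space and it meets
  \<open>K\<close> exactly in \<open>N \<inter> K\<close>, which is connected by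
  unicoherence.\<close>

lemma connected_region_neighbourhood:
  assumes N: "open N" "connected N" "D \<subseteq> N" and K: "K \<in> components (- D)"
  shows "connected (N \<inter> K)" "N \<inter> K \<noteq> {}"
proof -
  have K': "L \<in> components (UNIV - D) \<longleftrightarrow> L \<in> components (- D)" for L by (simp add: Compl_eq_Diff_UNIV)
  have meet: "N \<inter> L \<noteq> {}" if L: "L \<in> components (- D)" for L
  proof -
    obtain e where "e \<in> D" "e \<in> closure L"
      using component_touches[OF closed_D, of UNIV L] nonempty_D L K' by auto
    then show ?thesis using N open_Int_closure_eq_empty[of N L] by blast
  qed
  then show "N \<inter> K \<noteq> {}" using K .
  have op: "open L" if "L \<in> components (- D)" for L using open_component[of UNIV L] that K' by simp
  define S where "S = N \<union> \<Union> (components (- D) - {K})"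
  have "connected S" unfolding S_def
    by (rule connected_Un_UN[OF N(2)]) (use in_components_connected meet in blast)+
  moreover have "open S" unfolding S_def using N(1) op by blast
  moreover have "S \<union> K = UNIV"
  proof -
    have "- D \<subseteq> \<Union> (components (- D) - {K}) \<union> K" using Union_components[of "- D"] by blast
    then show ?thesis using N(3) unfolding S_def by blast
  qed
  ultimately have "connected (S \<inter> K)"
    using open_unicoherent[of S K] op[OF K] in_components_connected[OF K] by blast
  moreover have "S \<inter> K = N \<inter> K"
    unfolding S_def using components_nonoverlap[OF _ K] by blast
  ultimately show "connected (N \<inter> K)" by simp
qed

lemma global_section:
  assumes C: "consistent C"
  obtains F where "connected_constant F (- D)" "\<And>q. q \<in> R \<Longrightarrow> germ F q (fst (C (sheet q))) (snd (C (sheet q)))"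
proof -
  obtain e where e: "e > 0" "\<And>p. p \<in> D \<Longrightarrow> \<exists>f. local_section C (ball p e) f" by (rule local_section_cover[OF C]) (rule that)
  obtain fp where fp: "\<And>p. p \<in> D \<Longrightarrow> local_section C (ball p e) (fp p)" using e(2) by metis
  define N where "N = (\<Union>p\<in>D. ball p (e/2))"
  have "e/2 > 0" using e(1) by simp
  note N = connected_neighbourhood[OF this, folded N_def]
  \<comment> \<open>Any ball containing \<open>z\<close> would do: by
    \<open>local_section_agree\<close> the value \<open>F0 z\<close> does not depend on the choice
    when \<open>z\<close> is off \<open>D\<close>.\<close>
  define pick where "pick z = (SOME p. p \<in> D \<and> z \<in> ball p (e/2))" for z
  have pick: "pick z \<in> D" "z \<in> ball (pick z) (e/2)" if "z \<in> N" for z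
    using someI_ex[of "\<lambda>p. p \<in> D \<and> z \<in> ball p (e/2)"] that unfolding pick_def N_def by blast+
  define F0 where "F0 z = fp (pick z) z" for z
  have F0: "F0 z = fp p z" if p: "p \<in> D" "z \<in> ball p (e/2)" "z \<notin> D" for z p
  proof -
    have "z \<in> N" using p by (auto simp: N_def)
    from pick[OF this] show ?thesis
      unfolding F0_def using local_section_agree[OF fp fp e(1) _ _ _ p(2,3)] p(1) by blast
  qed
  have F0c: "connected_constant F0 (N - D)"
  proof (rule connected_constantI)
    fix z assume z: "z \<in> N - D"
    then obtain p where p: "p \<in> D" "z \<in> ball p (e/2)" by (auto simp: N_def)
    have op: "open (ball p (e/2) - D)" using closed_D by blast
    have "connected_constant (fp p) (ball p e - D)" using fp[OF p(1)] by (simp add: local_section_def)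
    then have "connected_constant (fp p) (ball p (e/2) - D)" by (rule connected_constant_subset) (use e(1) in auto)
    then obtain V where V: "open V" "z \<in> V" "V \<subseteq> ball p (e/2) - D" "\<forall>y\<in>V. fp p y = fp p z"
      using connected_constant_open[OF _ op] p z by blast
    have "F0 y = F0 z" if "y \<in> V" for y
    proof -
      have "y \<in> ball p (e/2)" "y \<notin> D" using that V(3) by blast+
      then show ?thesis using F0[OF p(1)] p(2) z V(4) that by simp
    qed
    then show "\<exists>V. open V \<and> z \<in> V \<and> (\<forall>y\<in>V \<inter> (N - D). F0 y = F0 z)" using V(1,2) by blast
  qed
  \<comment> \<open>A region takes the value of \<open>F0\<close> at any of its points in
    \<open>N\<close>; the choice is immaterial because \<open>N\<close> meets the region in a
    connected set.\<close>
  define F where "F z = F0 (SOME y. y \<in> N \<inter> connected_component_set (- D) z)" for z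
  have F: "F z = F0 y" if y: "z \<in> K" "y \<in> K" "y \<in> N" "K \<in> components (- D)" for z y K
  proof -
    have "connected_component_set (- D) z = K"
      using y(1,4) by (metis components_iff connected_component_eq)
    then have "(SOME y. y \<in> N \<inter> connected_component_set (- D) z) \<in> N \<inter> K"
      using y(2,3) by (metis IntI some_eq_ex[of "\<lambda>y. y \<in> N \<inter> K"])
    moreover have "N \<inter> K \<subseteq> N - D" using in_components_subset[OF y(4)] by blast
    ultimately show ?thesis unfolding F_def
      using connected_constantD[OF F0c connected_region_neighbourhood(1)[OF N y(4)]] y(2,3) by blast
  qed
  have "connected_constant F (- D)"
    unfolding connected_constant_def constant_on_def
  proof (intro allI impI)
    fix A assume A: "connected A \<and> A \<subseteq> - D"
    show "\<exists>y. \<forall>x\<in>A. F x = y"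
    proof (cases "A = {}")
      case False
      then obtain K where K: "K \<in> components (- D)" "A \<subseteq> K" using A exists_component_superset[of A "- D"] by blast
      obtain y where "y \<in> N \<inter> K" using connected_region_neighbourhood(2)[OF N K(1)] by blast
      then have "\<forall>x\<in>A. F x = F0 y" using F K by blast
      then show ?thesis by blast
    qed blast
  qed
  moreover have "germ F q (fst (C (sheet q))) (snd (C (sheet q)))" if q: "q \<in> R" for q
  proof (rule germ_cong)
    have qD: "q \<in> D" using q regular_subset_D by blast
    have "q \<in> ball q e \<inter> R" using e(1) q by simp
    then show "germ (fp q) q (fst (C (sheet q))) (snd (C (sheet q)))"
      using fp[OF qD] unfolding local_section_def by blast
    show "open (ball q (e/2))" "q \<in> ball q (e/2)" using e(1) by auto
    show "F z = fp q z" if z: "z \<in> ball q (e/2) - D" for z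
    proof -
      have "z \<in> - D" using z by blast
      then obtain K where K: "K \<in> components (- D)" "z \<in> K" by (metis UnionE Union_components)
      have "z \<in> N" using z qD by (auto simp: N_def)
      then have "F z = F0 z" using F K by blast
      then show ?thesis using F0[OF qD] z by simp
    qed
  qed
  ultimately show thesis by (rule that)
qed


section \<open>Regions, semi-sheets and the colors on them\<close>

lemma regions_D: "regions G = components (- D)"
  by (simp add: regions_def D_def)

lemma region_at_D: "region_at G z = connected_component_set (- D) z"
  by (simp add: region_at_def D_def)

lemma region_at_eq: "r \<in> regions G \<Longrightarrow> z \<in> r \<Longrightarrow> region_at G z = r"
  unfolding regions_D region_at_D by (metis components_iff connected_component_eq)

lemma region_at_in: "z \<notin> D \<Longrightarrow> region_at G z \<in> regions G"
  unfolding regions_D region_at_D components_def by blast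

lemma region_nonempty: "r \<in> regions G \<Longrightarrow> \<exists>z. z \<in> r \<and> z \<notin> D"
  unfolding regions_D using in_components_nonempty in_components_subset by blast

lemma connected_in_region:
  assumes "connected A" "A \<subseteq> - D" "z \<in> A"
  shows "A \<subseteq> region_at G z"
  unfolding region_at_D by (rule connected_component_maximal[OF assms(3,1,2)])

lemma semi_sheets_iff: "s \<in> semi_sheets G \<eta> \<longleftrightarrow> (\<exists>q\<in>R. s = sheet q)"
  unfolding semi_sheets_def components_def sheet_at_def by blast

lemma sheet_in: "q \<in> R \<Longrightarrow> sheet q \<in> semi_sheets G \<eta>"
  using semi_sheets_iff by blast

definition region_colour :: "(R3 set \<Rightarrow> 'v) \<Rightarrow> R3 \<Rightarrow> 'v" where
  "region_colour Cr z = Cr (region_at G z)"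

lemma region_colour_connected_constant: "connected_constant (region_colour Cr) (- D)"
  unfolding connected_constant_def constant_on_def
proof (intro allI impI)
  fix A assume A: "connected A \<and> A \<subseteq> - D"
  show "\<exists>y. \<forall>x\<in>A. region_colour Cr x = y"
  proof (cases "A = {}")
    case False
    then obtain a where a: "a \<in> A" by blast
    have eq: "region_at G x = region_at G a" if x: "x \<in> A" for x
    proof -
      have "x \<in> region_at G a" using connected_in_region[of A a] A a x by blast
      then show ?thesis using region_at_eq region_at_in A a by blast
    qed
    have "region_colour Cr x = region_colour Cr a" if "x \<in> A" for x
      unfolding region_colour_def eq[OF that] by (rule refl)
    then show ?thesis by blast
  qed blast
qed

lemma normal_regions_germ:
  assumes n: "normal_crosses G \<eta> q r1 r2" and r: "r1 \<in> regions G" "r2 \<in> regions G"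
  shows "germ (region_colour Cr) q (Cr r1) (Cr r2)"
  by (rule germ_normal[OF n open_UNIV]) (auto simp: region_colour_def region_at_eq[OF r(1)] region_at_eq[OF r(2)])

lemma normal_regions_exist:
  assumes q: "q \<in> R"
  shows "\<exists>r1\<in>regions G. \<exists>r2\<in>regions G. normal_crosses G \<eta> q r1 r2"
proof -
  obtain c \<phi> where c: "rhc c \<phi>" "\<phi> 0 = q" using q by (auto simp: regular_points_def)
  have cont: "continuous_on A \<phi>" for A
    by (rule continuous_on_subset[OF open_embeddingD(1)[OF rhcD(1)[OF c(1)]]]) simp
  have con: "connected (\<phi> ` {x. x $ 3 < 0})" "connected (\<phi> ` {x. 0 < x $ 3})"
    by (intro connected_continuous_image cont convex_connected convex_coord)+
  have sub: "\<phi> ` {x. x $ 3 < 0} \<subseteq> - D" "\<phi> ` {x. 0 < x $ 3} \<subseteq> - D" using rhc_D[OF c(1)] by auto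
  have ax: "- axis 3 1 \<in> {x::R3. x $ 3 < 0}" "axis 3 1 \<in> {x::R3. 0 < x $ 3}" by (simp_all add: axis_def)
  have "\<phi> ` {x. x $ 3 < 0} \<subseteq> region_at G (\<phi> (- axis 3 1))"
    "\<phi> ` {x. 0 < x $ 3} \<subseteq> region_at G (\<phi> (axis 3 1))"
    using connected_in_region[OF con(1) sub(1) imageI[OF ax(1)]] connected_in_region[OF con(2) sub(2) imageI[OF ax(2)]] .
  then have "normal_crosses G \<eta> q (region_at G (\<phi> (- axis 3 1))) (region_at G (\<phi> (axis 3 1)))"
    unfolding normal_crosses_def using c by blast
  moreover have "\<phi> (- axis 3 1) \<notin> D" "\<phi> (axis 3 1) \<notin> D" using rhc_D[OF c(1)] by (simp_all add: axis_def)
  ultimately show ?thesis using region_at_in by blast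
qed

text \<open>The choice is harmless: germs are unique and constant along a semi-sheet, so there is
  only one such pair.\<close>

definition sheet_colour :: "(R3 set \<Rightarrow> 'v) \<Rightarrow> R3 set \<Rightarrow> 'v \<times> 'v" where
  "sheet_colour Cr = (\<lambda>s\<in>semi_sheets G \<eta>. SOME p. \<exists>q\<in>R. s = sheet q \<and> germ (region_colour Cr) q (fst p) (snd p))"

lemma sheet_colour_germ:
  assumes q: "q \<in> R"
  shows "germ (region_colour Cr) q (fst (sheet_colour Cr (sheet q))) (snd (sheet_colour Cr (sheet q)))"
proof -
  have cc: "connected_constant (region_colour Cr) (UNIV - D)" using region_colour_connected_constant by (simp add: Compl_eq_Diff_UNIV)
  define P where "P p \<longleftrightarrow> (\<exists>q'\<in>R. sheet q = sheet q' \<and> germ (region_colour Cr) q' (fst p) (snd p))" for p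
  obtain v w where "germ (region_colour Cr) q v w" by (rule germ_exists[OF cc open_UNIV UNIV_I q]) (rule that)
  then have "P (v, w)" using q by (auto simp: P_def)
  then have "P (SOME p. P p)" by (rule someI)
  moreover have "sheet_colour Cr (sheet q) = (SOME p. P p)"
    using sheet_in[OF q] by (simp add: sheet_colour_def P_def)
  ultimately obtain q' where q': "q' \<in> R" "sheet q = sheet q'"
    "germ (region_colour Cr) q' (fst (sheet_colour Cr (sheet q))) (snd (sheet_colour Cr (sheet q)))"
    unfolding P_def by auto
  have mem: "x \<in> sheet x" if "x \<in> R" for x using that by (simp add: sheet_at_def)
  have s: "connected (sheet q)" "sheet q \<subseteq> R"
    by (auto simp: sheet_at_def dest: connected_component_in)
  show ?thesis
    by (rule germ_propagate[OF s open_UNIV subset_UNIV cc _ q'(3)]) (use mem q q' in auto)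
qed

text \<open>Quadrants are represented by points with coordinates 1 and -1. Each of the four values
  occurs in two of the germs, and these coincidences are the coloring rules at the double
  curve.\<close>

lemma double_chart_germs:
  assumes "double_chart G \<eta> \<phi>" and f: "connected_constant f (- D)"
  shows "germ f (\<phi> (vector [-1, 0, 0])) (f (\<phi> (vector [-1, -1, 0]))) (f (\<phi> (vector [-1, 1, 0])))"
    "germ f (\<phi> (vector [1, 0, 0])) (f (\<phi> (vector [1, -1, 0]))) (f (\<phi> (vector [1, 1, 0])))"
    "germ f (\<phi> (vector [0, -1, 0])) (f (\<phi> (vector [-1, -1, 0]))) (f (\<phi> (vector [1, -1, 0])))"
    "germ f (\<phi> (vector [0, 1, 0])) (f (\<phi> (vector [-1, 1, 0]))) (f (\<phi> (vector [1, 1, 0])))"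
proof -
  obtain h where cc: "crossing_chart G \<eta> {1, 2} \<phi> h" using assms(1) unfolding double_chart_def by blast
  have fc: "connected_constant f (range \<phi> - D)" using f by (rule connected_constant_subset) blast
  have a1: "vector [0, y, z] - axis 1 1 = (vector [-1, y, z] :: R3)" "vector [0, y, z] + axis 1 1 = (vector [1, y, z] :: R3)"
    for y z by (simp_all add: vec3_eq_iff axis_def)
  have a2: "vector [x, 0, z] - axis 2 1 = (vector [x, -1, z] :: R3)" "vector [x, 0, z] + axis 2 1 = (vector [x, 1, z] :: R3)"
    for x z by (simp_all add: vec3_eq_iff axis_def)
  note g = crossing_germ_on[OF cc convex_UNIV open_UNIV fc _ _ _ UNIV_I zero_less_one UNIV_I UNIV_I]
  have "germ f (\<phi> (vector [-1, 0, 0])) (f (\<phi> (vector [-1, 0, 0] - axis 2 1))) (f (\<phi> (vector [-1, 0, 0] + axis 2 1)))"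
    by (rule g) auto
  then show "germ f (\<phi> (vector [-1, 0, 0])) (f (\<phi> (vector [-1, -1, 0]))) (f (\<phi> (vector [-1, 1, 0])))"
    by (simp add: a1 a2)
  have "germ f (\<phi> (vector [1, 0, 0])) (f (\<phi> (vector [1, 0, 0] - axis 2 1))) (f (\<phi> (vector [1, 0, 0] + axis 2 1)))"
    by (rule g) auto
  then show "germ f (\<phi> (vector [1, 0, 0])) (f (\<phi> (vector [1, -1, 0]))) (f (\<phi> (vector [1, 1, 0])))"
    by (simp add: a1 a2)
  have "germ f (\<phi> (vector [0, -1, 0])) (f (\<phi> (vector [0, -1, 0] - axis 1 1))) (f (\<phi> (vector [0, -1, 0] + axis 1 1)))"
    by (rule g) auto
  then show "germ f (\<phi> (vector [0, -1, 0])) (f (\<phi> (vector [-1, -1, 0]))) (f (\<phi> (vector [1, -1, 0])))"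
    by (simp add: a1 a2)
  have "germ f (\<phi> (vector [0, 1, 0])) (f (\<phi> (vector [0, 1, 0] - axis 1 1))) (f (\<phi> (vector [0, 1, 0] + axis 1 1)))"
    by (rule g) auto
  then show "germ f (\<phi> (vector [0, 1, 0])) (f (\<phi> (vector [-1, 1, 0]))) (f (\<phi> (vector [1, 1, 0])))"
    by (simp add: a1 a2)
qed

lemma triple_chart_germs:
  assumes "triple_chart G \<eta> \<phi>" and f: "connected_constant f (- D)"
  shows "germ f (\<phi> (vector [-1, -1, 0])) (f (\<phi> (vector [-1, -1, -1]))) (f (\<phi> (vector [-1, -1, 1])))"
    "germ f (\<phi> (vector [-1, 0, -1])) (f (\<phi> (vector [-1, -1, -1]))) (f (\<phi> (vector [-1, 1, -1])))"
    "germ f (\<phi> (vector [0, -1, -1])) (f (\<phi> (vector [-1, -1, -1]))) (f (\<phi> (vector [1, -1, -1])))"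
    "\<phi> (vector [-1, -1, -1]) \<notin> D"
proof -
  obtain h where cc: "crossing_chart G \<eta> {1, 2, 3} \<phi> h" using assms(1) unfolding triple_chart_def by blast
  have fc: "connected_constant f (range \<phi> - D)" using f by (rule connected_constant_subset) blast
  have a: "vector [0, y, z] - axis 1 1 = (vector [-1, y, z] :: R3)" "vector [0, y, z] + axis 1 1 = (vector [1, y, z] :: R3)"
    "vector [y, 0, z] - axis 2 1 = (vector [y, -1, z] :: R3)" "vector [y, 0, z] + axis 2 1 = (vector [y, 1, z] :: R3)"
    "vector [y, z, 0] - axis 3 1 = (vector [y, z, -1] :: R3)" "vector [y, z, 0] + axis 3 1 = (vector [y, z, 1] :: R3)"
    for y z by (simp_all add: vec3_eq_iff axis_def)
  note g = crossing_germ_on[OF cc convex_UNIV open_UNIV fc _ _ _ UNIV_I zero_less_one UNIV_I UNIV_I]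
  have "germ f (\<phi> (vector [-1, -1, 0])) (f (\<phi> (vector [-1, -1, 0] - axis 3 1))) (f (\<phi> (vector [-1, -1, 0] + axis 3 1)))"
    by (rule g) auto
  then show "germ f (\<phi> (vector [-1, -1, 0])) (f (\<phi> (vector [-1, -1, -1]))) (f (\<phi> (vector [-1, -1, 1])))"
    by (simp add: a)
  have "germ f (\<phi> (vector [-1, 0, -1])) (f (\<phi> (vector [-1, 0, -1] - axis 2 1))) (f (\<phi> (vector [-1, 0, -1] + axis 2 1)))"
    by (rule g) auto
  then show "germ f (\<phi> (vector [-1, 0, -1])) (f (\<phi> (vector [-1, -1, -1]))) (f (\<phi> (vector [-1, 1, -1])))"
    by (simp add: a)
  have "germ f (\<phi> (vector [0, -1, -1])) (f (\<phi> (vector [0, -1, -1] - axis 1 1))) (f (\<phi> (vector [0, -1, -1] + axis 1 1)))"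
    by (rule g) auto
  then show "germ f (\<phi> (vector [0, -1, -1])) (f (\<phi> (vector [-1, -1, -1]))) (f (\<phi> (vector [1, -1, -1])))"
    by (simp add: a)
  show "\<phi> (vector [-1, -1, -1]) \<notin> D" using crossing_chart_D[OF cc] by simp
qed

lemma germ_in_R: "germ f q v w \<Longrightarrow> q \<in> R"
  unfolding germ_def regular_points_def by blast

lemma germ_determines_global:
  assumes "connected_constant f (- D)" "connected_constant g (- D)"
    and "\<And>q. q \<in> R \<Longrightarrow> \<exists>v w. germ f q v w \<and> germ g q v w" and "z \<notin> D"
  shows "f z = g z"
  by (rule germ_determines[of UNIV]) (use assms nonempty_D in \<open>auto simp: Compl_eq_Diff_UNIV[symmetric]\<close>)

lemma connected_constant_comp: "connected_constant f A \<Longrightarrow> connected_constant (\<lambda>z. h (f z)) A"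
  unfolding connected_constant_def constant_on_def by metis

lemma germ_comp: "germ f q v w \<Longrightarrow> germ (\<lambda>z. h (f z)) q (h v) (h w)"
  unfolding germ_def by metis

text \<open>The truth value of \<open>f z \<in> X\<close> is a locally constant function with the
  same germs as the constant \<open>True\<close>.\<close>

lemma germ_values_in:
  assumes f: "connected_constant f (- D)" and q: "\<And>q. q \<in> R \<Longrightarrow> \<exists>v\<in>X. \<exists>w\<in>X. germ f q v w" and z: "z \<notin> D"
  shows "f z \<in> X"
proof -
  have "(f z \<in> X) = True"
  proof (rule germ_determines_global[where f = "\<lambda>z. f z \<in> X" and g = "\<lambda>_. True"])
    show "connected_constant (\<lambda>z. f z \<in> X) (- D)" by (rule connected_constant_comp[OF f])
    show "connected_constant (\<lambda>_. True) (- D)" by (auto simp: connected_constant_def constant_on_def)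
    fix q assume qR: "q \<in> R"
    then obtain v w where vw: "v \<in> X" "w \<in> X" "germ f q v w" using q by blast
    have "germ (\<lambda>z. f z \<in> X) q True True" using germ_comp[OF vw(3), of "\<lambda>v. v \<in> X"] vw by simp
    moreover have "germ (\<lambda>_. True) q True True" using germ_comp[OF vw(3), of "\<lambda>_. True"] .
    ultimately show "\<exists>v w. germ (\<lambda>z. f z \<in> X) q v w \<and> germ (\<lambda>_. True) q v w" by blast
  qed (rule z)
  then show ?thesis by simp
qed

end

section \<open>The correspondence of colorings\<close>

locale coloured_diagram = connected_shadow B ud ov X act br + diagram G \<eta>
  for B :: "'b set" and ud ov :: "'b \<Rightarrow> 'b \<Rightarrow> 'b" and X :: "'x set" and act :: "'x \<Rightarrow> 'b \<Rightarrow> 'x"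
    and br :: "'x \<Rightarrow> 'x \<Rightarrow> 'x \<Rightarrow> 'x" and G :: "R4 set" and \<eta> :: "(real^2 \<Rightarrow> R4) set"
begin

lemma arrow_in:
  assumes "x \<in> X" "y \<in> X"
  shows "arrow B act x y \<in> B" "act x (arrow B act x y) = y"
proof -
  obtain a where "a \<in> B" "act x a = y" using strongD[OF assms(1)] assms(2) unfolding bij_betw_def by blast
  then show "arrow B act x y \<in> B" "act x (arrow B act x y) = y" using arrow_act[OF assms(1)] by auto
qed

lemma double_chart_sheets:
  assumes "double_chart G \<eta> \<phi>"
  shows "sheet_u1 G \<eta> \<phi> \<in> semi_sheets G \<eta>" "sheet_u2 G \<eta> \<phi> \<in> semi_sheets G \<eta>"
    "sheet_o1 G \<eta> \<phi> \<in> semi_sheets G \<eta>" "sheet_o2 G \<eta> \<phi> \<in> semi_sheets G \<eta>"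
proof -
  have "connected_constant (\<lambda>_. ()) (- D)" by (auto simp: connected_constant_def constant_on_def)
  note g = double_chart_germs[OF assms this, THEN germ_in_R, THEN sheet_in]
  show "sheet_u1 G \<eta> \<phi> \<in> semi_sheets G \<eta>" "sheet_u2 G \<eta> \<phi> \<in> semi_sheets G \<eta>"
    "sheet_o1 G \<eta> \<phi> \<in> semi_sheets G \<eta>" "sheet_o2 G \<eta> \<phi> \<in> semi_sheets G \<eta>"
    unfolding sheet_u1_def sheet_u2_def sheet_o1_def sheet_o2_def by (rule g)+
qed

lemma Col_SB_D:
  assumes "(Cs, Cr) \<in> Col_SB B X ud ov act G \<eta>"
  shows "Cs \<in> semi_sheets G \<eta> \<rightarrow>\<^sub>E B" "Cr \<in> regions G \<rightarrow>\<^sub>E X"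
    "double_chart G \<eta> \<phi> \<Longrightarrow> Cs (sheet_u2 G \<eta> \<phi>) = ud (Cs (sheet_u1 G \<eta> \<phi>)) (Cs (sheet_o1 G \<eta> \<phi>))"
    "double_chart G \<eta> \<phi> \<Longrightarrow> Cs (sheet_o2 G \<eta> \<phi>) = ov (Cs (sheet_o1 G \<eta> \<phi>)) (Cs (sheet_u1 G \<eta> \<phi>))"
    "s \<in> semi_sheets G \<eta> \<Longrightarrow> r1 \<in> regions G \<Longrightarrow> r2 \<in> regions G \<Longrightarrow> q \<in> s \<Longrightarrow>
       normal_crosses G \<eta> q r1 r2 \<Longrightarrow> act (Cr r1) (Cs s) = Cr r2"
proof -
  note * = assms[unfolded Col_SB_def mem_Collect_eq prod.case]
  show "Cs \<in> semi_sheets G \<eta> \<rightarrow>\<^sub>E B" using * by (elim conjE)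
  show "Cr \<in> regions G \<rightarrow>\<^sub>E X" using * by (elim conjE)
  have "\<forall>\<phi>. double_chart G \<eta> \<phi> \<longrightarrow>
           Cs (sheet_u2 G \<eta> \<phi>) = ud (Cs (sheet_u1 G \<eta> \<phi>)) (Cs (sheet_o1 G \<eta> \<phi>)) \<and>
           Cs (sheet_o2 G \<eta> \<phi>) = ov (Cs (sheet_o1 G \<eta> \<phi>)) (Cs (sheet_u1 G \<eta> \<phi>))"
    using * by (elim conjE)
  then show "double_chart G \<eta> \<phi> \<Longrightarrow> Cs (sheet_u2 G \<eta> \<phi>) = ud (Cs (sheet_u1 G \<eta> \<phi>)) (Cs (sheet_o1 G \<eta> \<phi>))"
    "double_chart G \<eta> \<phi> \<Longrightarrow> Cs (sheet_o2 G \<eta> \<phi>) = ov (Cs (sheet_o1 G \<eta> \<phi>)) (Cs (sheet_u1 G \<eta> \<phi>))"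
    by simp_all
  have "\<forall>s\<in>semi_sheets G \<eta>. \<forall>r1\<in>regions G. \<forall>r2\<in>regions G.
           (\<exists>q\<in>s. normal_crosses G \<eta> q r1 r2) \<longrightarrow> act (Cr r1) (Cs s) = Cr r2"
    using * by (elim conjE)
  then show "s \<in> semi_sheets G \<eta> \<Longrightarrow> r1 \<in> regions G \<Longrightarrow> r2 \<in> regions G \<Longrightarrow> q \<in> s \<Longrightarrow>
       normal_crosses G \<eta> q r1 r2 \<Longrightarrow> act (Cr r1) (Cs s) = Cr r2" by blast
qed

text \<open>The dictionary between the two kinds of colors: a biquandle color \<open>a\<close> next
  to a region of color \<open>v\<close> becomes the pair \<open>(v, act v a)\<close>, as in the
  definition of \<open>mu_chain\<close>.\<close>

lemma sheet_colour_value: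
  assumes C: "(Cs, Cr) \<in> Col_SB B X ud ov act G \<eta>" and g: "germ (region_colour Cr) q v w"
  shows "sheet_colour Cr (sheet q) = (v, w)" "v \<in> X" "w \<in> X" "Cs (sheet q) \<in> B" "act v (Cs (sheet q)) = w"
proof -
  have q: "q \<in> R" by (rule germ_in_R[OF g])
  obtain r1 r2 where r: "r1 \<in> regions G" "r2 \<in> regions G" "normal_crosses G \<eta> q r1 r2"
    using normal_regions_exist[OF q] by blast
  have "germ (region_colour Cr) q (Cr r1) (Cr r2)" by (rule normal_regions_germ[OF r(3,1,2)])
  then have vw: "v = Cr r1" "w = Cr r2" using germ_unique[OF g] by blast+
  show "v \<in> X" "w \<in> X" unfolding vw using Col_SB_D(2)[OF C] r by blast+
  show "Cs (sheet q) \<in> B" using Col_SB_D(1)[OF C] sheet_in[OF q] by blast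
  have "q \<in> sheet q" using q by (simp add: sheet_at_def)
  then show "act v (Cs (sheet q)) = w" unfolding vw by (rule Col_SB_D(5)[OF C sheet_in[OF q] r(1,2) _ r(3)])
  show "sheet_colour Cr (sheet q) = (v, w)"
    using germ_unique[OF g sheet_colour_germ[OF q]] by (simp add: prod_eq_iff)
qed

lemma sheet_colour_Col_LB:
  assumes C: "(Cs, Cr) \<in> Col_SB B X ud ov act G \<eta>"
  shows "sheet_colour Cr \<in> Col_LB X br G \<eta>"
  unfolding Col_LB_def mem_Collect_eq
proof (intro conjI allI impI)
  show "sheet_colour Cr \<in> semi_sheets G \<eta> \<rightarrow>\<^sub>E X \<times> X"
  proof (rule PiE_I)
    fix s assume "s \<in> semi_sheets G \<eta>"
    then obtain q where q: "q \<in> R" "s = sheet q" using semi_sheets_iff by blast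
    show "sheet_colour Cr s \<in> X \<times> X"
      using sheet_colour_value(2,3)[OF C sheet_colour_germ[OF q(1)]] unfolding q(2) by (simp add: mem_Times_iff)
  qed (simp add: sheet_colour_def)
  fix \<phi> assume d: "double_chart G \<eta> \<phi>"
  let ?f = "region_colour Cr"
  note g = double_chart_germs[OF d region_colour_connected_constant[of Cr]]
  note u1 = sheet_colour_value[OF C g(1), folded sheet_u1_def]
  note u2 = sheet_colour_value[OF C g(2), folded sheet_u2_def]
  note o1 = sheet_colour_value[OF C g(3), folded sheet_o1_def]
  note o2 = sheet_colour_value[OF C g(4), folded sheet_o2_def]
  show "fst (sheet_colour Cr (sheet_u1 G \<eta> \<phi>)) = fst (sheet_colour Cr (sheet_o1 G \<eta> \<phi>))"
    unfolding u1(1) o1(1) by simp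
  \<comment> \<open>The tribracket of the three colors around the negative quadrant is the color of
    the opposite quadrant: the latter is reached by crossing the half \<open>u2\<close> of the
    under-sheet, whose color is \<open>ud\<close> of the colors of \<open>u1\<close> and
    \<open>o1\<close>.\<close>
  have "br (?f (\<phi> (vector [-1, -1, 0]))) (?f (\<phi> (vector [-1, 1, 0]))) (?f (\<phi> (vector [1, -1, 0])))
     = act (?f (\<phi> (vector [1, -1, 0]))) (ud (Cs (sheet_u1 G \<eta> \<phi>)) (Cs (sheet_o1 G \<eta> \<phi>)))"
    using br_act(2)[OF u1(2,4) o1(4)] unfolding u1(5) o1(5) .
  also have "\<dots> = ?f (\<phi> (vector [1, 1, 0]))"
    using u2(5) unfolding Col_SB_D(3)[OF C d] .
  finally have br: "br (?f (\<phi> (vector [-1, -1, 0]))) (?f (\<phi> (vector [-1, 1, 0]))) (?f (\<phi> (vector [1, -1, 0])))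
     = ?f (\<phi> (vector [1, 1, 0]))" .
  show "sheet_colour Cr (sheet_u2 G \<eta> \<phi>) =
      lb_ud br (sheet_colour Cr (sheet_u1 G \<eta> \<phi>)) (sheet_colour Cr (sheet_o1 G \<eta> \<phi>))"
    unfolding u1(1) o1(1) u2(1) lb_ud_def by (simp add: br)
  show "sheet_colour Cr (sheet_o2 G \<eta> \<phi>) =
      lb_ov br (sheet_colour Cr (sheet_o1 G \<eta> \<phi>)) (sheet_colour Cr (sheet_u1 G \<eta> \<phi>))"
    unfolding u1(1) o1(1) o2(1) lb_ov_def by (simp add: br)
qed

text \<open>The pair on a sheet determines its biquandle color because \<open>act x\<close> is
  injective on \<open>B\<close>, and the region colors are determined by their germs.\<close>

lemma sheet_colour_inj: "inj_on (\<lambda>C. sheet_colour (snd C)) (Col_SB B X ud ov act G \<eta>)"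
proof (rule inj_onI, clarify)
  fix Cs Cr Cs' Cr'
  assume C: "(Cs, Cr) \<in> Col_SB B X ud ov act G \<eta>" and C': "(Cs', Cr') \<in> Col_SB B X ud ov act G \<eta>"
    and "sheet_colour (snd (Cs, Cr)) = sheet_colour (snd (Cs', Cr'))"
  then have eq: "sheet_colour Cr = sheet_colour Cr'" by simp
  have Cs: "Cs s = Cs' s" if s: "s \<in> semi_sheets G \<eta>" for s
  proof -
    obtain q where q: "q \<in> R" "s = sheet q" using s semi_sheets_iff by blast
    note v = sheet_colour_value[OF C sheet_colour_germ[OF q(1)], folded q(2)]
    note v' = sheet_colour_value[OF C' sheet_colour_germ[OF q(1)], folded q(2), folded eq]
    have "act (fst (sheet_colour Cr s)) (Cs s) = act (fst (sheet_colour Cr s)) (Cs' s)"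
      unfolding v(5) v'(5) ..
    then show ?thesis using strongD[OF v(2)] v(4) v'(4) unfolding bij_betw_def inj_on_def by blast
  qed
  have Cr: "Cr r = Cr' r" if r: "r \<in> regions G" for r
  proof -
    obtain z where z: "z \<in> r" "z \<notin> D" using region_nonempty[OF r] by blast
    have "region_colour Cr z = region_colour Cr' z"
    proof (rule germ_determines_global[OF region_colour_connected_constant region_colour_connected_constant _ z(2)])
      fix q assume "q \<in> R"
      from sheet_colour_germ[OF this, of Cr] sheet_colour_germ[OF this, of Cr', folded eq]
      show "\<exists>v w. germ (region_colour Cr) q v w \<and> germ (region_colour Cr') q v w" by blast
    qed
    then show ?thesis by (simp add: region_colour_def region_at_eq[OF r z(1)])
  qed
  show "Cs = Cs' \<and> Cr = Cr'"
    using PiE_ext[OF Col_SB_D(1)[OF C] Col_SB_D(1)[OF C'] Cs] PiE_ext[OF Col_SB_D(2)[OF C] Col_SB_D(2)[OF C'] Cr]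
    by blast
qed

lemma sheet_colour_surj:
  assumes L: "L \<in> Col_LB X br G \<eta>"
  shows "\<exists>C\<in>Col_SB B X ud ov act G \<eta>. sheet_colour (snd C) = L"
proof -
  have LE: "L \<in> semi_sheets G \<eta> \<rightarrow>\<^sub>E X \<times> X" using L by (simp add: Col_LB_def)
  have LX: "fst (L s) \<in> X" "snd (L s) \<in> X" if "s \<in> semi_sheets G \<eta>" for s
    using PiE_mem[OF LE that] by (auto simp: mem_Times_iff)
  have Ld: "fst (L (sheet_u1 G \<eta> \<phi>)) = fst (L (sheet_o1 G \<eta> \<phi>))"
    "L (sheet_u2 G \<eta> \<phi>) = lb_ud br (L (sheet_u1 G \<eta> \<phi>)) (L (sheet_o1 G \<eta> \<phi>))"
    "L (sheet_o2 G \<eta> \<phi>) = lb_ov br (L (sheet_o1 G \<eta> \<phi>)) (L (sheet_u1 G \<eta> \<phi>))"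
    if "double_chart G \<eta> \<phi>" for \<phi> using L that unfolding Col_LB_def by blast+
  have "consistent L" unfolding consistent_def
    \<comment> \<open>The last equation of consistency holds because \<open>lb_ov\<close> exchanges
      the last two arguments of the bracket, so both rules produce the same second
      component.\<close>
    using Ld by (simp add: lb_ud_def lb_ov_def)
  then obtain F where F: "connected_constant F (- D)" "\<And>q. q \<in> R \<Longrightarrow> germ F q (fst (L (sheet q))) (snd (L (sheet q)))"
    by (rule global_section) (rule that)
  have FX: "F z \<in> X" if z: "z \<notin> D" for z
  proof (rule germ_values_in[OF F(1) _ z])
    fix q assume q: "q \<in> R"
    show "\<exists>v\<in>X. \<exists>w\<in>X. germ F q v w" using F(2)[OF q] LX[OF sheet_in[OF q]] by blast
  qed
  define Cr where "Cr = (\<lambda>r\<in>regions G. F (SOME z. z \<in> r))"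
  define Cs where "Cs = (\<lambda>s\<in>semi_sheets G \<eta>. arrow B act (fst (L s)) (snd (L s)))"
  have some: "(SOME z. z \<in> r) \<in> r" "(SOME z. z \<in> r) \<notin> D" if r: "r \<in> regions G" for r
  proof -
    show "(SOME z. z \<in> r) \<in> r" using region_nonempty[OF r] someI_ex by metis
    then show "(SOME z. z \<in> r) \<notin> D" using r in_components_subset unfolding regions_D by blast
  qed
  have rc: "region_colour Cr z = F z" if z: "z \<notin> D" for z
  proof -
    have r: "region_at G z \<in> regions G" by (rule region_at_in[OF z])
    have con: "connected (region_at G z)" and sub: "region_at G z \<subseteq> - D"
      using r in_components_connected in_components_subset unfolding regions_D by blast+
    have "z \<in> region_at G z" using z unfolding region_at_D by simp
    then have "F (SOME y. y \<in> region_at G z) = F z" by (rule connected_constantD[OF F(1) con sub some(1)[OF r]])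
    then show ?thesis using r by (simp add: region_colour_def Cr_def)
  qed
  have g: "germ (region_colour Cr) q (fst (L (sheet q))) (snd (L (sheet q)))" if "q \<in> R" for q
    by (rule germ_cong[OF F(2)[OF that] open_UNIV UNIV_I]) (simp add: rc)
  have "(Cs, Cr) \<in> Col_SB B X ud ov act G \<eta>"
    unfolding Col_SB_def mem_Collect_eq prod.case
  proof (intro conjI allI impI ballI)
    show "Cs \<in> semi_sheets G \<eta> \<rightarrow>\<^sub>E B" unfolding Cs_def by (auto intro!: arrow_in LX)
    show "Cr \<in> regions G \<rightarrow>\<^sub>E X" unfolding Cr_def by (auto intro!: FX some(2))
  next
    fix \<phi> assume d: "double_chart G \<eta> \<phi>"
    note S = double_chart_sheets[OF d]
    define x y z where "x = fst (L (sheet_o1 G \<eta> \<phi>))" and "y = snd (L (sheet_u1 G \<eta> \<phi>))"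
      and "z = snd (L (sheet_o1 G \<eta> \<phi>))"
    have X: "x \<in> X" "y \<in> X" "z \<in> X" unfolding x_def y_def z_def using LX S by blast+
    define a b where "a = arrow B act x y" and "b = arrow B act x z"
    have ab: "a \<in> B" "b \<in> B" "act x a = y" "act x b = z" unfolding a_def b_def using arrow_in X by blast+
    have br: "br x y z = act y (ov b a)" "br x y z = act z (ud a b)"
      using br_act[OF X(1) ab(1,2)] unfolding ab(3,4) by blast+
    have u1: "Cs (sheet_u1 G \<eta> \<phi>) = a" using S Ld(1)[OF d] by (simp add: Cs_def a_def x_def y_def)
    have o1: "Cs (sheet_o1 G \<eta> \<phi>) = b" using S by (simp add: Cs_def b_def x_def z_def)
    have "Cs (sheet_u2 G \<eta> \<phi>) = arrow B act z (br x y z)"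
      using S Ld(1)[OF d] by (simp add: Cs_def Ld(2)[OF d] lb_ud_def x_def y_def z_def)
    then show "Cs (sheet_u2 G \<eta> \<phi>) = ud (Cs (sheet_u1 G \<eta> \<phi>)) (Cs (sheet_o1 G \<eta> \<phi>))"
      using arrow_act[OF X(3) ud_closed[OF ab(1,2)]] by (simp add: u1 o1 br(2))
    have "Cs (sheet_o2 G \<eta> \<phi>) = arrow B act y (br x y z)"
      using S by (simp add: Cs_def Ld(3)[OF d] lb_ov_def x_def y_def z_def)
    then show "Cs (sheet_o2 G \<eta> \<phi>) = ov (Cs (sheet_o1 G \<eta> \<phi>)) (Cs (sheet_u1 G \<eta> \<phi>))"
      using arrow_act[OF X(2) ov_closed[OF ab(2,1)]] by (simp add: u1 o1 br(1))
  next
    fix s r1 r2 assume s: "s \<in> semi_sheets G \<eta>" and r: "r1 \<in> regions G" "r2 \<in> regions G"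
      and "\<exists>q\<in>s. normal_crosses G \<eta> q r1 r2"
    then obtain q where q: "q \<in> s" "normal_crosses G \<eta> q r1 r2" by blast
    have qR: "q \<in> R" by (rule normal_crosses_regular[OF q(2)])
    obtain q' where "q' \<in> R" "s = sheet q'" using s semi_sheets_iff by blast
    then have sq: "s = sheet q" using q(1) connected_component_eq unfolding sheet_at_def by metis
    have "Cr r1 = fst (L s)" "Cr r2 = snd (L s)"
      using germ_unique[OF normal_regions_germ[OF q(2) r] g[OF qR]] unfolding sq by blast+
    then show "act (Cr r1) (Cs s) = Cr r2"
      using arrow_in(2)[OF LX[OF s]] s by (simp add: Cs_def)
  qed
  moreover have "sheet_colour Cr = L"
  proof (rule PiE_ext[OF _ LE])
    show "sheet_colour Cr \<in> semi_sheets G \<eta> \<rightarrow>\<^sub>E X \<times> X"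
      using sheet_colour_Col_LB[OF calculation] by (simp add: Col_LB_def)
    fix s assume "s \<in> semi_sheets G \<eta>"
    then obtain q where q: "q \<in> R" "s = sheet q" using semi_sheets_iff by blast
    show "sheet_colour Cr s = L s"
      using germ_unique[OF sheet_colour_germ[OF q(1)] g[OF q(1)]] unfolding q(2) by (simp add: prod_eq_iff)
  qed
  ultimately show ?thesis by force
qed

lemma sheet_colour_bij:
  "bij_betw (\<lambda>C. sheet_colour (snd C)) (Col_SB B X ud ov act G \<eta>) (Col_LB X br G \<eta>)"
  unfolding bij_betw_def
proof
  show "(\<lambda>C. sheet_colour (snd C)) ` Col_SB B X ud ov act G \<eta> = Col_LB X br G \<eta>"
  proof
    show "(\<lambda>C. sheet_colour (snd C)) ` Col_SB B X ud ov act G \<eta> \<subseteq> Col_LB X br G \<eta>"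
      using sheet_colour_Col_LB by auto
    show "Col_LB X br G \<eta> \<subseteq> (\<lambda>C. sheet_colour (snd C)) ` Col_SB B X ud ov act G \<eta>"
      using sheet_colour_surj by blast
  qed
qed (rule sheet_colour_inj)

section \<open>The chains of corresponding colorings\<close>

lemma W_correspond:
  assumes C: "C \<in> Col_SB B X ud ov act G \<eta>"
  shows "W_SB B X G \<eta> C \<in> carrier (C_SB B X 3)"
    "mu X act 3 (W_SB B X G \<eta> C) = W_LB X G \<eta> (sheet_colour (snd C))"
proof -
  obtain Cs Cr where CC: "C = (Cs, Cr)" by (cases C)
  note C = C[unfolded CC]
  define T where "T = triple_points G \<eta>"
  define sgn' where "sgn' \<tau> = triple_sign G \<eta> \<tau>" for \<tau>
  define base where "base \<tau> = (Cr (triple_r1 G \<eta> \<tau>),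
      [Cs (triple_b1 G \<eta> \<tau>), Cs (triple_m1 G \<eta> \<tau>), Cs (triple_t1 G \<eta> \<tau>)])" for \<tau>
  have base: "base \<tau> \<in> sb_basis B X 3"
    "map (\<lambda>a. (fst (base \<tau>), act (fst (base \<tau>)) a)) (snd (base \<tau>)) =
      [sheet_colour Cr (triple_b1 G \<eta> \<tau>), sheet_colour Cr (triple_m1 G \<eta> \<tau>), sheet_colour Cr (triple_t1 G \<eta> \<tau>)]"
    if "\<tau> \<in> T" for \<tau>
  proof -
    define \<phi> where "\<phi> = chart_at_triple G \<eta> \<tau>"
    have "\<exists>\<phi>. triple_chart G \<eta> \<phi> \<and> \<phi> 0 = \<tau>" using that by (auto simp: T_def triple_points_def)
    then have \<phi>: "triple_chart G \<eta> \<phi>" unfolding \<phi>_def chart_at_triple_def by (metis (mono_tags, lifting) someI_ex)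
    \<comment> \<open>All three germs start in the octant of negative coordinates, that is in
      \<open>triple_r1\<close>. So the three pairs share their first component, as a basis element
      of the local complex requires.\<close>
    note g = triple_chart_germs[OF \<phi> region_colour_connected_constant[of Cr]]
    have x: "region_colour Cr (\<phi> (vector [-1, -1, -1])) = Cr (triple_r1 G \<eta> \<tau>)"
      by (simp add: region_colour_def triple_r1_def \<phi>_def)
    have s: "sheet (\<phi> (vector [-1, -1, 0])) = triple_b1 G \<eta> \<tau>" "sheet (\<phi> (vector [-1, 0, -1])) = triple_m1 G \<eta> \<tau>"
      "sheet (\<phi> (vector [0, -1, -1])) = triple_t1 G \<eta> \<tau>"
      by (simp_all add: triple_b1_def triple_m1_def triple_t1_def \<phi>_def)
    note b = sheet_colour_value[OF C g(1), unfolded s x] and m = sheet_colour_value[OF C g(2), unfolded s x]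
      and t = sheet_colour_value[OF C g(3), unfolded s x]
    show "base \<tau> \<in> sb_basis B X 3" using b m t by (simp add: base_def sb_basis_def)
    show "map (\<lambda>a. (fst (base \<tau>), act (fst (base \<tau>)) a)) (snd (base \<tau>)) =
      [sheet_colour Cr (triple_b1 G \<eta> \<tau>), sheet_colour Cr (triple_m1 G \<eta> \<tau>), sheet_colour Cr (triple_t1 G \<eta> \<tau>)]"
      unfolding b(1) m(1) t(1) using b(5) m(5) t(5) by (simp add: base_def)
  qed
  define S where "S = (\<Sum>\<tau>\<in>T. frag_cmul (sgn' \<tau>) (frag_of (base \<tau>)))"
  have W: "W_SB B X G \<eta> C = D_sb B X 3 #>\<^bsub>C_sb B X 3\<^esub> S"
    by (simp add: W_SB_def S_def CC T_def sgn'_def base_def)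
  have "Poly_Mapping.keys S \<subseteq> (\<Union>\<tau>\<in>T. Poly_Mapping.keys (frag_cmul (sgn' \<tau>) (frag_of (base \<tau>))))"
    unfolding S_def by (rule keys_sum)
  also have "\<dots> \<subseteq> sb_basis B X 3"
  proof (rule UN_least)
    fix \<tau> assume "\<tau> \<in> T"
    then show "Poly_Mapping.keys (frag_cmul (sgn' \<tau>) (frag_of (base \<tau>))) \<subseteq> sb_basis B X 3"
      using base(1)[of \<tau>] keys_cmul[of "sgn' \<tau>" "frag_of (base \<tau>)"] by auto
  qed
  finally have S: "S \<in> carrier (C_sb B X 3)" by (simp add: C_sb_def)
  show "W_SB B X G \<eta> C \<in> carrier (C_SB B X 3)"
    unfolding W C_SB_def carrier_Mod using S by blast
  have "mu_chain act S = (\<Sum>\<tau>\<in>T. frag_cmul (sgn' \<tau>)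
      (frag_of [sheet_colour Cr (triple_b1 G \<eta> \<tau>), sheet_colour Cr (triple_m1 G \<eta> \<tau>), sheet_colour Cr (triple_t1 G \<eta> \<tau>)]))"
  \<comment> \<open>A sum over an infinite set is 0 by convention, on both sides alike.\<close>
  proof (cases "finite T")
    case True
    have "mu_chain act S = (\<Sum>\<tau>\<in>T. frag_cmul (sgn' \<tau>)
      (frag_of (map (\<lambda>a. (fst (base \<tau>), act (fst (base \<tau>)) a)) (snd (base \<tau>)))))"
      unfolding S_def mu_chain_alt using True
      by (simp add: frag_extend_sum frag_extend_cmul comp_def case_prod_unfold)
    also have "\<dots> = (\<Sum>\<tau>\<in>T. frag_cmul (sgn' \<tau>)
      (frag_of [sheet_colour Cr (triple_b1 G \<eta> \<tau>), sheet_colour Cr (triple_m1 G \<eta> \<tau>), sheet_colour Cr (triple_t1 G \<eta> \<tau>)]))"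
      by (rule sum.cong[OF refl]) (simp only: base(2))
    finally show ?thesis .
  next
    case False
    then show ?thesis by (simp add: S_def mu_chain_def)
  qed
  then show "mu X act 3 (W_SB B X G \<eta> C) = W_LB X G \<eta> (sheet_colour (snd C))"
    unfolding W mu_coset[OF S] by (simp add: W_LB_def CC T_def sgn'_def)
qed

text \<open>The second equation inverts \<open>mu_star\<close> on the quotient of all chains by the
  boundaries, where \<open>mu_star_inv\<close> is defined; the class lies there because
  \<open>W_SB\<close> is a chain.\<close>

lemma homology_correspond:
  assumes C: "C \<in> Col_SB B X ud ov act G \<eta>"
  shows "homology_class (C_LB X) (bd_LB X br) 3 (W_LB X G \<eta> (sheet_colour (snd C)))
       = mu_star X br act 3 (homology_class (C_SB B X) (bd_SB B X ud ov act) 3 (W_SB B X G \<eta> C))"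
    "mu_star_inv B X ud ov br act 3
       (homology_class (C_LB X) (bd_LB X br) 3 (W_LB X G \<eta> (sheet_colour (snd C))))
       = homology_class (C_SB B X) (bd_SB B X ud ov act) 3 (W_SB B X G \<eta> C)"
proof -
  note W = W_correspond[OF C]
  show 1: "homology_class (C_LB X) (bd_LB X br) 3 (W_LB X G \<eta> (sheet_colour (snd C)))
       = mu_star X br act 3 (homology_class (C_SB B X) (bd_SB B X ud ov act) 3 (W_SB B X G \<eta> C))"
    unfolding homology_class_def mu_star_coset[OF W(1)] W(2) ..
  have "homology_class (C_SB B X) (bd_SB B X ud ov act) 3 (W_SB B X G \<eta> C) \<in> carrier (C_SB B X 3 Mod bim_SB 3)"
    unfolding homology_class_def carrier_Mod using W(1) by blast
  then show "mu_star_inv B X ud ov br act 3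
       (homology_class (C_LB X) (bd_LB X br) 3 (W_LB X G \<eta> (sheet_colour (snd C))))
       = homology_class (C_SB B X) (bd_SB B X ud ov act) 3 (W_SB B X G \<eta> C)"
    unfolding 1 mu_star_inv_def using mu_star_bij_quotient[of 3]
    by (intro inv_into_f_f) (auto simp: bij_betw_def)
qed

end

lemma diagram_of_surface_link:
  assumes F: "surface_link F \<omega>" and D: "connected_diagram_of F \<omega> G \<eta>"
  shows "diagram G \<eta>"
proof -
  obtain H :: "real \<Rightarrow> R4 \<Rightarrow> R4" where H: "continuous_on ({0..1} \<times> UNIV) (\<lambda>(t, v). H t v)"
    "G = H 1 ` F" "\<eta> = (\<lambda>c. H 1 \<circ> c) ` \<omega>"
    using D unfolding connected_diagram_of_def ambient_isotopic_def by blast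
  have F': "F \<noteq> {}" "compact F" "(\<Union>c\<in>\<omega>. range c) = F"
    using F oriented_atlasD(3) unfolding surface_link_def by auto
  have "continuous_on UNIV (\<lambda>v. (\<lambda>(t, v). H t v) (1, v))"
    by (rule continuous_on_compose2[OF H(1)]) (auto intro!: continuous_intros)
  then have cH: "continuous_on F (H 1)" by (auto intro: continuous_on_subset)
  show ?thesis
  proof
    show "G = (\<Union>c\<in>\<eta>. range c)" unfolding H(2,3) F'(3)[symmetric] by auto
    show "compact G" unfolding H(2) by (rule compact_continuous_image[OF cH F'(2)])
    show "G \<noteq> {}" using F'(1) H(2) by simp
    show "regular_projection G \<eta>" "connected (fst ` G)" using D unfolding connected_diagram_of_def by blast+
  qed
qed

theorem theorem4p8:
  fixes F :: "R4 set" and \<omega> :: "(real^2 \<Rightarrow> R4) set"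
    and G :: "R4 set" and \<eta> :: "(real^2 \<Rightarrow> R4) set"
    and B :: "'b set" and X :: "'x set"
    and ud ov :: "'b \<Rightarrow> 'b \<Rightarrow> 'b" and act :: "'x \<Rightarrow> 'b \<Rightarrow> 'x"
    and br :: "'x \<Rightarrow> 'x \<Rightarrow> 'x \<Rightarrow> 'x"
  assumes "surface_link F \<omega>"
    and "connected_diagram_of F \<omega> G \<eta>"
    and "shadow_biquandle B ud ov X act"
    and "strongly_connected B X act"
    and "br = tribracket_of B ov act"
  shows "same_multiset (HH_LB X br G \<eta>)
           (family_image (mu_star X br act 3) (HH_SB B X ud ov act G \<eta>)) \<and>
         same_multiset
           (family_image (mu_star_inv B X ud ov br act 3) (HH_LB X br G \<eta>))
           (HH_SB B X ud ov act G \<eta>) \<and>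
         (\<forall>(A :: ('a, 'm) monoid_scheme) \<theta> \<theta>'.
            comm_group A \<and> \<theta> \<in> Z_SB B X ud ov act 3 A \<and> \<theta>' \<in> Z_LB X br 3 A \<and>
            (\<forall>c\<in>carrier (C_SB B X 3). \<theta> c = \<theta>' (mu X act 3 c)) \<longrightarrow>
            same_multiset (Phi_SB B X ud ov act \<theta> G \<eta>) (Phi_LB X br \<theta>' G \<eta>))"
proof -
  interpret coloured_diagram B ud ov X act br G \<eta>
    by (intro coloured_diagram.intro connected_shadow.intro connected_shadow_axioms.intro
        diagram_of_surface_link[OF assms(1,2)] assms(3-5))
  let ?S = "Col_SB B X ud ov act G \<eta>" and ?L = "Col_LB X br G \<eta>"
  define \<Psi> where "\<Psi> C = sheet_colour (snd C)" for C :: "(R3 set \<Rightarrow> 'b) \<times> (R3 set \<Rightarrow> 'x)"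
  have bij: "bij_betw \<Psi> ?S ?L" using sheet_colour_bij by (simp add: \<Psi>_def[abs_def])
  \<comment> \<open>The first two statements have the local family on the left, so their reindexing
    runs from local to shadow colorings; the last one uses \<Psi> itself.\<close>
  define \<Phi> where "\<Phi> = inv_into ?S \<Psi>"
  have bij': "bij_betw \<Phi> ?L ?S" unfolding \<Phi>_def by (rule bij_betw_inv_into[OF bij])
  have \<Phi>: "\<Phi> L \<in> ?S" "sheet_colour (snd (\<Phi> L)) = L" if "L \<in> ?L" for L
    using bij_betwE[OF bij'] that bij_betw_inv_into_right[OF bij that] by (auto simp: \<Phi>_def \<Psi>_def)
  have "same_multiset (HH_LB X br G \<eta>) (family_image (mu_star X br act 3) (HH_SB B X ud ov act G \<eta>))"
    unfolding same_multiset_def HH_LB_def HH_SB_def family_image_def fst_conv snd_conv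
  proof (intro exI[of _ \<Phi>] conjI ballI)
    fix L assume L: "L \<in> ?L"
    show "(mu_star X br act 3 \<circ> (\<lambda>C. homology_class (C_SB B X) (bd_SB B X ud ov act) 3 (W_SB B X G \<eta> C))) (\<Phi> L)
        = homology_class (C_LB X) (bd_LB X br) 3 (W_LB X G \<eta> L)"
      using homology_correspond(1)[OF \<Phi>(1)[OF L]] by (simp add: \<Phi>(2)[OF L])
  qed (rule bij')
  moreover have "same_multiset (family_image (mu_star_inv B X ud ov br act 3) (HH_LB X br G \<eta>))
      (HH_SB B X ud ov act G \<eta>)"
    unfolding same_multiset_def HH_LB_def HH_SB_def family_image_def fst_conv snd_conv
  proof (intro exI[of _ \<Phi>] conjI ballI)
    fix L assume L: "L \<in> ?L"
    show "homology_class (C_SB B X) (bd_SB B X ud ov act) 3 (W_SB B X G \<eta> (\<Phi> L))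
       = (mu_star_inv B X ud ov br act 3 \<circ> (\<lambda>C. homology_class (C_LB X) (bd_LB X br) 3 (W_LB X G \<eta> C))) L"
      using homology_correspond(2)[OF \<Phi>(1)[OF L]] by (simp add: \<Phi>(2)[OF L])
  qed (rule bij')
  moreover have "same_multiset (Phi_SB B X ud ov act \<theta> G \<eta>) (Phi_LB X br \<theta>' G \<eta>)"
    if "\<forall>c\<in>carrier (C_SB B X 3). \<theta> c = \<theta>' (mu X act 3 c)" for \<theta> :: "_ \<Rightarrow> 'a" and \<theta>'
    unfolding same_multiset_def Phi_SB_def Phi_LB_def fst_conv snd_conv
  proof (intro exI[of _ \<Psi>] conjI ballI)
    fix C assume C: "C \<in> ?S"
    show "\<theta>' (W_LB X G \<eta> (\<Psi> C)) = \<theta> (W_SB B X G \<eta> C)"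
      using that W_correspond[OF C] by (simp add: \<Psi>_def)
  qed (rule bij)
  ultimately show ?thesis by blast
qed

end
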